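(* Assume that $k$ is a field, let $A$ be the monogenic extension of $K$ associated with $\alpha$ and $f$, and assume that there exists $\breve\lambda\in\mathcal Z(K)$ (the center of $K$) such that $\alpha^n(\breve\lambda)=\breve\lambda$ and $\breve\lambda-\alpha^i(\breve\lambda)$ is invertible in $K$ for $1\le i<n$. Assume also that $\alpha$ is diagonalizable, with distinct eigenvalues $\omega_1=1,\omega_2,\dots,\omega_s$. Let $\mathrm{HH}^{K,\omega_h}_*(A)$ denote the homology of $C^{S,\omega_h}(A)$. Then $\mathrm{HH}^K_*(A)=\bigoplus_{h=1}^s\mathrm{HH}^{K,\omega_h}_*(A)$ and, for all $m\ge0$, $$\mathrm{HH}^{K,\omega_h}_0(A)=\begin{cases}\dfrac{K^1}{[K,K]^1}&\text{if } h=1,\\[8pt]\dfrac{K^{\omega_h}}{[K,K]^{\omega_h}+K^{\omega_h}\lambda_n}&\text{if } h\ne1,\end{cases}$$ $$\mathrm{HH}^{K,\omega_h}_{2m+1}(A)=\begin{cases}\dfrac{\{\lambda\in K^{\omega_h}:\lambda\lambda_n\in[K,K]^{\omega_h}_{\alpha^{mn}}\}}{[K,K]^{\omega_h}_{\alpha^{(m+1)n}}}\,x^{n-1}&\text{if } h\ne1\text{ and }\omega_h^n=1,\\[8pt]0&\text{otherwise},\end{cases}$$ $$\mathrm{HH}^{K,\omega_h}_{2m+2}(A)=\begin{cases}\dfrac{K^{\omega_h}}{[K,K]^{\omega_h}_{\alpha^{(m+1)n}}+K^{\omega_h}\lambda_n}&\text{if } h\ne1\text{ and }\omega_h^n=1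,\\[8pt]0&\text{otherwise}.\end{cases}$$
   Context: Setting: $k$ is a commutative ring with $1$ (here a field), $K$ is an associative unital $k$-algebra (not necessarily commutative), $\alpha$ is a $k$-algebra endomorphism of $K$, and $B=K[x,\alpha]$ is the Ore extension: the algebra generated by $K$ and $x$ subject to $x\lambda=\alpha(\lambda)x$ for $\lambda\in K$. Let $f=\sum_{i=0}^n\lambda_ix^{n-i}$ with $\lambda_0=1$, $n\ge 2$, $\lambda_i\in K$, $\alpha(\lambda_i)=\lambda_i$ and $\lambda_i\lambda=\alpha^i(\lambda)\lambda_i$ for all $\lambda\in K$ and $1\le i\le n$. The monogenic extension of $K$ associated with $\alpha$ and $f$ is $A=B/\langle f\rangle$. $[K,K]_{\alpha^j}$ is the $k$-submodule of $K$ generated by all $\lambda'\alpha^j(\lambda)-\lambda\lambda'$ ($\lambda,\lambda'\in K$). $K^{\omega_h}$ is the eigenspace of $\alpha$ of eigenvalue $\omega_h$, $[K,K]^{\omega_h}_{\alpha^r}=K^{\omega_h}\cap[K,K]_{\alpha^r}$ and $[K,K]^{\omega_h}=[K,K]^{\omega_h}_{\alpha^0}$. $C^{S,\omega_h}(A)$ is the chain complex with $C^{S,\omega_h}_{2m}(A)=K^{\omega_h}/[K,K]^{\omega_h}_{\alpha^{mn}}$, $C^{S,\omega_h}_{2m+1}(A)=(K^{\omega_h}/[K,K]^{\omega_h}_{\alpha^{(m+1)n}})x^{n-1}$ ($m\ge0$) and boundary maps $d^{\omega_h}_{2m}([\lambda])=(\sum_{l=0}^{n-1}\omega_h^l)[\lambda]x^{n-1}$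 ($m\ge1$), $d^{\omega_h}_{2m+1}([\lambda]x^{n-1})=(\omega_h-1)[\lambda\lambda_n]$ ($m\ge0$); $x^{n-1}$ is a label recording that classes are represented by elements of $Kx^{n-1}\subseteq A$. $\mathrm{HH}^K_*(A)$ is the Hochschild homology of $A$ relative to $K$ with coefficients in $A$: the homology of the complex $(A\otimes_K\overline A^{\otimes_K^*}\otimes,b)$, where $\overline A=A/K$, $b$ is the canonical Hochschild boundary, and for a $K$-bimodule $N$, $N\otimes$ denotes the quotient of $N$ by the $k$-submodule generated by all $m\lambda-\lambda m$ ($m\in N,\lambda\in K$). *)

theory Defs
  imports
    "HOL-Library.FuncSet"
    "HOL-Library.Poly_Mapping"
    "HOL-Computational_Algebra.Polynomial"
    "HOL-Algebra.QuotRing"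
    "HOL-Algebra.Module"
begin

text \<open>
  The field \<open>k\<close> and the \<open>k\<close>-algebra \<open>K\<close> are types \<open>'k::field\<close> and \<open>'a::ring_1\<close>. (That
  \<open>ring_1\<close> excludes the zero ring loses nothing: below, \<open>1\<close> is an eigenvalue of an
  endomorphism of \<open>K\<close>.) Objects built from them are records with a carrier. In this
  theory the HOL-Algebra record type \<open>module\<close> serves for \<open>k\<close>-algebras, and also for
  \<open>k\<close>-vector spaces, in which case the fields \<open>mult\<close> and \<open>one\<close> are irrelevant.
\<close>


section \<open>Vector spaces with a carrier\<close>

definition subspace_module :: "('k \<Rightarrow> 'v::ab_group_add \<Rightarrow> 'v) \<Rightarrow> 'v set \<Rightarrow> ('k, 'v) module" where
  "subspace_module sc S =
     \<lparr>carrier = S, mult = undefined, one = undefined, zero = 0, add = (+), smult = sc\<rparr>"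

text \<open>The quotient of \<open>M\<close> by a subspace (or, for algebras, by a two-sided ideal) \<open>N\<close>:
  the library quotient, extended by scalar multiplication of cosets.\<close>

definition quotient_module :: "('k, 'v) module \<Rightarrow> 'v set \<Rightarrow> ('k, 'v set) module" where
  "quotient_module M N =
     ring.extend (M Quot N) (module.fields (\<lambda>c X. \<Union>x\<in>X. N +>\<^bsub>M\<^esub> (c \<odot>\<^bsub>M\<^esub> x)))"

text \<open>The map into \<open>M' / N'\<close> that a map \<open>g\<close> into \<open>M'\<close> induces on cosets. The union is a
  single coset whenever \<open>g\<close> is compatible with the two quotients.\<close>

definition induced_map :: "('k, 'w) module \<Rightarrow> 'w set \<Rightarrow> ('v \<Rightarrow> 'w) \<Rightarrow> 'v set \<Rightarrow> 'w set" where
  "induced_map M' N' g X = (\<Union>x\<in>X. N' +>\<^bsub>M'\<^esub> g x)"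

definition module_isomorphism ::
    "('k, 'v) module \<Rightarrow> ('k, 'w) module \<Rightarrow> ('v \<Rightarrow> 'w) \<Rightarrow> bool" where
  "module_isomorphism M N \<phi> \<longleftrightarrow>
     bij_betw \<phi> (carrier M) (carrier N) \<and>
     (\<forall>x\<in>carrier M. \<forall>y\<in>carrier M. \<phi> (x \<oplus>\<^bsub>M\<^esub> y) = \<phi> x \<oplus>\<^bsub>N\<^esub> \<phi> y) \<and>
     (\<forall>c. \<forall>x\<in>carrier M. \<phi> (c \<odot>\<^bsub>M\<^esub> x) = c \<odot>\<^bsub>N\<^esub> \<phi> x)"

definition direct_sum_module :: "'i set \<Rightarrow> ('i \<Rightarrow> ('k, 'v) module) \<Rightarrow> ('k, 'i \<Rightarrow> 'v) module" where
  "direct_sum_module I M =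
     \<lparr>carrier = {x \<in> \<Pi>\<^sub>E i\<in>I. carrier (M i). finite {i \<in> I. x i \<noteq> \<zero>\<^bsub>M i\<^esub>}},
      mult = undefined, one = undefined,
      zero = (\<lambda>i\<in>I. \<zero>\<^bsub>M i\<^esub>),
      add = (\<lambda>x y. \<lambda>i\<in>I. x i \<oplus>\<^bsub>M i\<^esub> y i),
      smult = (\<lambda>c x. \<lambda>i\<in>I. c \<odot>\<^bsub>M i\<^esub> x i)\<rparr>"

text \<open>Homology of a chain complex \<open>\<dots> \<rightarrow> C 1 \<rightarrow> C 0 \<rightarrow> 0\<close>, with \<open>d r\<close> mapping \<open>C r\<close> to
  \<open>C (r - 1)\<close> for \<open>r \<ge> 1\<close>; the value of \<open>d 0\<close> is never used.\<close>

definition cycles :: "(nat \<Rightarrow> ('k, 'v) module) \<Rightarrow> (nat \<Rightarrow> 'v \<Rightarrow> 'v) \<Rightarrow> nat \<Rightarrow> 'v set" where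
  "cycles C d r = {z \<in> carrier (C r). r = 0 \<or> d r z = \<zero>\<^bsub>C (r - 1)\<^esub>}"

definition boundaries :: "(nat \<Rightarrow> ('k, 'v) module) \<Rightarrow> (nat \<Rightarrow> 'v \<Rightarrow> 'v) \<Rightarrow> nat \<Rightarrow> 'v set" where
  "boundaries C d r = d (Suc r) ` carrier (C (Suc r))"

definition homology_module ::
    "(nat \<Rightarrow> ('k, 'v) module) \<Rightarrow> (nat \<Rightarrow> 'v \<Rightarrow> 'v) \<Rightarrow> nat \<Rightarrow> ('k, 'v set) module" where
  "homology_module C d r = quotient_module ((C r)\<lparr>carrier := cycles C d r\<rparr>) (boundaries C d r)"


section \<open>Algebras, endomorphisms and diagonalizability\<close>

locale k_algebra = vector_space scale
  for scale :: "'k::field \<Rightarrow> 'a::ring_1 \<Rightarrow> 'a" +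
  assumes scale_mult_left: "scale c x * y = scale c (x * y)"
    and scale_mult_right: "x * scale c y = scale c (x * y)"

definition algebra_endomorphism ::
    "('k::field \<Rightarrow> 'a::ring_1 \<Rightarrow> 'a) \<Rightarrow> ('a \<Rightarrow> 'a) \<Rightarrow> bool" where
  "algebra_endomorphism scale \<alpha> \<longleftrightarrow>
     Vector_Spaces.linear scale scale \<alpha> \<and> \<alpha> 1 = 1 \<and> (\<forall>x y. \<alpha> (x * y) = \<alpha> x * \<alpha> y)"

definition invertible_element :: "'a::ring_1 \<Rightarrow> bool" where
  "invertible_element u \<longleftrightarrow> (\<exists>v. u * v = 1 \<and> v * u = 1)"

definition ring_center :: "'a::ring_1 set" where
  "ring_center = {z. \<forall>y. z * y = y * z}"

definition eigenspace :: "('k::field \<Rightarrow> 'a::ring_1 \<Rightarrow> 'a) \<Rightarrow> ('a \<Rightarrow> 'a) \<Rightarrow> 'k \<Rightarrow> 'a set" where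
  "eigenspace scale \<alpha> c = {v. \<alpha> v = scale c v}"

definition eigenvalues :: "('k::field \<Rightarrow> 'a::ring_1 \<Rightarrow> 'a) \<Rightarrow> ('a \<Rightarrow> 'a) \<Rightarrow> 'k set" where
  "eigenvalues scale \<alpha> = {c. \<exists>v. v \<noteq> 0 \<and> \<alpha> v = scale c v}"

text \<open>There is a basis (possibly infinite) consisting of eigenvectors.\<close>

definition diagonalizable :: "('k::field \<Rightarrow> 'a::ring_1 \<Rightarrow> 'a) \<Rightarrow> ('a \<Rightarrow> 'a) \<Rightarrow> bool" where
  "diagonalizable scale \<alpha> \<longleftrightarrow>
     (\<exists>E. \<not> Modules.module.dependent scale E \<and> Modules.module.span scale E = UNIV \<and>
          (\<forall>v\<in>E. \<exists>c. \<alpha> v = scale c v))"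


section \<open>Ore extensions and monogenic extensions\<close>

text \<open>The Ore extension \<open>K[x, \<alpha>]\<close>: the polynomial \<open>\<Sum>i. a\<^sub>i x\<^sup>i\<close>, coefficients on the left,
  with the multiplication determined by \<open>x \<cdot> \<lambda> = \<alpha>(\<lambda>) x\<close>, that is
  \<open>(a x\<^sup>i) (b x\<^sup>j) = a \<alpha>\<^sup>i(b) x\<^sup>i\<^sup>+\<^sup>j\<close>.\<close>

definition ore_mult :: "('a::ring_1 \<Rightarrow> 'a) \<Rightarrow> 'a poly \<Rightarrow> 'a poly \<Rightarrow> 'a poly" where
  "ore_mult \<alpha> p q =
     (\<Sum>i\<le>degree p. \<Sum>j\<le>degree q. monom (coeff p i * (\<alpha> ^^ i) (coeff q j)) (i + j))"

definition ore_extension ::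
    "('k::field \<Rightarrow> 'a::ring_1 \<Rightarrow> 'a) \<Rightarrow> ('a \<Rightarrow> 'a) \<Rightarrow> ('k, 'a poly) module" where
  "ore_extension scale \<alpha> =
     \<lparr>carrier = UNIV, mult = ore_mult \<alpha>, one = [:1:], zero = 0, add = (+),
      smult = (\<lambda>c. map_poly (scale c))\<rparr>"

definition monogenic_poly :: "nat \<Rightarrow> (nat \<Rightarrow> 'a::ring_1) \<Rightarrow> 'a poly" where
  "monogenic_poly n lam = (\<Sum>i\<le>n. monom (lam i) (n - i))"

definition monogenic_ideal ::
    "('k::field \<Rightarrow> 'a::ring_1 \<Rightarrow> 'a) \<Rightarrow> ('a \<Rightarrow> 'a) \<Rightarrow> nat \<Rightarrow> (nat \<Rightarrow> 'a) \<Rightarrow> 'a poly set" where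
  "monogenic_ideal scale \<alpha> n lam = Idl\<^bsub>ore_extension scale \<alpha>\<^esub> {monogenic_poly n lam}"

definition monogenic_extension ::
    "('k::field \<Rightarrow> 'a::ring_1 \<Rightarrow> 'a) \<Rightarrow> ('a \<Rightarrow> 'a) \<Rightarrow> nat \<Rightarrow> (nat \<Rightarrow> 'a) \<Rightarrow> ('k, 'a poly set) module"
  where
  "monogenic_extension scale \<alpha> n lam =
     quotient_module (ore_extension scale \<alpha>) (monogenic_ideal scale \<alpha> n lam)"

definition monogenic_incl ::
    "('k::field \<Rightarrow> 'a::ring_1 \<Rightarrow> 'a) \<Rightarrow> ('a \<Rightarrow> 'a) \<Rightarrow> nat \<Rightarrow> (nat \<Rightarrow> 'a) \<Rightarrow> 'a \<Rightarrow> 'a poly set" where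
  "monogenic_incl scale \<alpha> n lam y =
     monogenic_ideal scale \<alpha> n lam +>\<^bsub>ore_extension scale \<alpha>\<^esub> [:y:]"


section \<open>Relative Hochschild homology\<close>

text \<open>
  For a \<open>k\<close>-algebra \<open>A\<close> and an algebra map \<open>\<iota>\<close> from \<open>K\<close> to \<open>A\<close>, the space of \<open>r\<close>-chains
  \<open>A \<otimes>\<^sub>K (A/K)\<^bsup>\<otimes>r\<^esup> \<otimes>\<close> is presented as the free vector space on the tuples
  \<open>(a\<^sub>0, \<dots>, a\<^sub>r)\<close> of elements of \<open>A\<close> (lists of length \<open>r + 1\<close>) modulo the relations that
  make tuples \<open>k\<close>-multilinear and \<open>K\<close>-balanced at each of the \<open>r\<close> inner tensor signs
  and at the final, cyclic one, and that kill the tuples with some \<open>a\<^sub>i\<close>, \<open>i \<ge> 1\<close>, in the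
  image of \<open>K\<close>. The last family generates the kernel of
  \<open>A \<otimes>\<^sub>K A\<^bsup>\<otimes>r\<^esup> \<otimes> \<rightarrow> A \<otimes>\<^sub>K (A/K)\<^bsup>\<otimes>r\<^esup> \<otimes>\<close>.
\<close>

definition free_scale :: "'k::field \<Rightarrow> ('b \<Rightarrow>\<^sub>0 'k) \<Rightarrow> ('b \<Rightarrow>\<^sub>0 'k)" where
  "free_scale c = Poly_Mapping.map ((*) c)"

definition tup :: "'b list \<Rightarrow> ('b list \<Rightarrow>\<^sub>0 'k::field)" where
  "tup t = Poly_Mapping.single t 1"

definition tuples :: "('k, 'b) module \<Rightarrow> nat \<Rightarrow> 'b list set" where
  "tuples A r = {t. length t = Suc r \<and> set t \<subseteq> carrier A}"

definition free_chains :: "('k::field, 'b) module \<Rightarrow> nat \<Rightarrow> ('k, 'b list \<Rightarrow>\<^sub>0 'k) module" where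
  "free_chains A r = subspace_module free_scale {c. Poly_Mapping.keys c \<subseteq> tuples A r}"

definition tensor_relations ::
    "('k::field, 'b) module \<Rightarrow> ('a \<Rightarrow> 'b) \<Rightarrow> nat \<Rightarrow> ('b list \<Rightarrow>\<^sub>0 'k) set" where
  "tensor_relations A \<iota> r = Modules.module.span free_scale
     ({tup (t[i := a \<oplus>\<^bsub>A\<^esub> a']) - tup (t[i := a]) - tup (t[i := a']) |t i a a'.
         t \<in> tuples A r \<and> i \<le> r \<and> a \<in> carrier A \<and> a' \<in> carrier A} \<union>
      {tup (t[i := c \<odot>\<^bsub>A\<^esub> t ! i]) - free_scale c (tup t) |t i c.
         t \<in> tuples A r \<and> i \<le> r} \<union>
      {tup (t[i := t ! i \<otimes>\<^bsub>A\<^esub> \<iota> y]) - tup (t[Suc i := \<iota> y \<otimes>\<^bsub>A\<^esub> t ! Suc i]) |t i y.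
         t \<in> tuples A r \<and> i < r} \<union>
      {tup (t[r := t ! r \<otimes>\<^bsub>A\<^esub> \<iota> y]) - tup (t[0 := \<iota> y \<otimes>\<^bsub>A\<^esub> t ! 0]) |t y.
         t \<in> tuples A r} \<union>
      {tup t |t i. t \<in> tuples A r \<and> 1 \<le> i \<and> i \<le> r \<and> t ! i \<in> range \<iota>})"

definition hochschild_chains ::
    "('k::field, 'b) module \<Rightarrow> ('a \<Rightarrow> 'b) \<Rightarrow> nat \<Rightarrow> ('k, ('b list \<Rightarrow>\<^sub>0 'k) set) module" where
  "hochschild_chains A \<iota> r = quotient_module (free_chains A r) (tensor_relations A \<iota> r)"

text \<open>\<open>b(a\<^sub>0 \<otimes> \<dots> \<otimes> a\<^sub>r) = (\<Sum>i<r. (-1)\<^sup>i a\<^sub>0 \<otimes> \<dots> \<otimes> a\<^sub>i a\<^sub>i\<^sub>+\<^sub>1 \<otimes> \<dots> \<otimes> a\<^sub>r)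
  + (-1)\<^sup>r a\<^sub>r a\<^sub>0 \<otimes> a\<^sub>1 \<otimes> \<dots> \<otimes> a\<^sub>r\<^sub>-\<^sub>1\<close>\<close>

definition tuple_boundary ::
    "('k::field, 'b) module \<Rightarrow> nat \<Rightarrow> 'b list \<Rightarrow> ('b list \<Rightarrow>\<^sub>0 'k)" where
  "tuple_boundary A r t =
     (\<Sum>i<r. free_scale ((-1) ^ i)
        (tup (take i t @ [t ! i \<otimes>\<^bsub>A\<^esub> t ! Suc i] @ drop (Suc (Suc i)) t))) +
     free_scale ((-1) ^ r) (tup ((t ! r \<otimes>\<^bsub>A\<^esub> t ! 0) # butlast (tl t)))"

definition free_boundary ::
    "('k::field, 'b) module \<Rightarrow> nat \<Rightarrow> ('b list \<Rightarrow>\<^sub>0 'k) \<Rightarrow> ('b list \<Rightarrow>\<^sub>0 'k)" where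
  "free_boundary A r c =
     (\<Sum>t\<in>Poly_Mapping.keys c. free_scale (Poly_Mapping.lookup c t) (tuple_boundary A r t))"

definition hochschild_boundary ::
    "('k::field, 'b) module \<Rightarrow> ('a \<Rightarrow> 'b) \<Rightarrow> nat \<Rightarrow>
     ('b list \<Rightarrow>\<^sub>0 'k) set \<Rightarrow> ('b list \<Rightarrow>\<^sub>0 'k) set" where
  "hochschild_boundary A \<iota> r =
     induced_map (free_chains A (r - 1)) (tensor_relations A \<iota> (r - 1)) (free_boundary A r)"

definition relative_HH ::
    "('k::field, 'b) module \<Rightarrow> ('a \<Rightarrow> 'b) \<Rightarrow> nat \<Rightarrow> ('k, ('b list \<Rightarrow>\<^sub>0 'k) set set) module" where
  "relative_HH A \<iota> = homology_module (hochschild_chains A \<iota>) (hochschild_boundary A \<iota>)"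


section \<open>The eigenspace complexes\<close>

text \<open>\<open>[K,K]\<close> twisted by \<open>\<alpha>\<^sup>j\<close>, and its part in the \<open>c\<close>-eigenspace.\<close>

definition twisted_commutators ::
    "('k::field \<Rightarrow> 'a::ring_1 \<Rightarrow> 'a) \<Rightarrow> ('a \<Rightarrow> 'a) \<Rightarrow> nat \<Rightarrow> 'a set" where
  "twisted_commutators scale \<alpha> j =
     Modules.module.span scale {y' * (\<alpha> ^^ j) y - y * y' |y y'. True}"

definition eigen_commutators ::
    "('k::field \<Rightarrow> 'a::ring_1 \<Rightarrow> 'a) \<Rightarrow> ('a \<Rightarrow> 'a) \<Rightarrow> 'k \<Rightarrow> nat \<Rightarrow> 'a set" where
  "eigen_commutators scale \<alpha> c j = eigenspace scale \<alpha> c \<inter> twisted_commutators scale \<alpha> j"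

text \<open>The power of \<open>\<alpha>\<close> that occurs in degree \<open>r\<close>: \<open>m n\<close> for \<open>r = 2 m\<close> and
  \<open>(m + 1) n\<close> for \<open>r = 2 m + 1\<close>.\<close>

definition eigen_twist :: "nat \<Rightarrow> nat \<Rightarrow> nat" where
  "eigen_twist n r = (if even r then (r div 2) * n else (r div 2 + 1) * n)"

text \<open>In odd degrees the formal label \<open>x\<^sup>n\<^sup>-\<^sup>1\<close> attached to the classes is omitted; it does
  not affect the vector spaces or the maps.\<close>

definition eigen_chains ::
    "('k::field \<Rightarrow> 'a::ring_1 \<Rightarrow> 'a) \<Rightarrow> ('a \<Rightarrow> 'a) \<Rightarrow> nat \<Rightarrow> 'k \<Rightarrow> nat \<Rightarrow> ('k, 'a set) module" where
  "eigen_chains scale \<alpha> n c r =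
     quotient_module (subspace_module scale (eigenspace scale \<alpha> c))
       (eigen_commutators scale \<alpha> c (eigen_twist n r))"

definition eigen_boundary ::
    "('k::field \<Rightarrow> 'a::ring_1 \<Rightarrow> 'a) \<Rightarrow> ('a \<Rightarrow> 'a) \<Rightarrow> nat \<Rightarrow> (nat \<Rightarrow> 'a) \<Rightarrow> 'k \<Rightarrow> nat \<Rightarrow> 'a set \<Rightarrow> 'a set"
  where
  "eigen_boundary scale \<alpha> n lam c r =
     induced_map (subspace_module scale (eigenspace scale \<alpha> c))
       (eigen_commutators scale \<alpha> c (eigen_twist n (r - 1)))
       (if even r then (\<lambda>y. scale (\<Sum>l<n. c ^ l) y) else (\<lambda>y. scale (c - 1) (y * lam n)))"

definition eigen_HH ::
    "('k::field \<Rightarrow> 'a::ring_1 \<Rightarrow> 'a) \<Rightarrow> ('a \<Rightarrow> 'a) \<Rightarrow> nat \<Rightarrow> (nat \<Rightarrow> 'a) \<Rightarrow> 'k \<Rightarrow> nat \<Rightarrow>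
     ('k, 'a set set) module" where
  "eigen_HH scale \<alpha> n lam c =
     homology_module (eigen_chains scale \<alpha> n c) (eigen_boundary scale \<alpha> n lam c)"

text \<open>The homology class of the class of \<open>y\<close> in the chain space of degree \<open>r\<close>.\<close>

definition eigen_class ::
    "('k::field \<Rightarrow> 'a::ring_1 \<Rightarrow> 'a) \<Rightarrow> ('a \<Rightarrow> 'a) \<Rightarrow> nat \<Rightarrow> (nat \<Rightarrow> 'a) \<Rightarrow> 'k \<Rightarrow> nat \<Rightarrow> 'a \<Rightarrow> 'a set set"
  where
  "eigen_class scale \<alpha> n lam c r y =
     boundaries (eigen_chains scale \<alpha> n c) (eigen_boundary scale \<alpha> n lam c) r
       +>\<^bsub>eigen_chains scale \<alpha> n c r\<^esub>
     (eigen_commutators scale \<alpha> c (eigen_twist n r)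
       +>\<^bsub>subspace_module scale (eigenspace scale \<alpha> c)\<^esub> y)"

text \<open>\<open>eigen_HH\<close> in degree \<open>r\<close> is \<open>Z / N\<close>, for subspaces \<open>N \<subseteq> Z\<close> of the \<open>c\<close>-eigenspace,
  through the identification that sends the class of \<open>y\<close> to the class of \<open>y\<close>.\<close>

definition eigen_HH_equals ::
    "('k::field \<Rightarrow> 'a::ring_1 \<Rightarrow> 'a) \<Rightarrow> ('a \<Rightarrow> 'a) \<Rightarrow> nat \<Rightarrow> (nat \<Rightarrow> 'a) \<Rightarrow> 'k \<Rightarrow> nat \<Rightarrow>
     'a set \<Rightarrow> 'a set \<Rightarrow> bool" where
  "eigen_HH_equals scale \<alpha> n lam c r Z N \<longleftrightarrow>
     N \<subseteq> Z \<and>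
     (\<exists>\<phi>. module_isomorphism (eigen_HH scale \<alpha> n lam c r)
            (quotient_module (subspace_module scale Z) N) \<phi> \<and>
          (\<forall>y\<in>Z. \<phi> (eigen_class scale \<alpha> n lam c r y) = N +>\<^bsub>subspace_module scale Z\<^esub> y))"

definition module_is_zero :: "('k, 'v) module \<Rightarrow> bool" where
  "module_is_zero M \<longleftrightarrow> carrier M = {\<zero>\<^bsub>M\<^esub>}"

end

theory Submission
  imports Defs
begin

text \<open>
  Two consequences of the existence of the central element \<open>z\<close> make the computation possible.
  Comparing \<open>lam i * z = z * lam i\<close> with \<open>lam i * z = \<alpha>\<^sup>i(z) * lam i\<close> shows that \<open>lam i = 0\<close> for
  \<open>0 < i < n\<close>, so that \<open>A\<close> is the quotient of the Ore extension by \<open>x\<^sup>n - q\<close> with \<open>q = - lam n\<close>, and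
  is free over \<open>K\<close> on \<open>1, x, \<dots>, x\<^sup>n\<^sup>-\<^sup>1\<close> (\<open>lam_middle_zero\<close>, \<open>red_I\<close>). And the twisted commutators
  of \<open>\<alpha>\<^sup>j\<close> are all of \<open>K\<close> unless \<open>n\<close> divides \<open>j\<close> (\<open>N_trivial\<close>).

  Moving all scalars to the left writes a chain of degree \<open>r\<close> as a combination of the tensors
  \<open>y x\<^sup>i\<^sup>0 \<otimes> x\<^sup>i\<^sup>1 \<otimes> \<dots> \<otimes> x\<^sup>i\<^sup>r\<close>, with exponents below \<open>n\<close> that are positive except possibly the first.
  The coefficient \<open>y\<close> at an index word \<open>i\<close> is determined modulo the commutators twisted by the sum
  of \<open>i\<close>, and a free chain is zero in the tensor product exactly if all its coefficients are
  such commutators (\<open>Theta_R\<close>, \<open>R_if_Theta\<close>). In these coordinates the Hochschild boundary merges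
  neighbouring exponents; read off at a given word, it collects the coefficients at all words
  that arise by splitting one exponent (\<open>Theta_bd\<close>).

  The homology is then found by a discrete Morse argument. Read a word \<open>i\<^sub>1, \<dots>, i\<^sub>r\<close> from the left and
  strip pairs \<open>1, n - 1\<close>. If an exponent \<open>c \<ge> 2\<close> comes next, match the word with the longer one in
  which \<open>c\<close> is replaced by \<open>1, c - 1\<close>. The boundary, restricted to matched words, is triangular
  with diagonal entries \<open>-1\<close> for the order by exponent sum and then lexicographically
  (\<open>bsplit_triangular\<close>). Only the words \<open>1, n - 1, 1, n - 1, \<dots>\<close> are unmatched; they contribute one
  copy of \<open>K\<close> modulo twisted commutators in each degree, the chains of the small complex. The
  inverse of the triangular system need not be computed, because there is an explicit chain
  map \<open>small_to_bar\<close> from the small complex whose values have no coefficients at the words that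
  are matched with longer ones (\<open>chain_map\<close>, \<open>Theta_small_to_bar_redundant\<close>). It follows that each cycle
  is homologous to a value of \<open>small_to_bar\<close>, and that such a value bounds only if it bounds in
  the small complex (\<open>small_to_bar_onto\<close>, \<open>small_to_bar_boundary\<close>).

  Diagonalizability of \<open>\<alpha>\<close> splits the small complex into its eigenspace complexes
  (\<open>direct_sum_presents\<close>). In the one for an eigenvalue \<open>c\<close>, the boundaries are alternately
  multiplication by the scalar \<open>1 + c + \<dots> + c\<^sup>n\<^sup>-\<^sup>1\<close> and by \<open>(c - 1) lam n\<close>. The scalar vanishes
  precisely if \<open>c \<noteq> 1\<close> and \<open>c\<^sup>n = 1\<close>; for \<open>c = 1\<close> this uses that \<open>n\<close> is not zero in the field, which
  is again forced by \<open>z\<close> (\<open>n_nonzero\<close>).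
\<close>

section \<open>Presented quotients and the homology of quotient complexes\<close>

text \<open>Elements of the homology of a complex of quotients are sets of sets. The following predicate
  replaces them by representatives in a single ambient space: \<open>cl\<close> takes the class of a
  representative, and \<open>B\<close> is the kernel of \<open>cl\<close> on the space \<open>Z\<close> of all representatives.\<close>

definition presents ::
    "('k, 'm) module \<Rightarrow> ('k::field \<Rightarrow> 'v::ab_group_add \<Rightarrow> 'v) \<Rightarrow> 'v set \<Rightarrow> 'v set \<Rightarrow> ('v \<Rightarrow> 'm) \<Rightarrow> bool"
  where
  "presents M sc Z B cl \<longleftrightarrow>
     Modules.module.subspace sc Z \<and> Modules.module.subspace sc B \<and> carrier M = cl ` Z \<and>
     (\<forall>x\<in>Z. \<forall>y\<in>Z. cl x = cl y \<longleftrightarrow> x - y \<in> B) \<and>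
     (\<forall>x\<in>Z. \<forall>y\<in>Z. cl (x + y) = cl x \<oplus>\<^bsub>M\<^esub> cl y) \<and>
     (\<forall>c. \<forall>x\<in>Z. cl (sc c x) = c \<odot>\<^bsub>M\<^esub> cl x) \<and>
     \<zero>\<^bsub>M\<^esub> = cl 0"

lemma quotient_module_simps:
  shows "carrier (quotient_module M N) = (\<lambda>x. N +>\<^bsub>M\<^esub> x) ` carrier M"
    and "X \<oplus>\<^bsub>quotient_module M N\<^esub> Y = (\<Union>x\<in>X. \<Union>y\<in>Y. {x \<oplus>\<^bsub>M\<^esub> y})"
    and "\<zero>\<^bsub>quotient_module M N\<^esub> = N"
    and "c \<odot>\<^bsub>quotient_module M N\<^esub> X = (\<Union>x\<in>X. N +>\<^bsub>M\<^esub> (c \<odot>\<^bsub>M\<^esub> x))"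
    and "X \<otimes>\<^bsub>quotient_module M N\<^esub> Y = (\<Union>x\<in>X. \<Union>y\<in>Y. N +>\<^bsub>M\<^esub> (x \<otimes>\<^bsub>M\<^esub> y))"
  by (auto simp: quotient_module_def ring.defs module.defs FactRing_def A_RCOSETS_def' a_r_coset_def'
      set_add_def' rcoset_mult_def)

lemma subspace_module_simps [simp]:
  "carrier (subspace_module sc S) = S"
  "x \<oplus>\<^bsub>subspace_module sc S\<^esub> y = x + y"
  "\<zero>\<^bsub>subspace_module sc S\<^esub> = 0"
  "c \<odot>\<^bsub>subspace_module sc S\<^esub> x = sc c x"
  by (simp_all add: subspace_module_def)

lemma subspace_module_update [simp]:
  "(subspace_module sc S)\<lparr>carrier := T\<rparr> = subspace_module sc T"
  by (simp add: subspace_module_def)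

lemma a_r_coset_subspace_module:
  "N +>\<^bsub>subspace_module sc S\<^esub> x = (\<lambda>y. y + x) ` N"
  by (auto simp: a_r_coset_def')

context vector_space
begin

lemma presents_subspace_module:
  "subspace S \<Longrightarrow> presents (subspace_module scale S) scale S {0} (\<lambda>x. x)"
  by (auto simp: presents_def subspace_def)

text \<open>The coset of \<open>cl x\<close> modulo \<open>cl ` B\<close> is the image under \<open>cl\<close> of the coset of \<open>x\<close> modulo \<open>B\<close>. Hence
  iterating a quotient adds up the two kernels in the ambient space.\<close>

lemma presents_quotient:
  assumes P: "presents M scale S N cl"
    and Z: "subspace Z" "Z \<subseteq> S" and B: "subspace B" "B \<subseteq> S"
  shows "presents (quotient_module (M\<lparr>carrier := cl ` Z\<rparr>) (cl ` B)) scale Z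
           {b + v |b v. b \<in> B \<and> v \<in> N} (\<lambda>x. cl ` B +>\<^bsub>M\<^esub> cl x)"
proof -
  let ?Q = "quotient_module (M\<lparr>carrier := cl ` Z\<rparr>) (cl ` B)"
  let ?D = "{b + v |b v. b \<in> B \<and> v \<in> N}"
  let ?cl = "\<lambda>x. cl ` B +>\<^bsub>M\<^esub> cl x"
  have S: "subspace S" and N: "subspace N"
    and eq: "\<And>x y. x \<in> S \<Longrightarrow> y \<in> S \<Longrightarrow> cl x = cl y \<longleftrightarrow> x - y \<in> N"
    and add: "\<And>x y. x \<in> S \<Longrightarrow> y \<in> S \<Longrightarrow> cl (x + y) = cl x \<oplus>\<^bsub>M\<^esub> cl y"
    and sm: "\<And>c x. x \<in> S \<Longrightarrow> cl (scale c x) = c \<odot>\<^bsub>M\<^esub> cl x"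
    and zero: "\<zero>\<^bsub>M\<^esub> = cl 0"
    using P by (auto simp: presents_def)
  have coset: "?cl x = (\<lambda>b. cl (b + x)) ` B" if "x \<in> S" for x
  proof -
    have "?cl x = (\<lambda>b. cl b \<oplus>\<^bsub>M\<^esub> cl x) ` B"
      by (auto simp: a_r_coset_def')
    also have "\<dots> = (\<lambda>b. cl (b + x)) ` B"
      using that B by (intro image_cong) (auto simp: add)
    finally show ?thesis .
  qed
  have coset': "cl ` B +>\<^bsub>M\<lparr>carrier := cl ` Z\<rparr>\<^esub> u = cl ` B +>\<^bsub>M\<^esub> u" for u
    by (simp add: a_r_coset_def')
  have mem: "x + y \<in> S" if "x \<in> S" "y \<in> S" for x y
    using S that by (rule subspace_add)
  have cl_eq: "?cl x = ?cl y \<longleftrightarrow> x - y \<in> ?D" if xy: "x \<in> S" "y \<in> S" for x y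
  proof
    assume "?cl x = ?cl y"
    moreover have "cl (0 + x) \<in> ?cl x"
      unfolding coset[OF xy(1)] using subspace_0[OF B(1)] by blast
    ultimately obtain b where b: "b \<in> B" "cl (0 + x) = cl (b + y)"
      unfolding coset[OF xy(2)] by auto
    then have "x - (b + y) \<in> N"
      using eq[of "0 + x" "b + y"] xy B mem by auto
    moreover have "x - y = b + (x - (b + y))" by simp
    ultimately show "x - y \<in> ?D" using b(1) by blast
  next
    assume "x - y \<in> ?D"
    then obtain b v where bv: "b \<in> B" "v \<in> N" "x - y = b + v" by blast
    have key: "cl (c + x) = cl ((c + b) + y)" if c: "c \<in> B" for c
    proof -
      have "c + x - ((c + b) + y) = v" using bv(3) by (simp add: algebra_simps)
      moreover have "c + x \<in> S" "(c + b) + y \<in> S"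
        using c bv(1) xy B by (auto intro!: mem)
      ultimately show ?thesis using eq bv(2) by metis
    qed
    have "(\<lambda>b. cl (b + x)) ` B = (\<lambda>b. cl (b + y)) ` B"
    proof (intro equalityI subsetI)
      fix u assume "u \<in> (\<lambda>b. cl (b + x)) ` B"
      then show "u \<in> (\<lambda>b. cl (b + y)) ` B"
        using key bv(1) subspace_add[OF B(1)] by auto
    next
      fix u assume "u \<in> (\<lambda>b. cl (b + y)) ` B"
      then obtain c where c: "c \<in> B" "u = cl (c + y)" by auto
      then have "u = cl ((c - b) + x)"
        using key[of "c - b"] bv(1) subspace_diff[OF B(1)] by simp
      then show "u \<in> (\<lambda>b. cl (b + x)) ` B"
        using c bv(1) subspace_diff[OF B(1)] by blast
    qed
    then show "?cl x = ?cl y" by (simp add: coset xy)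
  qed
  have plus: "?cl (x + y) = ?cl x \<oplus>\<^bsub>?Q\<^esub> ?cl y" if xy: "x \<in> S" "y \<in> S" for x y
  proof -
    have "?cl x \<oplus>\<^bsub>?Q\<^esub> ?cl y = (\<Union>b\<in>B. \<Union>c\<in>B. {cl (b + x) \<oplus>\<^bsub>M\<^esub> cl (c + y)})"
      by (auto simp: quotient_module_simps coset xy)
    also have "\<dots> = (\<Union>b\<in>B. \<Union>c\<in>B. {cl ((b + c) + (x + y))})"
    proof (intro SUP_cong refl)
      fix b c assume "b \<in> B" "c \<in> B"
      then have "b + x \<in> S" "c + y \<in> S" using xy B by (auto intro!: mem)
      from add[OF this] show "{cl (b + x) \<oplus>\<^bsub>M\<^esub> cl (c + y)} = {cl ((b + c) + (x + y))}"
        by (simp add: algebra_simps)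
    qed
    also have "\<dots> = (\<lambda>b. cl (b + (x + y))) ` B"
    proof (intro equalityI subsetI)
      fix u assume "u \<in> (\<lambda>b. cl (b + (x + y))) ` B"
      then obtain b where "b \<in> B" "u = cl ((b + 0) + (x + y))" by auto
      then show "u \<in> (\<Union>b\<in>B. \<Union>c\<in>B. {cl ((b + c) + (x + y))})"
        using subspace_0[OF B(1)] by blast
    qed (use subspace_add[OF B(1)] in blast)
    finally show ?thesis by (simp add: coset xy mem)
  qed
  have smult: "?cl (scale c x) = c \<odot>\<^bsub>?Q\<^esub> ?cl x" if x: "x \<in> S" for x c
  proof -
    have cx: "scale c x \<in> S" using S x by (rule subspace_scale)
    have "c \<odot>\<^bsub>?Q\<^esub> ?cl x = (\<Union>b\<in>B. cl ` B +>\<^bsub>M\<^esub> (c \<odot>\<^bsub>M\<^esub> cl (b + x)))"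
      by (auto simp: quotient_module_simps coset coset' x)
    also have "\<dots> = (\<Union>b\<in>B. ?cl (scale c x))"
    proof (intro SUP_cong refl)
      fix b assume b: "b \<in> B"
      have "scale c b \<in> B" using B(1) b by (rule subspace_scale)
      moreover have "scale c (b + x) - scale c x = scale c b + 0"
        by (simp add: scale_right_distrib)
      ultimately have "scale c (b + x) - scale c x \<in> ?D"
        using subspace_0[OF N] by blast
      then have "?cl (scale c (b + x)) = ?cl (scale c x)"
        using cl_eq[of "scale c (b + x)" "scale c x"] b x B mem cx subspace_scale[OF S] by blast
      moreover have "c \<odot>\<^bsub>M\<^esub> cl (b + x) = cl (scale c (b + x))"
        using sm[of "b + x" c] b x B mem by auto
      ultimately show "cl ` B +>\<^bsub>M\<^esub> (c \<odot>\<^bsub>M\<^esub> cl (b + x)) = ?cl (scale c x)" by simp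
    qed
    also have "\<dots> = ?cl (scale c x)"
      using subspace_0[OF B(1)] by blast
    finally show ?thesis by simp
  qed
  have zero': "\<zero>\<^bsub>?Q\<^esub> = ?cl 0"
    using coset[of 0] subspace_0[OF S] by (simp add: quotient_module_simps)
  have carr: "carrier ?Q = ?cl ` Z"
    by (auto simp: quotient_module_simps coset')
  show ?thesis
    unfolding presents_def
    using Z cl_eq plus smult zero' carr subspace_sums[OF B(1) N]
    by (auto simp: subset_iff)
qed

lemma presents_quotient_subspace:
  assumes S: "subspace S" and N: "subspace N" "N \<subseteq> S"
  shows "presents (quotient_module (subspace_module scale S) N) scale S N
           (\<lambda>x. N +>\<^bsub>subspace_module scale S\<^esub> x)"
  using presents_quotient[OF presents_subspace_module[OF S] S order.refl N] by simp

text \<open>Cycles and boundaries of a complex of quotients can be computed before passing to the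
  quotients; boundaries then acquire the relations as an additional summand.\<close>

lemma presents_homology:
  assumes S: "\<And>i. subspace (S i)" and N: "\<And>i. subspace (N i)" "\<And>i. N i \<subseteq> S i"
    and g: "\<And>i. Vector_Spaces.linear scale scale (g i)"
    and gS: "\<And>i. g (Suc i) ` S (Suc i) \<subseteq> S i" and gN: "\<And>i. g (Suc i) ` N (Suc i) \<subseteq> N i"
    and C: "\<And>i. C i = quotient_module (subspace_module scale (S i)) (N i)"
    and d: "\<And>i. d i = induced_map (subspace_module scale (S (i - 1))) (N (i - 1)) (g i)"
  shows "presents (homology_module C d r) scale {x \<in> S r. r = 0 \<or> g r x \<in> N (r - 1)}
           {b + v |b v. b \<in> g (Suc r) ` S (Suc r) \<and> v \<in> N r}
           (\<lambda>x. boundaries C d r +>\<^bsub>C r\<^esub> (N r +>\<^bsub>subspace_module scale (S r)\<^esub> x))"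
proof -
  let ?cl = "\<lambda>i x. N i +>\<^bsub>subspace_module scale (S i)\<^esub> x"
  have P: "presents (C i) scale (S i) (N i) (?cl i)" for i
    unfolding C using S N by (rule presents_quotient_subspace)
  have Peq: "?cl i x = ?cl i y \<longleftrightarrow> x - y \<in> N i" if "x \<in> S i" "y \<in> S i" for i x y
    using P[of i] that by (auto simp: presents_def)
  have g_add: "g i (x + y) = g i x + g i y" for i x y
  proof -
    interpret l: Vector_Spaces.linear scale scale "g i" by (rule g)
    show ?thesis by (rule l.add)
  qed
  have gS': "g (Suc i) x \<in> S i" if "x \<in> S (Suc i)" for i x using gS that by auto
  have dcl: "d (Suc i) (?cl (Suc i) x) = ?cl i (g (Suc i) x)" if x: "x \<in> S (Suc i)" for i x
  proof -
    have "d (Suc i) (?cl (Suc i) x) = (\<Union>y\<in>N (Suc i). ?cl i (g (Suc i) (y + x)))"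
      by (auto simp: d induced_map_def a_r_coset_subspace_module)
    also have "\<dots> = (\<Union>y\<in>N (Suc i). ?cl i (g (Suc i) x))"
    proof (intro SUP_cong refl)
      fix y assume y: "y \<in> N (Suc i)"
      then have "g (Suc i) y \<in> N i" using gN by blast
      moreover have "y + x \<in> S (Suc i)" using y x N S by (meson subsetD subspace_add)
      ultimately show "?cl i (g (Suc i) (y + x)) = ?cl i (g (Suc i) x)"
        using x gS'[of "y + x" i] by (subst Peq) (auto simp: gS' g_add)
    qed
    also have "\<dots> = ?cl i (g (Suc i) x)"
      using subspace_0[OF N(1)] by blast
    finally show ?thesis .
  qed
  let ?Z = "{x \<in> S r. r = 0 \<or> g r x \<in> N (r - 1)}"
  have Zsub: "subspace ?Z"
  proof (cases r)
    case (Suc i)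
    have lin: "g r (scale c x) = scale c (g r x)" "g r 0 = 0" for c x
    proof -
      interpret l: Vector_Spaces.linear scale scale "g r" by (rule g)
      show "g r (scale c x) = scale c (g r x)" "g r 0 = 0" by (rule l.scale, rule l.zero)
    qed
    show ?thesis
      unfolding subspace_def using S[of r] N(1)[of "r - 1"]
      by (auto simp: subspace_def g_add lin Suc) (simp_all add: lin[unfolded Suc])
  qed (use S in simp)
  have carr: "carrier (C i) = ?cl i ` S i" for i
    using P[of i] by (simp add: presents_def)
  have cyc: "cycles C d r = ?cl r ` ?Z"
  proof (cases r)
    case 0
    then show ?thesis by (simp add: cycles_def carr)
  next
    case (Suc i)
    have "\<zero>\<^bsub>C i\<^esub> = ?cl i 0" using P[of i] by (simp add: presents_def)
    then have "d (Suc i) (?cl (Suc i) x) = \<zero>\<^bsub>C i\<^esub> \<longleftrightarrow> g (Suc i) x \<in> N i" if "x \<in> S (Suc i)" for x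
      using Peq[of "g (Suc i) x" i 0] that S[of i] by (simp add: dcl gS' subspace_0)
    then show ?thesis by (auto simp: cycles_def carr Suc)
  qed
  have bd: "boundaries C d r = ?cl r ` (g (Suc r) ` S (Suc r))"
    unfolding boundaries_def carr image_image by (intro image_cong refl) (simp add: dcl)
  have Bsub: "subspace (g (Suc r) ` S (Suc r))"
  proof -
    interpret l: Vector_Spaces.linear scale scale "g (Suc r)" by (rule g)
    show ?thesis by (rule l.subspace_image[OF S])
  qed
  show ?thesis
    using presents_quotient[OF P Zsub _ Bsub] gS
    by (auto simp: homology_module_def cyc bd)
qed

end

text \<open>A correspondence of representatives that is linear only up to boundaries still induces an
  isomorphism of the presented spaces. The isomorphism is returned in the direction opposite to
  the correspondence.\<close>

lemma presents_isomorphic: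
  assumes M: "presents M sc Z B cl" and M': "presents M' sc' Z' B' cl'"
    and vs: "vector_space sc" and vs': "vector_space sc'"
    and into: "\<And>x. x \<in> Z' \<Longrightarrow> \<gamma> x \<in> Z"
    and add: "\<And>x y. x \<in> Z' \<Longrightarrow> y \<in> Z' \<Longrightarrow> \<gamma> (x + y) - (\<gamma> x + \<gamma> y) \<in> B"
    and smult: "\<And>c x. x \<in> Z' \<Longrightarrow> \<gamma> (sc' c x) - sc c (\<gamma> x) \<in> B"
    and ker: "\<And>x. x \<in> Z' \<Longrightarrow> \<gamma> x \<in> B \<longleftrightarrow> x \<in> B'"
    and onto: "\<And>z. z \<in> Z \<Longrightarrow> \<exists>x\<in>Z'. z - \<gamma> x \<in> B"
  shows "\<exists>\<phi>. module_isomorphism M M' \<phi> \<and> (\<forall>x\<in>Z'. \<phi> (cl (\<gamma> x)) = cl' x)"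
proof -
  interpret v: vector_space sc by fact
  interpret v': vector_space sc' by fact
  note m = M[unfolded presents_def] and m' = M'[unfolded presents_def]
  have B: "v.subspace B" and Z: "v.subspace Z" and Z': "v'.subspace Z'" using m m' by auto
  have eq: "cl (\<gamma> x) = cl (\<gamma> y) \<longleftrightarrow> cl' x = cl' y" if xy: "x \<in> Z'" "y \<in> Z'" for x y
  proof -
    have xy': "x - y \<in> Z'" using Z' xy by (rule v'.subspace_diff)
    have "\<gamma> ((x - y) + y) - (\<gamma> (x - y) + \<gamma> y) \<in> B" using xy' xy(2) by (rule add)
    then have "\<gamma> x - \<gamma> y - \<gamma> (x - y) \<in> B" by (simp add: algebra_simps)
    then have "\<gamma> x - \<gamma> y \<in> B \<longleftrightarrow> \<gamma> (x - y) \<in> B"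
      using v.subspace_add[OF B] v.subspace_diff[OF B] by (metis add.commute diff_add_cancel diff_diff_eq2 add_diff_cancel_right')
    then show ?thesis using ker[OF xy'] m m' xy into by auto
  qed
  define \<phi> where "\<phi> w = cl' (SOME x. x \<in> Z' \<and> w = cl (\<gamma> x))" for w
  have phi: "\<phi> (cl (\<gamma> x)) = cl' x" if "x \<in> Z'" for x
  proof -
    have "\<exists>y. y \<in> Z' \<and> cl (\<gamma> x) = cl (\<gamma> y)" using that by blast
    from someI_ex[OF this] show ?thesis
      unfolding \<phi>_def using eq that by metis
  qed
  have clB: "cl u = cl v" if "u \<in> Z" "v \<in> Z" "u - v \<in> B" for u v
    using m that by auto
  have carr: "carrier M = (\<lambda>x. cl (\<gamma> x)) ` Z'"
  proof (intro equalityI subsetI)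
    fix w assume "w \<in> carrier M"
    then obtain z where z: "z \<in> Z" "w = cl z" using m by auto
    then obtain x where "x \<in> Z'" "z - \<gamma> x \<in> B" using onto by blast
    then show "w \<in> (\<lambda>x. cl (\<gamma> x)) ` Z'" using z clB into by blast
  qed (use m into in auto)
  have carr': "carrier M' = cl' ` Z'" using m' by auto
  have "inj_on \<phi> (carrier M)" unfolding carr by (auto intro!: inj_onI simp: phi eq)
  moreover have "\<phi> ` carrier M = carrier M'"
    unfolding carr carr' image_image by (intro image_cong) (auto simp: phi)
  ultimately have bij: "bij_betw \<phi> (carrier M) (carrier M')" by (simp add: bij_betw_def)
  have "\<phi> (cl (\<gamma> x) \<oplus>\<^bsub>M\<^esub> cl (\<gamma> y)) = cl' x \<oplus>\<^bsub>M'\<^esub> cl' y" if xy: "x \<in> Z'" "y \<in> Z'" for x y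
  proof -
    have s: "x + y \<in> Z'" using Z' xy by (rule v'.subspace_add)
    have "cl (\<gamma> x) \<oplus>\<^bsub>M\<^esub> cl (\<gamma> y) = cl (\<gamma> x + \<gamma> y)" using m xy into by auto
    also have "\<dots> = cl (\<gamma> (x + y))"
      using clB[OF into[OF s] v.subspace_add[OF Z into[OF xy(1)] into[OF xy(2)]] add[OF xy]] by simp
    finally show ?thesis using phi[OF s] m' xy by auto
  qed
  moreover have "\<phi> (c \<odot>\<^bsub>M\<^esub> cl (\<gamma> x)) = c \<odot>\<^bsub>M'\<^esub> cl' x" if x: "x \<in> Z'" for c x
  proof -
    have s: "sc' c x \<in> Z'" using Z' x by (rule v'.subspace_scale)
    have "c \<odot>\<^bsub>M\<^esub> cl (\<gamma> x) = cl (sc c (\<gamma> x))" using m x into by auto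
    also have "\<dots> = cl (\<gamma> (sc' c x))"
      using clB[OF into[OF s] v.subspace_scale[OF Z into[OF x]] smult[OF x]] by simp
    finally show ?thesis using phi[OF s] m' x by auto
  qed
  ultimately have "module_isomorphism M M' \<phi>"
    unfolding module_isomorphism_def using bij by (auto simp: carr phi)
  with phi show ?thesis by blast
qed

lemma presents_zero:
  assumes vs: "vector_space sc" and P: "presents M sc Z B cl" and ZB: "Z \<subseteq> B"
  shows "module_is_zero M"
proof -
  interpret v: vector_space sc by fact
  have Z: "v.subspace Z" and carr: "carrier M = cl ` Z" and zero: "\<zero>\<^bsub>M\<^esub> = cl 0"
    and eq: "\<forall>x\<in>Z. \<forall>y\<in>Z. cl x = cl y \<longleftrightarrow> x - y \<in> B"
    using P by (simp_all add: presents_def)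
  have 0: "0 \<in> Z" using Z by (rule v.subspace_0)
  have "cl x = cl 0" if "x \<in> Z" for x using eq[rule_format, OF that 0] that ZB by auto
  then have "cl ` Z = {cl 0}" using 0 by blast
  then show ?thesis by (simp add: module_is_zero_def carr zero)
qed

text \<open>The representatives of a direct sum may be taken from one space that is mapped to the
  representatives of the summands by projections \<open>\<pi>\<close>.\<close>

lemma presents_direct_sum:
  assumes I: "finite I" and vs: "vector_space sc"
    and M: "\<And>h. h \<in> I \<Longrightarrow> presents (M h) sc (Zh h) (Bh h) (clh h)"
    and Z: "Modules.module.subspace sc Z" and B: "Modules.module.subspace sc B"
    and pi: "\<And>h. h \<in> I \<Longrightarrow> Vector_Spaces.linear sc sc (\<pi> h)"
    and into: "\<And>h x. h \<in> I \<Longrightarrow> x \<in> Z \<Longrightarrow> \<pi> h x \<in> Zh h"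
    and onto: "\<And>f. (\<And>h. h \<in> I \<Longrightarrow> f h \<in> Zh h) \<Longrightarrow> \<exists>x\<in>Z. \<forall>h\<in>I. \<pi> h x = f h"
    and B_iff: "\<And>x. x \<in> Z \<Longrightarrow> x \<in> B \<longleftrightarrow> (\<forall>h\<in>I. \<pi> h x \<in> Bh h)"
  shows "presents (direct_sum_module I M) sc Z B (\<lambda>x. \<lambda>h\<in>I. clh h (\<pi> h x))"
proof -
  interpret v: vector_space sc by fact
  let ?cl = "\<lambda>x. \<lambda>h\<in>I. clh h (\<pi> h x)"
  have pi_add: "\<pi> h (x + y) = \<pi> h x + \<pi> h y" and pi_diff: "\<pi> h (x - y) = \<pi> h x - \<pi> h y"
    and pi_sc: "\<pi> h (sc c x) = sc c (\<pi> h x)" and pi_0: "\<pi> h 0 = 0"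
    if "h \<in> I" for h x y c
  proof -
    interpret l: Vector_Spaces.linear sc sc "\<pi> h" using pi that by blast
    show "\<pi> h (x + y) = \<pi> h x + \<pi> h y" "\<pi> h (x - y) = \<pi> h x - \<pi> h y"
      "\<pi> h (sc c x) = sc c (\<pi> h x)" "\<pi> h 0 = 0"
      by (auto simp: l.add l.diff l.scale l.zero)
  qed
  note m = M[unfolded presents_def]
  have carr: "carrier (direct_sum_module I M) = ?cl ` Z"
  proof (intro equalityI subsetI)
    fix w assume "w \<in> carrier (direct_sum_module I M)"
    then have w: "w \<in> (\<Pi>\<^sub>E h\<in>I. carrier (M h))" by (auto simp: direct_sum_module_def)
    have "\<exists>z. z \<in> Zh h \<and> w h = clh h z" if "h \<in> I" for h
      using w m[OF that] that by (auto simp: PiE_iff)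
    then obtain f where f: "\<And>h. h \<in> I \<Longrightarrow> f h \<in> Zh h" "\<And>h. h \<in> I \<Longrightarrow> w h = clh h (f h)" by metis
    obtain x where x: "x \<in> Z" "\<forall>h\<in>I. \<pi> h x = f h" using onto[of f] f(1) by blast
    have "w = ?cl x"
      using w f x by (auto simp: PiE_iff extensional_def)
    then show "w \<in> ?cl ` Z" using x by blast
  next
    fix w assume "w \<in> ?cl ` Z"
    then show "w \<in> carrier (direct_sum_module I M)"
      using m into I by (auto simp: direct_sum_module_def PiE_iff)
  qed
  have "?cl x = ?cl y \<longleftrightarrow> x - y \<in> B" if xy: "x \<in> Z" "y \<in> Z" for x y
  proof -
    have "x - y \<in> Z" using Z xy by (rule v.subspace_diff)
    then have "x - y \<in> B \<longleftrightarrow> (\<forall>h\<in>I. \<pi> h x - \<pi> h y \<in> Bh h)"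
      by (simp add: B_iff pi_diff)
    also have "\<dots> \<longleftrightarrow> (\<forall>h\<in>I. clh h (\<pi> h x) = clh h (\<pi> h y))"
      using m into xy by auto
    also have "\<dots> \<longleftrightarrow> ?cl x = ?cl y" by (auto simp: restrict_def fun_eq_iff)
    finally show ?thesis by simp
  qed
  moreover have "?cl (x + y) = ?cl x \<oplus>\<^bsub>direct_sum_module I M\<^esub> ?cl y" if "x \<in> Z" "y \<in> Z" for x y
    using m into that by (auto simp: direct_sum_module_def restrict_def fun_eq_iff pi_add)
  moreover have "?cl (sc c x) = c \<odot>\<^bsub>direct_sum_module I M\<^esub> ?cl x" if "x \<in> Z" for c x
    using m into that by (auto simp: direct_sum_module_def restrict_def fun_eq_iff pi_sc)
  moreover have "\<zero>\<^bsub>direct_sum_module I M\<^esub> = ?cl 0"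
    using m by (auto simp: direct_sum_module_def restrict_def fun_eq_iff pi_0)
  ultimately show ?thesis
    unfolding presents_def using carr Z B by blast
qed

section \<open>Ore extensions\<close>

text \<open>The Ore product and the remainder modulo \<open>x\<^sup>n - q\<close> are both sums over coefficients of a function that
  is additive in the coefficient. Such sums are additive, so that identities need to be
  checked only on monomials.\<close>

definition poly_sum :: "('a::zero \<Rightarrow> nat \<Rightarrow> 'b::comm_monoid_add) \<Rightarrow> 'a poly \<Rightarrow> 'b" where
  "poly_sum F p = (\<Sum>i\<le>degree p. F (coeff p i) i)"

lemma poly_sum_eq:
  assumes "\<And>i. F 0 i = 0" "degree p \<le> N"
  shows "poly_sum F p = (\<Sum>i\<le>N. F (coeff p i) i)"
  unfolding poly_sum_def using assms
  by (intro sum.mono_neutral_left) (auto simp: coeff_eq_0)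

lemma poly_sum_add:
  assumes "\<And>i. F 0 i = 0" "\<And>a b i. F (a + b) i = F a i + F b i"
  shows "poly_sum F (p + r) = poly_sum F p + poly_sum F r"
proof -
  let ?N = "max (degree p) (degree r)"
  have "degree (p + r) \<le> ?N" by (rule degree_add_le_max)
  then show ?thesis
    using assms poly_sum_eq[of F p ?N] poly_sum_eq[of F r ?N] poly_sum_eq[of F "p + r" ?N]
    by (simp add: sum.distrib)
qed

lemma poly_sum_monom:
  assumes "\<And>i. F 0 i = 0"
  shows "poly_sum F (monom c j) = F c j"
proof -
  have "poly_sum F (monom c j) = (\<Sum>i\<le>j. F (coeff (monom c j) i) i)"
    using assms by (intro poly_sum_eq) (auto simp: degree_monom_le)
  also have "\<dots> = (\<Sum>i\<le>j. if i = j then F c i else 0)"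
    using assms by (intro sum.cong) auto
  finally show ?thesis by simp
qed

lemma poly_monom_induct [case_names zero monom add]:
  assumes "P 0" "\<And>c i. P (monom c i)" "\<And>p r. P p \<Longrightarrow> P r \<Longrightarrow> P (p + r)"
  shows "P (p :: 'a::comm_monoid_add poly)"
proof -
  have "P (\<Sum>i\<le>m. monom (coeff p i) i)" for m
    using assms by (induction m) auto
  then show ?thesis by (metis poly_as_sum_of_monoms)
qed

locale twisted_algebra = k_algebra scale
  for scale :: "'k::field \<Rightarrow> 'a::ring_1 \<Rightarrow> 'a" +
  fixes \<alpha> :: "'a \<Rightarrow> 'a"
  assumes endo: "algebra_endomorphism scale \<alpha>"
begin

sublocale al: Vector_Spaces.linear scale scale \<alpha>
  using endo by (simp add: algebra_endomorphism_def)

lemma pow_linear: "Vector_Spaces.linear scale scale (\<alpha> ^^ i)"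
proof (induction i)
  case (Suc i)
  show ?case using Vector_Spaces.linear_compose[OF Suc al.linear_axioms] by (simp add: comp_def)
qed (simp add: linear_ident)

lemma pow_add [simp]: "(\<alpha> ^^ i) (x + y) = (\<alpha> ^^ i) x + (\<alpha> ^^ i) y"
  and pow_diff [simp]: "(\<alpha> ^^ i) (x - y) = (\<alpha> ^^ i) x - (\<alpha> ^^ i) y"
  and pow_minus [simp]: "(\<alpha> ^^ i) (- x) = - (\<alpha> ^^ i) x"
  and pow_scale [simp]: "(\<alpha> ^^ i) (scale c x) = scale c ((\<alpha> ^^ i) x)"
  and pow_zero [simp]: "(\<alpha> ^^ i) 0 = 0"
  and pow_sum: "(\<alpha> ^^ i) (sum f S) = (\<Sum>s\<in>S. (\<alpha> ^^ i) (f s))"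
proof -
  interpret l: Vector_Spaces.linear scale scale "\<alpha> ^^ i" by (rule pow_linear)
  show "(\<alpha> ^^ i) (x + y) = (\<alpha> ^^ i) x + (\<alpha> ^^ i) y" "(\<alpha> ^^ i) (x - y) = (\<alpha> ^^ i) x - (\<alpha> ^^ i) y"
    "(\<alpha> ^^ i) (- x) = - (\<alpha> ^^ i) x" "(\<alpha> ^^ i) (scale c x) = scale c ((\<alpha> ^^ i) x)"
    "(\<alpha> ^^ i) 0 = 0" "(\<alpha> ^^ i) (sum f S) = (\<Sum>s\<in>S. (\<alpha> ^^ i) (f s))"
    by (simp_all add: l.add l.diff l.neg l.scale l.zero l.sum)
qed

lemma \<alpha>_mult [simp]: "\<alpha> (x * y) = \<alpha> x * \<alpha> y"
  and \<alpha>_one [simp]: "\<alpha> 1 = 1"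
  using endo by (simp_all add: algebra_endomorphism_def)

lemma pow_mult [simp]: "(\<alpha> ^^ i) (x * y) = (\<alpha> ^^ i) x * (\<alpha> ^^ i) y"
  by (induction i) auto

lemma pow_one [simp]: "(\<alpha> ^^ i) 1 = 1"
  by (induction i) auto

lemma pow_pow: "(\<alpha> ^^ i) ((\<alpha> ^^ j) x) = (\<alpha> ^^ (i + j)) x"
  by (simp add: funpow_add)

lemma ore_mult_poly_sum:
  "ore_mult \<alpha> p r = poly_sum (\<lambda>a i. poly_sum (\<lambda>b j. monom (a * (\<alpha> ^^ i) b) (i + j)) r) p"
  by (simp add: ore_mult_def poly_sum_def)

lemma ore_mult_add_left: "ore_mult \<alpha> (p + p') r = ore_mult \<alpha> p r + ore_mult \<alpha> p' r"
  unfolding ore_mult_poly_sum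
  by (rule poly_sum_add) (simp_all add: poly_sum_def distrib_right add_monom[symmetric] sum.distrib)

lemma ore_mult_add_right: "ore_mult \<alpha> p (r + r') = ore_mult \<alpha> p r + ore_mult \<alpha> p r'"
proof -
  have "poly_sum (\<lambda>b j. monom (a * (\<alpha> ^^ i) b) (i + j)) (r + r')
      = poly_sum (\<lambda>b j. monom (a * (\<alpha> ^^ i) b) (i + j)) r
      + poly_sum (\<lambda>b j. monom (a * (\<alpha> ^^ i) b) (i + j)) r'" for a i
    by (rule poly_sum_add) (simp_all add: distrib_left add_monom[symmetric])
  then show ?thesis
    unfolding ore_mult_poly_sum by (simp add: poly_sum_def sum.distrib)
qed

lemma ore_mult_monom:
  "ore_mult \<alpha> (monom a i) (monom b j) = monom (a * (\<alpha> ^^ i) b) (i + j)"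
  unfolding ore_mult_poly_sum
  by (simp add: poly_sum_monom)

lemma ore_mult_zero [simp]: "ore_mult \<alpha> 0 r = 0" "ore_mult \<alpha> p 0 = 0"
  by (simp_all add: ore_mult_def)

lemma ore_mult_assoc:
  "ore_mult \<alpha> (ore_mult \<alpha> p r) s = ore_mult \<alpha> p (ore_mult \<alpha> r s)"
proof (induction p rule: poly_monom_induct)
  case (monom a i)
  show ?case
  proof (induction r rule: poly_monom_induct)
    case (monom b j)
    show ?case
      by (induction s rule: poly_monom_induct)
        (simp_all add: ore_mult_monom ore_mult_add_right mult.assoc pow_pow add.assoc)
  qed (simp_all add: ore_mult_add_left ore_mult_add_right)
qed (simp_all add: ore_mult_add_left)

lemma ore_mult_one: "ore_mult \<alpha> [:1:] p = p" "ore_mult \<alpha> p [:1:] = p"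
  unfolding monom_0[symmetric]
  by (induction p rule: poly_monom_induct)
    (simp_all add: ore_mult_monom ore_mult_add_left ore_mult_add_right)

lemma map_poly_scale: "map_poly (scale c) p = ore_mult \<alpha> [:scale c 1:] p"
  unfolding monom_0[symmetric]
proof (induction p rule: poly_monom_induct)
  case (monom b i)
  show ?case by (simp add: ore_mult_monom map_poly_monom scale_mult_left)
next
  case (add p r)
  have "map_poly (scale c) (p + r) = map_poly (scale c) p + map_poly (scale c) r"
    by (rule poly_eqI) (simp add: coeff_map_poly scale_right_distrib)
  then show ?case using add by (simp add: ore_mult_add_right)
qed simp

abbreviation "Ore \<equiv> ore_extension scale \<alpha>"

lemma Ore_simps [simp]:
  "carrier Ore = UNIV" "p \<oplus>\<^bsub>Ore\<^esub> r = p + r" "p \<otimes>\<^bsub>Ore\<^esub> r = ore_mult \<alpha> p r"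
  "\<zero>\<^bsub>Ore\<^esub> = 0" "\<one>\<^bsub>Ore\<^esub> = [:1:]" "c \<odot>\<^bsub>Ore\<^esub> p = map_poly (scale c) p"
  by (simp_all add: ore_extension_def)

lemma ring_Ore: "ring Ore"
proof (rule ringI)
  show "abelian_group Ore"
    by (rule abelian_groupI) (auto simp: algebra_simps intro: exI[of _ "- x" for x])
  show "Group.monoid Ore"
    by (rule Group.monoidI) (simp_all add: ore_mult_assoc ore_mult_one)
qed (simp_all add: ore_mult_add_left ore_mult_add_right)

lemma Ore_a_inv [simp]: "\<ominus>\<^bsub>Ore\<^esub> p = - p"
proof -
  interpret ring Ore by (rule ring_Ore)
  show ?thesis by (rule minus_equality) auto
qed

lemma ideal_OreI:
  assumes "0 \<in> J" "\<And>p r. p \<in> J \<Longrightarrow> r \<in> J \<Longrightarrow> p + r \<in> J"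
    and "\<And>p r. p \<in> J \<Longrightarrow> ore_mult \<alpha> r p \<in> J" "\<And>p r. p \<in> J \<Longrightarrow> ore_mult \<alpha> p r \<in> J"
  shows "ideal J Ore"
proof -
  interpret ring Ore by (rule ring_Ore)
  have minus: "- p \<in> J" if "p \<in> J" for p
  proof -
    have "ore_mult \<alpha> (monom (- 1) 0) p = - p"
      by (induction p rule: poly_monom_induct)
        (simp_all add: ore_mult_monom minus_monom ore_mult_add_right)
    then show ?thesis using assms(3)[OF that] by metis
  qed
  show ?thesis
  proof (rule idealI[OF ring_Ore])
    show "subgroup J (add_monoid Ore)"
      using assms(1,2) minus Ore_a_inv
      by (intro add.subgroupI) (auto simp: a_inv_def[symmetric] simp del: Ore_a_inv)
  qed (use assms in auto)
qed

end

section \<open>The monogenic extension and its basis over \<open>K\<close>\<close>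

locale monogenic = twisted_algebra scale \<alpha>
  for scale :: "'k::field \<Rightarrow> 'a::ring_1 \<Rightarrow> 'a" and \<alpha> +
  fixes n :: nat and lam :: "nat \<Rightarrow> 'a"
  assumes n_ge_2: "n \<ge> 2"
    and monic: "lam 0 = 1"
    and lam_fixed: "\<And>i. 1 \<le> i \<Longrightarrow> i \<le> n \<Longrightarrow> \<alpha> (lam i) = lam i"
    and lam_comm: "\<And>i y. 1 \<le> i \<Longrightarrow> i \<le> n \<Longrightarrow> lam i * y = (\<alpha> ^^ i) y * lam i"
    and breve: "\<exists>z \<in> ring_center. (\<alpha> ^^ n) z = z \<and>
                  (\<forall>i. 1 \<le> i \<and> i < n \<longrightarrow> invertible_element (z - (\<alpha> ^^ i) z))"
begin

text \<open>As \<open>z\<close> is central, \<open>lam i\<close> is annihilated by \<open>z - \<alpha>\<^sup>i(z)\<close>, which is invertible.\<close>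

lemma lam_middle_zero:
  assumes "1 \<le> i" "i < n"
  shows "lam i = 0"
proof -
  obtain z where z: "z \<in> ring_center" "invertible_element (z - (\<alpha> ^^ i) z)"
    using breve assms by blast
  have "lam i * z = (\<alpha> ^^ i) z * lam i" using lam_comm assms by simp
  moreover have "lam i * z = z * lam i" using z by (simp add: ring_center_def)
  ultimately have 0: "(z - (\<alpha> ^^ i) z) * lam i = 0" by (simp add: left_diff_distrib)
  obtain v where "v * (z - (\<alpha> ^^ i) z) = 1" using z by (auto simp: invertible_element_def)
  then have "lam i = v * ((z - (\<alpha> ^^ i) z) * lam i)" by (simp add: mult.assoc[symmetric])
  with 0 show ?thesis by simp
qed

definition q :: 'a where "q = - lam n"

lemma \<alpha>_q: "(\<alpha> ^^ i) q = q"
proof (induction i)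
  case (Suc i)
  then show ?case using lam_fixed[of n] n_ge_2 by (simp add: q_def al.neg)
qed simp

lemma q_comm: "q * y = (\<alpha> ^^ n) y * q"
  using lam_comm[of n y] n_ge_2 by (simp add: q_def)

lemma \<alpha>_qpow [simp]: "(\<alpha> ^^ i) (q ^ k) = q ^ k"
  by (induction k) (simp_all add: \<alpha>_q)

lemma qpow_comm: "q ^ k * y = (\<alpha> ^^ (k * n)) y * q ^ k"
proof (induction k)
  case (Suc k)
  have "q ^ Suc k * y = q * (\<alpha> ^^ (k * n)) y * q ^ k" by (simp add: Suc mult.assoc)
  also have "\<dots> = (\<alpha> ^^ n) ((\<alpha> ^^ (k * n)) y) * q * q ^ k" by (simp only: q_comm)
  also have "\<dots> = (\<alpha> ^^ (Suc k * n)) y * q ^ Suc k" by (simp add: pow_pow mult.assoc)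
  finally show ?case .
qed simp

lemma monogenic_poly_eq: "monogenic_poly n lam = monom 1 n - monom q 0"
proof -
  have "(\<Sum>i\<le>n. monom (lam i) (n - i)) = (\<Sum>i\<in>{0, n}. monom (lam i) (n - i))"
    using lam_middle_zero by (intro sum.mono_neutral_right) (auto simp: Suc_le_eq)
  then show ?thesis using n_ge_2 by (simp add: monogenic_poly_def monic q_def minus_monom)
qed

abbreviation "I \<equiv> monogenic_ideal scale \<alpha> n lam"
abbreviation "A \<equiv> monogenic_extension scale \<alpha> n lam"
abbreviation "\<iota> \<equiv> monogenic_incl scale \<alpha> n lam"

abbreviation A_mult :: "'a poly set \<Rightarrow> 'a poly set \<Rightarrow> 'a poly set" (infixl "\<cdot>" 70) where
  "a \<cdot> b \<equiv> a \<otimes>\<^bsub>A\<^esub> b"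

lemma ideal_I: "ideal I Ore"
proof -
  interpret ring Ore by (rule ring_Ore)
  show ?thesis unfolding monogenic_ideal_def by (rule genideal_ideal) simp
qed

text \<open>The coefficient of \<open>x\<^sup>e\<close> in the remainder modulo \<open>x\<^sup>n - q\<close>, where \<open>q\<close> is carried to the right of
  the coefficients.\<close>

definition red :: "nat \<Rightarrow> 'a poly \<Rightarrow> 'a" where
  "red e p = poly_sum (\<lambda>c j. if j mod n = e then c * q ^ (j div n) else 0) p"

lemma red_add: "red e (p + r) = red e p + red e r"
  unfolding red_def by (rule poly_sum_add) (auto simp: distrib_right)

lemma red_monom: "red e (monom c j) = (if j mod n = e then c * q ^ (j div n) else 0)"
  unfolding red_def by (subst poly_sum_monom) auto

lemma red_zero [simp]: "red e 0 = 0"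
  using red_monom[of e 0 0] by simp

lemma red_minus: "red e (- p) = - red e p"
  using red_add[of e p "- p"] by (simp add: eq_neg_iff_add_eq_0 add.commute)

lemma red_diff: "red e (p - r) = red e p - red e r"
  using red_add[of e p "- r"] by (simp add: red_minus)

text \<open>A remainder of a product depends only on the remainders of the factors: when
  the exponents \<open>i\<close> and \<open>(e + n - i) mod n\<close> add up to \<open>e + n\<close>, a factor \<open>x\<^sup>n = q\<close> splits off.\<close>

lemma red_mult:
  assumes e: "e < n"
  shows "red e (ore_mult \<alpha> p r) =
    (\<Sum>i<n. red i p * (\<alpha> ^^ i) (red ((e + n - i) mod n) r) * q ^ (if i \<le> e then 0 else 1))"
proof (induction p rule: poly_monom_induct)
  case (monom a j)
  show ?case
  proof (induction r rule: poly_monom_induct)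
    case (monom b l)
    have n: "n > 0" using n_ge_2 by simp
    define i where "i = j mod n"
    have i: "i < n" using n by (simp add: i_def)
    let ?e = "\<lambda>i. q ^ (if i \<le> e then 0 else 1)"
    have "(\<Sum>i<n. red i (monom a j) * (\<alpha> ^^ i) (red ((e + n - i) mod n) (monom b l)) * ?e i)
        = (\<Sum>i'<n. if i' = i then
             a * q ^ (j div n) * (\<alpha> ^^ i) (red ((e + n - i) mod n) (monom b l)) * ?e i else 0)"
      by (intro sum.cong) (auto simp: red_monom i_def)
    also have "\<dots> = a * q ^ (j div n) * (\<alpha> ^^ i) (red ((e + n - i) mod n) (monom b l)) * ?e i"
      using i by simp
    also have "\<dots> = red e (ore_mult \<alpha> (monom a j) (monom b l))"
    proof (cases "(j + l) mod n = e")
      case True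
      define m where "m = l mod n"
      have m: "m < n" using n by (simp add: m_def)
      have jl: "j = j div n * n + i" "l = l div n * n + m"
        by (simp_all add: i_def m_def)
      have im: "(i + m) mod n = e" using True by (simp add: i_def m_def mod_add_eq)
      have meq: "m = (e + n - i) mod n" and dv: "(i + m) div n = (if i \<le> e then 0 else 1)"
      proof -
        have "i + m < n \<and> e = i + m \<or> n \<le> i + m \<and> e = i + m - n"
          using im i m by (metis le_mod_geq mod_less add_less_mono nat_less_le not_le
              less_diff_conv2 add_diff_inverse_nat nat_add_left_cancel_less)
        then show "m = (e + n - i) mod n" "(i + m) div n = (if i \<le> e then 0 else 1)"
          using i m by (auto simp: le_mod_geq le_div_geq)
      qed
      have "(j + l) div n = j div n + l div n + (i + m) div n"
        unfolding i_def m_def by (rule div_add1_eq)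
      then have "red e (ore_mult \<alpha> (monom a j) (monom b l))
          = a * (\<alpha> ^^ j) b * q ^ (j div n + l div n + (i + m) div n)"
        using True by (simp add: ore_mult_monom red_monom)
      also have "(\<alpha> ^^ j) b = (\<alpha> ^^ (j div n * n)) ((\<alpha> ^^ i) b)"
        using jl(1) by (metis pow_pow)
      also have "a * (\<alpha> ^^ (j div n * n)) ((\<alpha> ^^ i) b) * q ^ (j div n + l div n + (i + m) div n)
          = a * (q ^ (j div n) * (\<alpha> ^^ i) b) * q ^ (l div n) * q ^ ((i + m) div n)"
        by (simp only: power_add mult.assoc qpow_comm[of "j div n" "(\<alpha> ^^ i) b"])
      finally show ?thesis
        using meq dv by (simp add: red_monom m_def mult.assoc)
    next
      case False
      have "l mod n \<noteq> (e + n - i) mod n"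
      proof
        assume "l mod n = (e + n - i) mod n"
        then have "(i + l) mod n = (i + (e + n - i)) mod n" by (metis mod_add_right_eq)
        also have "\<dots> = e" using i e by simp
        finally have "(j + l) mod n = e" by (simp add: i_def mod_add_left_eq)
        with False show False by simp
      qed
      then show ?thesis using False by (simp add: red_monom ore_mult_monom)
    qed
    finally show ?case by simp
  qed (simp_all add: ore_mult_add_right red_add distrib_left distrib_right sum.distrib)
qed (simp_all add: ore_mult_add_left red_add distrib_left distrib_right sum.distrib)

lemma red_ge: "e \<ge> n \<Longrightarrow> red e p = 0"
proof (induction p rule: poly_monom_induct)
  case (monom c j)
  have "j mod n < n" using n_ge_2 by simp
  then show ?case using monom by (simp add: red_monom)
qed (simp_all add: red_add)

text \<open>By the product formula, the polynomials with remainder zero form a two-sided ideal. As it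
  contains \<open>x\<^sup>n - q\<close>, remainders are well defined on \<open>A\<close>.\<close>

lemma red_I: "p \<in> I \<Longrightarrow> red e p = 0"
proof -
  let ?J = "{p. \<forall>e. red e p = 0}"
  have m: "red e (ore_mult \<alpha> p r) = 0" if "(\<forall>e. red e p = 0) \<or> (\<forall>e. red e r = 0)" for e p r
    using that by (cases "e < n") (auto simp: red_mult red_ge)
  have J: "ideal ?J Ore" by (rule ideal_OreI) (auto simp: red_add m)
  have "monogenic_poly n lam \<in> ?J"
    using n_ge_2 by (auto simp: monogenic_poly_eq red_diff red_monom)
  then have "I \<subseteq> ?J"
    unfolding monogenic_ideal_def
    using ring.genideal_minimal[OF ring_Ore J, of "{monogenic_poly n lam}"] by auto
  then show "p \<in> I \<Longrightarrow> red e p = 0" by blast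
qed

lemma I_zero: "0 \<in> I" and I_add: "p \<in> I \<Longrightarrow> r \<in> I \<Longrightarrow> p + r \<in> I"
  and I_diff: "p \<in> I \<Longrightarrow> r \<in> I \<Longrightarrow> p - r \<in> I"
  and I_mult_left: "p \<in> I \<Longrightarrow> ore_mult \<alpha> r p \<in> I"
proof -
  interpret ideal I Ore by (rule ideal_I)
  note sg = additive_subgroup_axioms
  show z: "0 \<in> I" using additive_subgroup.zero_closed[OF sg] by simp
  show a: "p \<in> I \<Longrightarrow> r \<in> I \<Longrightarrow> p + r \<in> I" for p r using additive_subgroup.a_closed[OF sg] by simp
  have m: "p \<in> I \<Longrightarrow> - p \<in> I" for p using additive_subgroup.a_inv_closed[OF sg, of p] by simp
  show "p \<in> I \<Longrightarrow> r \<in> I \<Longrightarrow> p - r \<in> I" using a[of p "- r"] m[of r] by simp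
  show "p \<in> I \<Longrightarrow> ore_mult \<alpha> r p \<in> I" using I_l_closed[of p r] by simp
qed

lemma monogenic_poly_in_I: "monogenic_poly n lam \<in> I"
  unfolding monogenic_ideal_def using ring.genideal_self'[OF ring_Ore] by simp

lemma red_expand: "p - (\<Sum>e<n. monom (red e p) e) \<in> I"
proof (induction p rule: poly_monom_induct)
  case zero
  show ?case by (simp add: I_zero)
next
  case (monom c j)
  have n: "n > 0" using n_ge_2 by simp
  have step: "monom c (k * n + m) - monom (c * q ^ k) m \<in> I" for c k m
  proof (induction k arbitrary: c)
    case (Suc k)
    have "monom c (Suc k * n + m) - monom (c * q) (k * n + m)
        = ore_mult \<alpha> (monom c (k * n + m)) (monogenic_poly n lam)"
    proof -
      have f: "monogenic_poly n lam = monom 1 n + monom (- q) 0"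
        by (simp add: monogenic_poly_eq minus_monom[symmetric])
      have "ore_mult \<alpha> (monom c (k * n + m)) (monogenic_poly n lam)
          = monom c (k * n + m + n) + - monom (c * q) (k * n + m)"
        unfolding f ore_mult_add_right by (simp add: ore_mult_monom \<alpha>_q minus_monom)
      also have "\<dots> = monom c (Suc k * n + m) - monom (c * q) (k * n + m)"
        by (simp add: algebra_simps)
      finally show ?thesis by simp
    qed
    then have "monom c (Suc k * n + m) - monom (c * q) (k * n + m) \<in> I"
      using I_mult_left[OF monogenic_poly_in_I] by metis
    from I_add[OF this Suc.IH[of "c * q"]] show ?case by (simp add: mult.assoc)
  qed (simp add: I_zero)
  have "(\<Sum>e<n. monom (red e (monom c j)) e)
      = (\<Sum>e<n. if e = j mod n then monom (c * q ^ (j div n)) e else 0)"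
    by (intro sum.cong) (auto simp: red_monom)
  also have "\<dots> = monom (c * q ^ (j div n)) (j mod n)" using n by simp
  finally show ?case using step[of c "j div n" "j mod n"] by simp
next
  case (add p r)
  from I_add[OF add] show ?case
    by (simp add: red_add add_monom[symmetric] sum.distrib algebra_simps)
qed

definition cls :: "'a poly \<Rightarrow> 'a poly set" where "cls p = I +>\<^bsub>Ore\<^esub> p"

lemma cls_image: "cls p = (\<lambda>y. y + p) ` I"
  by (auto simp: cls_def a_r_coset_def')

lemma cls_eq: "cls p = cls r \<longleftrightarrow> p - r \<in> I"
proof
  assume "cls p = cls r"
  then have "p \<in> cls r" using I_zero by (force simp: cls_image)
  then show "p - r \<in> I" by (auto simp: cls_image)
next
  assume d: "p - r \<in> I"
  show "cls p = cls r"
  proof (intro equalityI subsetI)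
    fix s assume "s \<in> cls p"
    then obtain y where "y \<in> I" "s = y + p" by (auto simp: cls_image)
    then have "s = (y + (p - r)) + r" "y + (p - r) \<in> I" using d I_add by auto
    then show "s \<in> cls r" unfolding cls_image by blast
  next
    fix s assume "s \<in> cls r"
    then obtain y where "y \<in> I" "s = y + r" by (auto simp: cls_image)
    then have "s = (y - (p - r)) + p" "y - (p - r) \<in> I" using d I_diff by auto
    then show "s \<in> cls p" unfolding cls_image by blast
  qed
qed

lemma carrier_A: "carrier A = range cls"
  by (simp add: monogenic_extension_def quotient_module_simps cls_def)

lemma cls_add: "cls p \<oplus>\<^bsub>A\<^esub> cls r = cls (p + r)"
proof -
  interpret ideal I Ore by (rule ideal_I)
  show ?thesis
    using a_rcos_sum[of p r]
    by (simp add: monogenic_extension_def quotient_module_simps cls_def set_add_def')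
qed

lemma cls_mult: "cls p \<cdot> cls r = cls (ore_mult \<alpha> p r)"
proof -
  interpret ideal I Ore by (rule ideal_I)
  show ?thesis
    using rcoset_mult_add[of p r]
    by (simp add: monogenic_extension_def quotient_module_simps cls_def rcoset_mult_def)
qed

lemma cls_smult: "c \<odot>\<^bsub>A\<^esub> cls p = cls (map_poly (scale c) p)"
proof -
  have "c \<odot>\<^bsub>A\<^esub> cls p = (\<Union>r\<in>cls p. cls (map_poly (scale c) r))"
    by (simp add: monogenic_extension_def quotient_module_simps cls_def)
  also have "\<dots> = (\<Union>r\<in>cls p. cls (map_poly (scale c) p))"
  proof (intro SUP_cong refl)
    fix r assume "r \<in> cls p"
    then have "r - p \<in> I" by (auto simp: cls_image)
    then have "ore_mult \<alpha> [:scale c 1:] (r - p) \<in> I" by (rule I_mult_left)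
    moreover have "ore_mult \<alpha> s r = ore_mult \<alpha> s (r - p) + ore_mult \<alpha> s p" for s
      by (simp add: ore_mult_add_right[symmetric])
    ultimately show "cls (map_poly (scale c) r) = cls (map_poly (scale c) p)"
      by (simp add: cls_eq map_poly_scale)
  qed
  also have "\<dots> = cls (map_poly (scale c) p)" using I_zero by (auto simp: cls_image)
  finally show ?thesis .
qed

text \<open>The coefficient of \<open>x\<^sup>e\<close>. By \<open>red_I\<close> the choice of a representative does not matter.\<close>

definition cf :: "'a poly set \<Rightarrow> nat \<Rightarrow> 'a" where
  "cf a e = red e (SOME p. p \<in> a)"

lemma cf_cls: "cf (cls p) e = red e p"
proof -
  have "p \<in> cls p" using I_zero by (force simp: cls_image)
  then have "(SOME r. r \<in> cls p) \<in> cls p" by (rule someI)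
  then have "(SOME r. r \<in> cls p) - p \<in> I" by (auto simp: cls_image)
  then show ?thesis using red_I red_diff unfolding cf_def by (metis eq_iff_diff_eq_0)
qed

definition X :: "'a \<Rightarrow> nat \<Rightarrow> 'a poly set" where "X y e = cls (monom y e)"

lemma iota_X: "\<iota> y = X y 0"
  by (simp add: monogenic_incl_def X_def cls_def monom_0)

lemma A_closed [simp]:
  "X y e \<in> carrier A" "\<iota> y \<in> carrier A"
  "a \<in> carrier A \<Longrightarrow> b \<in> carrier A \<Longrightarrow> a \<cdot> b \<in> carrier A"
  "a \<in> carrier A \<Longrightarrow> b \<in> carrier A \<Longrightarrow> a \<oplus>\<^bsub>A\<^esub> b \<in> carrier A"
  "a \<in> carrier A \<Longrightarrow> c \<odot>\<^bsub>A\<^esub> a \<in> carrier A"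
  unfolding iota_X X_def by (auto simp: carrier_A cls_mult cls_add cls_smult)

lemma A_assoc:
  "a \<in> carrier A \<Longrightarrow> b \<in> carrier A \<Longrightarrow> c \<in> carrier A \<Longrightarrow>
    a \<cdot> b \<cdot> c = a \<cdot> (b \<cdot> c)"
  by (auto simp: carrier_A cls_mult ore_mult_assoc)

lemma X_mult: "X a i \<cdot> X b j = X (a * (\<alpha> ^^ i) b) (i + j)"
  by (simp add: X_def cls_mult ore_mult_monom)

lemma X_add: "X (a + b) e = X a e \<oplus>\<^bsub>A\<^esub> X b e"
  by (simp add: X_def cls_add add_monom)

lemma X_scale: "X (scale c a) e = c \<odot>\<^bsub>A\<^esub> X a e"
  by (simp add: X_def cls_smult map_poly_monom)

lemma cf_add: "a \<in> carrier A \<Longrightarrow> b \<in> carrier A \<Longrightarrow> cf (a \<oplus>\<^bsub>A\<^esub> b) e = cf a e + cf b e"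
  by (auto simp: carrier_A cls_add cf_cls red_add)

lemma cf_X: "cf (X y j) e = (if j mod n = e then y * q ^ (j div n) else 0)"
  by (simp add: X_def cf_cls red_monom)

lemma cf_mult:
  "a \<in> carrier A \<Longrightarrow> b \<in> carrier A \<Longrightarrow> e < n \<Longrightarrow> cf (a \<cdot> b) e =
    (\<Sum>i<n. cf a i * (\<alpha> ^^ i) (cf b ((e + n - i) mod n)) * q ^ (if i \<le> e then 0 else 1))"
  by (auto simp: carrier_A cls_mult cf_cls red_mult)

lemma cf_iota_left: "a \<in> carrier A \<Longrightarrow> e < n \<Longrightarrow> cf (\<iota> y \<cdot> a) e = y * cf a e"
proof -
  assume a: "a \<in> carrier A" and e: "e < n"
  have "cf (\<iota> y \<cdot> a) e = (\<Sum>i<n. if i = 0 then y * cf a e else 0)"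
    unfolding cf_mult[OF A_closed(2) a e] using e
    by (intro sum.cong) (auto simp: iota_X cf_X)
  then show ?thesis using n_ge_2 by simp
qed

lemma cf_iota_right: "a \<in> carrier A \<Longrightarrow> e < n \<Longrightarrow> cf (a \<cdot> \<iota> y) e = cf a e * (\<alpha> ^^ e) y"
proof -
  assume a: "a \<in> carrier A" and e: "e < n"
  have "cf (a \<cdot> \<iota> y) e = (\<Sum>i<n. if i = e then cf a e * (\<alpha> ^^ e) y else 0)"
    unfolding cf_mult[OF a A_closed(2) e]
  proof (intro sum.cong refl)
    fix i assume "i \<in> {..<n}"
    then have i: "i < n" by simp
    have "(e + n - i) mod n = 0 \<longleftrightarrow> i = e"
    proof (cases "i \<le> e")
      case True
      then have "(e + n - i) mod n = (e - i + n) mod n" by simp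
      also have "\<dots> = e - i" using e by simp
      finally show ?thesis using True by auto
    next
      case False
      then show ?thesis using i by simp
    qed
    then show "cf a i * (\<alpha> ^^ i) (cf (\<iota> y) ((e + n - i) mod n)) * q ^ (if i \<le> e then 0 else 1)
        = (if i = e then cf a e * (\<alpha> ^^ e) y else 0)"
      by (auto simp: iota_X cf_X)
  qed
  then show ?thesis using e by simp
qed

lemma cf_smult: "a \<in> carrier A \<Longrightarrow> e < n \<Longrightarrow> cf (c \<odot>\<^bsub>A\<^esub> a) e = scale c (cf a e)"
proof -
  assume a: "a \<in> carrier A" and e: "e < n"
  have "c \<odot>\<^bsub>A\<^esub> a = \<iota> (scale c 1) \<cdot> a"
    using a by (auto simp: carrier_A cls_smult map_poly_scale iota_X X_def cls_mult monom_0)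
  then show ?thesis using a e by (simp add: cf_iota_left scale_mult_left)
qed

lemma A_expand: "a \<in> carrier A \<Longrightarrow> a = cls (\<Sum>e<n. monom (cf a e) e)"
proof -
  assume "a \<in> carrier A"
  then obtain p where "a = cls p" by (auto simp: carrier_A)
  then show ?thesis by (simp only: cf_cls cls_eq red_expand)
qed

lemma X_reduce: "X y (e + n) = X (y * q) e"
proof -
  have "X y (e + n) = cls (\<Sum>i<n. monom (cf (X y (e + n)) i) i)" by (rule A_expand) simp
  also have "\<dots> = cls (\<Sum>i<n. monom (cf (X (y * q) e) i) i)"
    using n_ge_2 by (simp add: cf_X mult.assoc cong: if_cong)
  also have "\<dots> = X (y * q) e" by (rule A_expand[symmetric]) simp
  finally show ?thesis .
qed

end

section \<open>Twisted commutators\<close>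

context twisted_algebra
begin

abbreviation "N \<equiv> twisted_commutators scale \<alpha>"

lemma N_subspace: "subspace (N j)"
  unfolding twisted_commutators_def by (rule subspace_span)

lemmas N_add = subspace_add[OF N_subspace]
  and N_diff = subspace_diff[OF N_subspace]
  and N_neg = subspace_neg[OF N_subspace]
  and N_zero = subspace_0[OF N_subspace]
  and N_scale = subspace_scale[OF N_subspace]
  and N_sum = subspace_sum[OF N_subspace]

lemma N_generator: "y' * (\<alpha> ^^ j) y - y * y' \<in> N j"
  unfolding twisted_commutators_def by (rule span_base) blast

lemma N_induct [consumes 1, case_names zero add generator]:
  assumes "v \<in> N j" "P 0" "\<And>c x y. P x \<Longrightarrow> P y \<Longrightarrow> P (scale c x + y)"
    "\<And>y y'. P (y' * (\<alpha> ^^ j) y - y * y')"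
  shows "P v"
  using assms(1) unfolding twisted_commutators_def
proof (induction rule: span_induct_alt)
  case (step c x y)
  then show ?case using assms(3,4) by auto
qed (rule assms(2))

lemma N_pow: "v \<in> N j \<Longrightarrow> (\<alpha> ^^ i) v \<in> N j"
proof (induction rule: N_induct)
  case (generator y y')
  show ?case
    using N_generator[of "(\<alpha> ^^ i) y'" j "(\<alpha> ^^ i) y"] by (simp add: pow_pow add.commute)
qed (simp_all add: N_zero N_add N_scale)

end

context monogenic
begin

text \<open>Passing \<open>q\<close> through \<open>\<alpha>\<^sup>j(y)\<close> turns it into \<open>\<alpha>\<^sup>j\<^sup>+\<^sup>n(y)\<close>, so a right factor \<open>q\<close> lowers the twist by \<open>n\<close>.\<close>

lemma N_q: "v \<in> N (j + n) \<Longrightarrow> v * q \<in> N j"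
proof (induction rule: N_induct)
  case (generator y y')
  have "(y' * (\<alpha> ^^ (j + n)) y - y * y') * q = (y' * q) * (\<alpha> ^^ j) y - y * (y' * q)"
    by (simp add: left_diff_distrib mult.assoc q_comm[of "(\<alpha> ^^ j) y"] pow_pow add.commute)
  then show ?case using N_generator by metis
qed (simp_all add: N_zero N_add N_scale distrib_right scale_mult_left)

lemma N_qpow: "v \<in> N (j + k * n) \<Longrightarrow> v * q ^ k \<in> N j"
proof (induction k arbitrary: v)
  case (Suc k)
  then have "v * q \<in> N (j + k * n)" using N_q[of v "j + k * n"] by (simp add: ac_simps)
  from Suc.IH[OF this] show ?case by (simp add: mult.assoc)
qed simp

text \<open>Modulo \<open>n\<close>, the exponent \<open>j\<close> is some \<open>i\<close> with \<open>0 < i < n\<close>. The commutator of \<open>v u\<close> with the central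
  \<open>z\<close> is then \<open>v u (\<alpha>\<^sup>i(z) - z)\<close>, and this is \<open>- v\<close> if \<open>u\<close> is inverse to \<open>z - \<alpha>\<^sup>i(z)\<close>.\<close>

lemma N_trivial:
  assumes "\<not> n dvd j"
  shows "v \<in> N j"
proof -
  obtain z where z: "z \<in> ring_center" "(\<alpha> ^^ n) z = z"
    "\<And>i. 1 \<le> i \<Longrightarrow> i < n \<Longrightarrow> invertible_element (z - (\<alpha> ^^ i) z)"
    using breve by blast
  define i where "i = j mod n"
  have i: "1 \<le> i" "i < n" using assms n_ge_2 by (auto simp: i_def dvd_eq_mod_eq_0)
  obtain u where u: "u * (z - (\<alpha> ^^ i) z) = 1" using z(3)[OF i] by (auto simp: invertible_element_def)
  have "(\<alpha> ^^ j) z = (\<alpha> ^^ i) z" unfolding i_def using funpow_mod_eq[of n \<alpha> z j] z(2) by simp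
  then have "- (v * u) * (\<alpha> ^^ j) z - z * (- (v * u)) = v * u * z - v * u * (\<alpha> ^^ i) z"
    using z(1) by (simp add: ring_center_def)
  also have "\<dots> = v" using u by (simp add: right_diff_distrib[symmetric] mult.assoc)
  finally show ?thesis using N_generator by metis
qed

end

section \<open>Free chains and coefficients of tensors\<close>

lemma lookup_free_scale [simp]: "Poly_Mapping.lookup (free_scale c p) t = c * Poly_Mapping.lookup p t"
  by (simp add: free_scale_def Poly_Mapping.map.rep_eq when_def)

interpretation free: vector_space "free_scale :: 'k::field \<Rightarrow> ('b \<Rightarrow>\<^sub>0 'k) \<Rightarrow> _"
  by unfold_locales (auto intro!: poly_mapping_eqI simp: lookup_add algebra_simps)

definition lin_ext :: "('k::field \<Rightarrow> 'v::ab_group_add \<Rightarrow> 'v) \<Rightarrow> ('b \<Rightarrow> 'v) \<Rightarrow> ('b \<Rightarrow>\<^sub>0 'k) \<Rightarrow> 'v" where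
  "lin_ext sc F c = (\<Sum>t\<in>Poly_Mapping.keys c. sc (Poly_Mapping.lookup c t) (F t))"

context vector_space
begin

lemma lin_ext_eq:
  assumes "finite S" "Poly_Mapping.keys c \<subseteq> S"
  shows "lin_ext scale F c = (\<Sum>t\<in>S. scale (Poly_Mapping.lookup c t) (F t))"
  unfolding lin_ext_def using assms by (intro sum.mono_neutral_left) (auto simp: in_keys_iff)

lemma lin_ext_linear: "Vector_Spaces.linear free_scale scale (lin_ext scale F)"
proof (intro Vector_Spaces.linear.intro module_hom.intro module_hom_axioms.intro)
  fix c d :: "'c \<Rightarrow>\<^sub>0 'a" and k
  let ?S = "Poly_Mapping.keys c \<union> Poly_Mapping.keys d"
  have "Poly_Mapping.keys (c + d) \<subseteq> ?S" by (rule keys_add)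
  then show "lin_ext scale F (c + d) = lin_ext scale F c + lin_ext scale F d"
    using lin_ext_eq[of ?S c F] lin_ext_eq[of ?S d F] lin_ext_eq[of ?S "c + d" F]
    by (simp add: lookup_add scale_left_distrib sum.distrib)
  have "Poly_Mapping.keys (free_scale k c) \<subseteq> Poly_Mapping.keys c" by (auto simp: in_keys_iff)
  then show "lin_ext scale F (free_scale k c) = scale k (lin_ext scale F c)"
    using lin_ext_eq[of "Poly_Mapping.keys c" "free_scale k c" F]
    by (simp add: lin_ext_def scale_sum_right)
qed (simp_all add: free.vector_space_axioms vector_space_axioms module_axioms free.module_axioms)

lemma lin_ext_tup [simp]: "lin_ext scale F (tup t) = F t"
  by (simp add: lin_ext_def tup_def)

end

lemma lin_ext_tup_self: "lin_ext free_scale tup c = c"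
proof (rule poly_mapping_eqI)
  fix t
  have "Poly_Mapping.lookup (lin_ext free_scale tup c) t
      = (\<Sum>s\<in>Poly_Mapping.keys c. if s = t then Poly_Mapping.lookup c t else 0)"
    unfolding lin_ext_def lookup_sum by (intro sum.cong) (auto simp: tup_def lookup_single when_def)
  then show "Poly_Mapping.lookup (lin_ext free_scale tup c) t = Poly_Mapping.lookup c t"
    by (simp add: in_keys_iff)
qed

definition words :: "nat \<Rightarrow> nat \<Rightarrow> nat list set" where
  "words b m = {w. length w = m \<and> set w \<subseteq> {..<b}}"

lemma finite_words [simp]: "finite (words b m)"
  using finite_lists_length_eq[of "{..<b}" m] by (simp add: words_def conj_commute)

lemma words_0 [simp]: "words b 0 = {[]}"
  by (auto simp: words_def)

lemma sum_words_Cons: "(\<Sum>w\<in>words b (Suc m). f w) = (\<Sum>e<b. \<Sum>w\<in>words b m. f (e # w))"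
proof -
  have "(\<Sum>e<b. \<Sum>w\<in>words b m. f (e # w)) = (\<Sum>(e, w)\<in>{..<b} \<times> words b m. f (e # w))"
    by (rule sum.cartesian_product)
  also have "\<dots> = (\<Sum>w\<in>words b (Suc m). f w)"
    by (rule sum.reindex_bij_witness[of _ "\<lambda>w. (hd w, tl w)" "\<lambda>(e, w). e # w"])
      (auto simp: words_def length_Suc_conv)
  finally show ?thesis by simp
qed

lemma sum_words_snoc: "(\<Sum>w\<in>words b (Suc m). f w) = (\<Sum>w\<in>words b m. \<Sum>e<b. f (w @ [e]))"
proof -
  have "(\<Sum>w\<in>words b m. \<Sum>e<b. f (w @ [e])) = (\<Sum>(w, e)\<in>words b m \<times> {..<b}. f (w @ [e]))"
    by (rule sum.cartesian_product)
  also have "\<dots> = (\<Sum>w\<in>words b (Suc m). f w)"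
    by (rule sum.reindex_bij_witness[of _ "\<lambda>w. (butlast w, last w)" "\<lambda>(w, e). w @ [e]"])
      (auto simp: words_def length_Suc_conv_rev)
  finally show ?thesis by simp
qed

context monogenic
begin

text \<open>The coefficient of the tensor \<open>a\<^sub>0 \<otimes> \<dots> \<otimes> a\<^sub>r\<close> at \<open>x\<^sup>i\<^sup>0 \<otimes> \<dots> \<otimes> x\<^sup>i\<^sup>r\<close> once all scalars have been moved to
  the left, through the powers of \<open>x\<close>.\<close>

fun theta :: "nat list \<Rightarrow> 'a poly set list \<Rightarrow> 'a" where
  "theta [] [] = 1"
| "theta (i # is) (a # as) = cf a i * (\<alpha> ^^ i) (theta is as)"
| "theta _ _ = 0"

lemma theta_append:
  "length is = length us \<Longrightarrow>
    theta (is @ js) (us @ vs) = theta is us * (\<alpha> ^^ sum_list is) (theta js vs)"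
  by (induction "is" us rule: theta.induct) (simp_all add: pow_pow mult.assoc)

lemma theta_update_add:
  "length i = length t \<Longrightarrow> j < length t \<Longrightarrow> a \<in> carrier A \<Longrightarrow> a' \<in> carrier A \<Longrightarrow>
    theta i (t[j := a \<oplus>\<^bsub>A\<^esub> a']) = theta i (t[j := a]) + theta i (t[j := a'])"
  by (induction i t arbitrary: j rule: theta.induct)
    (auto simp: cf_add distrib_left distrib_right split: nat.split)

lemma theta_update_smult:
  "length i = length t \<Longrightarrow> set i \<subseteq> {..<n} \<Longrightarrow> set t \<subseteq> carrier A \<Longrightarrow> j < length t \<Longrightarrow>
    theta i (t[j := c \<odot>\<^bsub>A\<^esub> t ! j]) = scale c (theta i t)"
  by (induction i t arbitrary: j rule: theta.induct)
    (auto simp: cf_smult scale_mult_left scale_mult_right split: nat.split)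

lemma theta_balance:
  "length i = length t \<Longrightarrow> set i \<subseteq> {..<n} \<Longrightarrow> set t \<subseteq> carrier A \<Longrightarrow> Suc j < length t \<Longrightarrow>
    theta i (t[j := t ! j \<cdot> \<iota> y]) = theta i (t[Suc j := \<iota> y \<cdot> t ! Suc j])"
proof (induction i t arbitrary: j rule: theta.induct)
  case (2 e es a as)
  show ?case
  proof (cases j)
    case 0
    then obtain e' es' a' as' where "es = e' # es'" "as = a' # as'"
      using 2 by (cases es; cases as) auto
    then show ?thesis using 2 0 by (simp add: cf_iota_left cf_iota_right mult.assoc)
  next
    case (Suc k)
    then show ?thesis using 2 by simp
  qed
qed simp_all

text \<open>A scalar behind the last entry meets all powers of \<open>x\<close> on its way to the left. Together with
  \<open>theta_first\<close> this turns the cyclic relation into a commutator twisted by the sum of the word.\<close>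

lemma theta_last:
  "length i = Suc r \<Longrightarrow> length t = Suc r \<Longrightarrow> set i \<subseteq> {..<n} \<Longrightarrow> set t \<subseteq> carrier A \<Longrightarrow>
    theta i (t[r := t ! r \<cdot> \<iota> y]) = theta i t * (\<alpha> ^^ sum_list i) y"
proof (induction i t arbitrary: r rule: theta.induct)
  case (2 e es a as)
  show ?case
  proof (cases r)
    case 0
    then show ?thesis using 2 by (simp add: cf_iota_right)
  next
    case (Suc k)
    then show ?thesis using 2 by (simp add: mult.assoc pow_pow)
  qed
qed simp_all

lemma theta_first:
  "length i = Suc r \<Longrightarrow> length t = Suc r \<Longrightarrow> set i \<subseteq> {..<n} \<Longrightarrow> set t \<subseteq> carrier A \<Longrightarrow>
    theta i (t[0 := \<iota> y \<cdot> t ! 0]) = y * theta i t"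
  by (cases i; cases t) (auto simp: cf_iota_left mult.assoc)

lemma theta_degenerate:
  "length i = length t \<Longrightarrow> j < length t \<Longrightarrow> t ! j \<in> range \<iota> \<Longrightarrow> i ! j \<noteq> 0 \<Longrightarrow> theta i t = 0"
proof (induction i t arbitrary: j rule: theta.induct)
  case (2 e es a as)
  then show ?case by (cases j) (auto simp: iota_X cf_X)
qed simp_all

definition Theta :: "nat list \<Rightarrow> ('a poly set list \<Rightarrow>\<^sub>0 'k) \<Rightarrow> 'a" where
  "Theta i = lin_ext scale (theta i)"

sublocale Theta: Vector_Spaces.linear free_scale scale "Theta i" for i
  unfolding Theta_def by (rule lin_ext_linear)

lemma Theta_tup [simp]: "Theta i (tup t) = theta i t"
  by (simp add: Theta_def)

abbreviation R :: "nat \<Rightarrow> ('a poly set list \<Rightarrow>\<^sub>0 'k) set" where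
  "R r \<equiv> tensor_relations A \<iota> r"

abbreviation free_space :: "nat \<Rightarrow> ('a poly set list \<Rightarrow>\<^sub>0 'k) set" where
  "free_space r \<equiv> {c. Poly_Mapping.keys c \<subseteq> tuples A r}"

text \<open>The first exponent may be zero, since only the other tensor factors are taken modulo \<open>K\<close>.\<close>

definition cells :: "nat \<Rightarrow> nat list set" where
  "cells r = {i \<in> words n (Suc r). 0 \<notin> set (tl i)}"

lemma R_subspace: "free.subspace (R r)"
  unfolding tensor_relations_def by (rule free.subspace_span)

lemmas R_add = free.subspace_add[OF R_subspace]
  and R_diff = free.subspace_diff[OF R_subspace]
  and R_neg = free.subspace_neg[OF R_subspace]
  and R_zero = free.subspace_0[OF R_subspace]
  and R_scale = free.subspace_scale[OF R_subspace]
  and R_sum = free.subspace_sum[OF R_subspace]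

lemma free_space_subspace: "free.subspace (free_space r)"
  unfolding free.subspace_def
proof (intro conjI allI ballI)
  fix c d :: "'a poly set list \<Rightarrow>\<^sub>0 'k" and k
  assume "c \<in> free_space r"
  then show "free_scale k c \<in> free_space r" by (auto simp: in_keys_iff)
  assume "c \<in> free_space r" "d \<in> free_space r"
  then show "c + d \<in> free_space r" using keys_add[of c d] by blast
qed simp

lemma tup_free: "t \<in> tuples A r \<Longrightarrow> tup t \<in> free_space r"
  by (simp add: tup_def)

lemma tuples_update: "t \<in> tuples A r \<Longrightarrow> a \<in> carrier A \<Longrightarrow> t[i := a] \<in> tuples A r"
  using set_update_subset_insert[of t i a] by (auto simp: tuples_def)

lemma tuples_nth: "t \<in> tuples A r \<Longrightarrow> i \<le> r \<Longrightarrow> t ! i \<in> carrier A"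
  by (auto simp: tuples_def)

lemma tuples_update_smult: "t \<in> tuples A r \<Longrightarrow> i \<le> r \<Longrightarrow> t[i := c \<odot>\<^bsub>A\<^esub> t ! i] \<in> tuples A r"
  and tuples_update_right: "t \<in> tuples A r \<Longrightarrow> i \<le> r \<Longrightarrow> t[i := t ! i \<cdot> \<iota> y] \<in> tuples A r"
  and tuples_update_left: "t \<in> tuples A r \<Longrightarrow> i \<le> r \<Longrightarrow> t[i := \<iota> y \<cdot> t ! i] \<in> tuples A r"
  using tuples_update tuples_nth A_closed by meson+

lemmas relation_free = free.subspace_diff[OF free_space_subspace] free.subspace_scale[OF free_space_subspace]
  tup_free tuples_update_smult tuples_update_right tuples_update_left

lemma words_props: "i \<in> words b m \<Longrightarrow> length i = m" "i \<in> words b m \<Longrightarrow> set i \<subseteq> {..<b}"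
  by (auto simp: words_def)

text \<open>All relations but the degenerate tensors have coefficients in the twisted commutators at
  every index word, even at words with zeros in inner positions. Such words do occur when the
  exponents of a cell are split, so the full range is needed to see that boundaries of relations
  are relations.\<close>

lemma R_induct [consumes 1, case_names subspace balanced degenerate]:
  assumes "c \<in> R r" and S: "free.subspace S"
    and balanced: "\<And>c. c \<in> free_space r \<Longrightarrow>
      (\<And>i. i \<in> words n (Suc r) \<Longrightarrow> Theta i c \<in> N (sum_list i)) \<Longrightarrow> c \<in> S"
    and degenerate: "\<And>t i. t \<in> tuples A r \<Longrightarrow> 1 \<le> i \<Longrightarrow> i \<le> r \<Longrightarrow> t ! i \<in> range \<iota> \<Longrightarrow> tup t \<in> S"
  shows "c \<in> S"
proof -
  have "R r \<subseteq> S"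
    unfolding tensor_relations_def
  proof (intro free.span_minimal[OF _ S] Un_least subsetI; elim CollectE exE conjE)
    fix v :: "'a poly set list \<Rightarrow>\<^sub>0 'k" and t i a a'
    assume v: "v = tup (t[i := a \<oplus>\<^bsub>A\<^esub> a']) - tup (t[i := a]) - tup (t[i := a'])"
      and t: "t \<in> tuples A r" "i \<le> r" "a \<in> carrier A" "a' \<in> carrier A"
    show "v \<in> S"
      unfolding v
      by (rule balanced, intro relation_free tuples_update A_closed t)
        (use t in \<open>simp add: Theta.diff tuples_def words_props theta_update_add N_zero\<close>)
  next
    fix v :: "'a poly set list \<Rightarrow>\<^sub>0 'k" and t i c
    assume v: "v = tup (t[i := c \<odot>\<^bsub>A\<^esub> t ! i]) - free_scale c (tup t)" and t: "t \<in> tuples A r" "i \<le> r"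
    show "v \<in> S"
      unfolding v
      by (rule balanced, intro relation_free t)
        (use t in \<open>simp add: Theta.diff Theta.scale tuples_def words_props theta_update_smult N_zero\<close>)
  next
    fix v :: "'a poly set list \<Rightarrow>\<^sub>0 'k" and t i y
    assume v: "v = tup (t[i := t ! i \<cdot> \<iota> y]) - tup (t[Suc i := \<iota> y \<cdot> t ! Suc i])"
      and t: "t \<in> tuples A r" "i < r"
    have i: "i \<le> r" "Suc i \<le> r" using t by auto
    show "v \<in> S"
      unfolding v
      by (rule balanced, intro relation_free t i)
        (use t in \<open>simp add: Theta.diff tuples_def words_props theta_balance N_zero\<close>)
  next
    fix v :: "'a poly set list \<Rightarrow>\<^sub>0 'k" and t y
    assume v: "v = tup (t[r := t ! r \<cdot> \<iota> y]) - tup (t[0 := \<iota> y \<cdot> t ! 0])"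
      and t: "t \<in> tuples A r"
    show "v \<in> S"
      unfolding v
      by (rule balanced, intro relation_free t order.refl le0)
        (use t N_generator in \<open>simp add: Theta.diff tuples_def words_props theta_last theta_first\<close>)
  next
    fix v :: "'a poly set list \<Rightarrow>\<^sub>0 'k" and t i assume "v = tup t" "t \<in> tuples A r" "1 \<le> i" "i \<le> r" "t ! i \<in> range \<iota>"
    then show "v \<in> S" using degenerate by simp
  qed
  then show ?thesis using assms(1) by blast
qed

lemma R_free: "R r \<subseteq> free_space r"
proof
  fix c assume "c \<in> R r"
  then show "c \<in> free_space r"
    by (induction rule: R_induct) (simp_all add: free_space_subspace tup_free del: mem_Collect_eq)
qed

lemma Theta_R: "c \<in> R r \<Longrightarrow> i \<in> cells r \<Longrightarrow> Theta i c \<in> N (sum_list i)"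
proof -
  assume c: "c \<in> R r" and i: "i \<in> cells r"
  then have i': "length i = Suc r" "0 \<notin> set (tl i)" by (auto simp: cells_def words_def)
  have "c \<in> {c. Theta i c \<in> N (sum_list i)}"
    using c
  proof (induction rule: R_induct)
    case subspace
    show ?case
      by (auto simp: free.subspace_def Theta.add Theta.scale Theta.zero N_zero N_add N_scale)
  next
    case (balanced c)
    then show ?case using i by (simp add: cells_def)
  next
    case (degenerate t j)
    have "i ! j = tl i ! (j - 1)" "j - 1 < length (tl i)"
      using degenerate i' by (auto simp: nth_tl)
    then have "i ! j \<noteq> 0" using i' by (metis nth_mem)
    then show ?case
      using i' degenerate theta_degenerate[of i t j] by (simp add: tuples_def N_zero)
  qed
  then show ?thesis by simp
qed

section \<open>Normal form of relative tensors\<close>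

definition chain_cong :: "nat \<Rightarrow> ('a poly set list \<Rightarrow>\<^sub>0 'k) \<Rightarrow> ('a poly set list \<Rightarrow>\<^sub>0 'k) \<Rightarrow> bool" where
  "chain_cong r c d \<longleftrightarrow> c - d \<in> R r"

lemma cong_refl [simp]: "chain_cong r c c"
  by (simp add: chain_cong_def R_zero)

lemma cong_sym: "chain_cong r c d \<Longrightarrow> chain_cong r d c"
  unfolding chain_cong_def using R_neg by fastforce

lemma cong_trans [trans]: "chain_cong r c d \<Longrightarrow> chain_cong r d e \<Longrightarrow> chain_cong r c e"
  unfolding chain_cong_def using R_add[of "c - d" r "d - e"] by simp

lemma cong_eq_trans [trans]: "chain_cong r c d \<Longrightarrow> d = e \<Longrightarrow> chain_cong r c e"
  and eq_cong_trans [trans]: "c = d \<Longrightarrow> chain_cong r d e \<Longrightarrow> chain_cong r c e"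
  by simp_all

lemma cong_add: "chain_cong r c d \<Longrightarrow> chain_cong r c' d' \<Longrightarrow> chain_cong r (c + c') (d + d')"
  unfolding chain_cong_def using R_add[of "c - d" r "c' - d'"] by (simp add: algebra_simps)

lemma cong_diff: "chain_cong r c d \<Longrightarrow> chain_cong r c' d' \<Longrightarrow> chain_cong r (c - c') (d - d')"
  unfolding chain_cong_def using R_diff[of "c - d" r "c' - d'"] by (simp add: algebra_simps)

lemma cong_scale: "chain_cong r c d \<Longrightarrow> chain_cong r (free_scale k c) (free_scale k d)"
  unfolding chain_cong_def using R_scale[of "c - d" r k] by (simp add: free.scale_right_diff_distrib)

lemma cong_sum: "(\<And>s. s \<in> S \<Longrightarrow> chain_cong r (f s) (g s)) \<Longrightarrow> chain_cong r (sum f S) (sum g S)"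
  unfolding chain_cong_def sum_subtractf[symmetric] by (rule R_sum)

lemma cong_zero_iff: "chain_cong r c 0 \<longleftrightarrow> c \<in> R r"
  by (simp add: chain_cong_def)

lemma tup_add:
  assumes "set us \<subseteq> carrier A" "set vs \<subseteq> carrier A" "length us + length vs = r"
    "a \<in> carrier A" "a' \<in> carrier A"
  shows "chain_cong r (tup (us @ (a \<oplus>\<^bsub>A\<^esub> a') # vs)) (tup (us @ a # vs) + tup (us @ a' # vs))"
proof -
  have t: "us @ a # vs \<in> tuples A r" using assms by (simp add: tuples_def)
  have "tup ((us @ a # vs)[length us := a \<oplus>\<^bsub>A\<^esub> a']) - tup ((us @ a # vs)[length us := a])
      - tup ((us @ a # vs)[length us := a']) \<in> R r"
    unfolding tensor_relations_def
    by (rule free.span_base, intro UnI1 CollectI exI conjI, rule refl) (use t assms in auto)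
  then show ?thesis by (simp add: chain_cong_def diff_diff_eq)
qed

lemma tup_smult:
  assumes "set us \<subseteq> carrier A" "set vs \<subseteq> carrier A" "length us + length vs = r" "a \<in> carrier A"
  shows "chain_cong r (tup (us @ (c \<odot>\<^bsub>A\<^esub> a) # vs)) (free_scale c (tup (us @ a # vs)))"
proof -
  have t: "us @ a # vs \<in> tuples A r" using assms by (simp add: tuples_def)
  have "tup ((us @ a # vs)[length us := c \<odot>\<^bsub>A\<^esub> (us @ a # vs) ! length us])
      - free_scale c (tup (us @ a # vs)) \<in> R r"
    unfolding tensor_relations_def
    by (rule free.span_base, rule UnI1, rule UnI1, rule UnI1, rule UnI2, intro CollectI exI conjI, rule refl)
      (use t assms in auto)
  then show ?thesis by (simp add: chain_cong_def)
qed

lemma tup_balance: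
  assumes "set us \<subseteq> carrier A" "set vs \<subseteq> carrier A" "length us + length vs + 1 = r"
    "a \<in> carrier A" "b \<in> carrier A"
  shows "chain_cong r (tup (us @ (a \<cdot> \<iota> y) # b # vs)) (tup (us @ a # (\<iota> y \<cdot> b) # vs))"
proof -
  let ?t = "us @ a # b # vs"
  have t: "?t \<in> tuples A r" using assms by (simp add: tuples_def)
  have "tup (?t[length us := ?t ! length us \<cdot> \<iota> y])
      - tup (?t[Suc (length us) := \<iota> y \<cdot> ?t ! Suc (length us)]) \<in> R r"
    unfolding tensor_relations_def
    by (rule free.span_base, rule UnI1, rule UnI1, rule UnI2, intro CollectI exI conjI, rule refl)
      (use t assms in auto)
  then show ?thesis by (simp add: chain_cong_def list_update_append nth_append)
qed

lemma tup_cyclic: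
  assumes t: "t \<in> tuples A r"
  shows "chain_cong r (tup (t[r := t ! r \<cdot> \<iota> y])) (tup (t[0 := \<iota> y \<cdot> t ! 0]))"
  unfolding chain_cong_def tensor_relations_def
  by (rule free.span_base, rule UnI1, rule UnI2, intro CollectI exI conjI, rule refl)
    (use t in auto)

lemma tup_degenerate:
  assumes "t \<in> tuples A r" "1 \<le> i" "i \<le> r" "t ! i \<in> range \<iota>"
  shows "tup t \<in> R r"
  unfolding tensor_relations_def
  by (rule free.span_base, rule UnI2, intro CollectI exI conjI, rule refl) (use assms in auto)

lemma tup_sum:
  assumes "set us \<subseteq> carrier A" "set vs \<subseteq> carrier A" "length us + length vs = r"
    and E: "finite E"
  shows "chain_cong r (tup (us @ cls (\<Sum>e\<in>E. p e) # vs)) (\<Sum>e\<in>E. tup (us @ cls (p e) # vs))"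
  using E
proof induction
  case empty
  have "chain_cong r (tup (us @ cls 0 # vs)) (tup (us @ cls 0 # vs) + tup (us @ cls 0 # vs))"
    using tup_add[OF assms(1-3), of "cls 0" "cls 0"] by (simp add: carrier_A cls_add)
  then have "- tup (us @ cls 0 # vs) \<in> R r" by (simp add: chain_cong_def)
  from R_neg[OF this] show ?case by (simp add: chain_cong_def)
next
  case (insert e E)
  have "chain_cong r (tup (us @ cls (\<Sum>e\<in>insert e E. p e) # vs))
      (tup (us @ cls (p e) # vs) + tup (us @ cls (\<Sum>e\<in>E. p e) # vs))"
    using tup_add[OF assms(1-3), of "cls (p e)" "cls (\<Sum>e\<in>E. p e)"] insert
    by (simp add: carrier_A cls_add)
  also have "chain_cong r \<dots> (\<Sum>e\<in>insert e E. tup (us @ cls (p e) # vs))"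
    using insert by (simp add: cong_add)
  finally show ?case .
qed

lemma X_eq_iota_mult: "X y e = \<iota> y \<cdot> X 1 e"
  by (simp add: iota_X X_mult)

lemma cls_monom: "cls (monom y e) = \<iota> y \<cdot> X 1 e"
  using X_eq_iota_mult[of y e] unfolding X_def[of y e] .

lemma A_iota_one: "a \<in> carrier A \<Longrightarrow> a \<cdot> \<iota> 1 = a"
  by (auto simp: carrier_A iota_X X_def cls_mult monom_0 ore_mult_one)

lemma set_X: "set (map (X y) w) \<subseteq> carrier A"
  by auto

text \<open>Entries are expanded from the right: an entry times a scalar is a sum of terms \<open>y x\<^sup>e\<close>, and the
  scalar \<open>y\<close> is handed over to the next entry on the left.\<close>

lemma tup_normal_form_aux:
  assumes "set us \<subseteq> carrier A" "a \<in> carrier A" "set vs \<subseteq> carrier A" "length us + length vs = r"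
  shows "chain_cong r (tup (us @ a # vs))
    (\<Sum>w\<in>words n (length vs). tup (us @ (a \<cdot> \<iota> (theta w vs)) # map (X 1) w))"
  using assms
proof (induction vs arbitrary: us a)
  case Nil
  then show ?case by (simp add: A_iota_one)
next
  case (Cons v vs)
  have "chain_cong r (tup ((us @ [a]) @ v # vs))
     (\<Sum>w\<in>words n (length vs). tup ((us @ [a]) @ (v \<cdot> \<iota> (theta w vs)) # map (X 1) w))"
    using Cons.prems by (intro Cons.IH) auto
  also have "chain_cong r \<dots> (\<Sum>w\<in>words n (length vs). \<Sum>e<n.
      tup (us @ (a \<cdot> \<iota> (theta (e # w) (v # vs))) # map (X 1) (e # w)))"
  proof (rule cong_sum)
    fix w assume w: "w \<in> words n (length vs)"
    let ?p = "theta w vs"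
    let ?c = "\<lambda>e. cf (v \<cdot> \<iota> ?p) e"
    have v: "v \<in> carrier A" using Cons.prems by simp
    have "tup ((us @ [a]) @ (v \<cdot> \<iota> ?p) # map (X 1) w)
        = tup ((us @ [a]) @ cls (\<Sum>e<n. monom (?c e) e) # map (X 1) w)"
      using A_expand[of "v \<cdot> \<iota> ?p"] v by simp
    also have "chain_cong r \<dots> (\<Sum>e<n. tup ((us @ [a]) @ cls (monom (?c e) e) # map (X 1) w))"
      using Cons.prems w by (intro tup_sum set_X) (auto simp: words_def)
    also have "\<dots> = (\<Sum>e<n. tup (us @ a # (\<iota> (?c e) \<cdot> X 1 e) # map (X 1) w))"
      by (simp only: cls_monom append.simps append_assoc)
    also have "chain_cong r \<dots> (\<Sum>e<n.
      tup (us @ (a \<cdot> \<iota> (theta (e # w) (v # vs))) # map (X 1) (e # w)))"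
    proof (rule cong_sum)
      fix e assume "e \<in> {..<n}"
      then have c: "?c e = theta (e # w) (v # vs)" using v by (simp add: cf_iota_right)
      show "chain_cong r (tup (us @ a # (\<iota> (?c e) \<cdot> X 1 e) # map (X 1) w))
        (tup (us @ (a \<cdot> \<iota> (theta (e # w) (v # vs))) # map (X 1) (e # w)))"
        unfolding c list.map
        using Cons.prems w by (intro cong_sym[OF tup_balance] set_X) (auto simp: words_def)
    qed
    finally show "chain_cong r (tup ((us @ [a]) @ (v \<cdot> \<iota> ?p) # map (X 1) w)) (\<Sum>e<n.
      tup (us @ (a \<cdot> \<iota> (theta (e # w) (v # vs))) # map (X 1) (e # w)))" .
  qed
  also have "\<dots> = (\<Sum>w\<in>words n (length (v # vs)).
      tup (us @ (a \<cdot> \<iota> (theta w (v # vs))) # map (X 1) w))"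
    by (simp add: sum_words_Cons del: theta.simps) (rule sum.swap)
  finally show ?case by simp
qed

definition word :: "'a \<Rightarrow> nat \<Rightarrow> nat list \<Rightarrow> ('a poly set list \<Rightarrow>\<^sub>0 'k)" where
  "word y e w = tup (X y e # map (X 1) w)"

definition Word :: "'a \<Rightarrow> nat list \<Rightarrow> ('a poly set list \<Rightarrow>\<^sub>0 'k)" where
  "Word y i = word y (hd i) (tl i)"

lemma word_tuples: "length w = r \<Longrightarrow> X y e # map (X z) w \<in> tuples A r"
  by (auto simp: tuples_def)

lemma word_free: "length w = r \<Longrightarrow> word y e w \<in> free_space r"
  unfolding word_def by (intro tup_free word_tuples)

lemma word_degenerate: "0 \<in> set w \<Longrightarrow> length w = r \<Longrightarrow> word y e w \<in> R r"
proof -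
  assume "0 \<in> set w" and l: "length w = r"
  then obtain k where k: "k < length w" "w ! k = 0" by (auto simp: in_set_conv_nth)
  show ?thesis
    unfolding word_def
    by (rule tup_degenerate[where i = "Suc k"]) (use k l in \<open>auto simp: word_tuples iota_X[symmetric]\<close>)
qed

lemma word_add: "chain_cong (length w) (word (y + z) e w) (word y e w + word z e w)"
  unfolding word_def X_add using tup_add[of "[]" "map (X 1) w" "length w" "X y e" "X z e"] set_X by simp

lemma word_scale: "chain_cong (length w) (word (scale c y) e w) (free_scale c (word y e w))"
  unfolding word_def X_scale using tup_smult[of "[]" "map (X 1) w" "length w" "X y e"] set_X by simp

lemma word_zero: "word 0 e w \<in> R (length w)"
  using word_add[of w 0 0 e] R_neg[of "- word 0 e w"] by (auto simp: chain_cong_def)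

lemma word_sum:
  assumes "finite S"
  shows "chain_cong (length w) (word (\<Sum>s\<in>S. f s) e w) (\<Sum>s\<in>S. word (f s) e w)"
  using assms
proof induction
  case (insert s S)
  have "chain_cong (length w) (word (f s + sum f S) e w) (word (f s) e w + word (sum f S) e w)"
    by (rule word_add)
  also have "chain_cong (length w) \<dots> (word (f s) e w + (\<Sum>s\<in>S. word (f s) e w))"
    using insert by (simp add: cong_add)
  finally show ?case using insert by simp
qed (simp add: chain_cong_def word_zero)

lemma tup_normal_form:
  assumes t: "t \<in> tuples A r"
  shows "chain_cong r (tup t) (\<Sum>i\<in>cells r. Word (theta i t) i)"
proof -
  obtain a vs where avs: "t = a # vs" "a \<in> carrier A" "set vs \<subseteq> carrier A" "length vs = r"
    using t by (cases t) (auto simp: tuples_def)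
  have "chain_cong r (tup t) (\<Sum>w\<in>words n r. tup ((a \<cdot> \<iota> (theta w vs)) # map (X 1) w))"
    using tup_normal_form_aux[of "[]" a vs r] avs by simp
  also have "chain_cong r \<dots> (\<Sum>w\<in>words n r. \<Sum>e<n. word (theta (e # w) t) e w)"
  proof (rule cong_sum)
    fix w assume w: "w \<in> words n r"
    let ?b = "a \<cdot> \<iota> (theta w vs)"
    have "tup (?b # map (X 1) w) = tup ([] @ cls (\<Sum>e<n. monom (cf ?b e) e) # map (X 1) w)"
      using A_expand[of ?b] avs by simp
    also have "chain_cong r \<dots> (\<Sum>e<n. tup ([] @ cls (monom (cf ?b e) e) # map (X 1) w))"
      using w by (intro tup_sum set_X) (auto simp: words_def)
    also have "\<dots> = (\<Sum>e<n. word (theta (e # w) t) e w)"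
      using avs by (intro sum.cong) (auto simp: word_def X_def cf_iota_right)
    finally show "chain_cong r (tup (?b # map (X 1) w)) (\<Sum>e<n. word (theta (e # w) t) e w)" .
  qed
  also have "\<dots> = (\<Sum>i\<in>words n (Suc r). Word (theta i t) i)"
    by (simp add: sum_words_Cons Word_def del: theta.simps) (rule sum.swap)
  also have "chain_cong r \<dots> (\<Sum>i\<in>words n (Suc r). if i \<in> cells r then Word (theta i t) i else 0)"
    by (rule cong_sum)
      (auto simp: cells_def Word_def cong_zero_iff words_def intro!: word_degenerate)
  also have "\<dots> = (\<Sum>i\<in>cells r. Word (theta i t) i)"
    by (simp add: sum.If_cases cells_def Int_def)
  finally show ?thesis .
qed

lemma finite_cells [simp]: "finite (cells r)"
  by (simp add: cells_def)

lemma chain_normal_form: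
  assumes c: "c \<in> free_space r"
  shows "chain_cong r c (\<Sum>i\<in>cells r. Word (Theta i c) i)"
proof -
  let ?K = "Poly_Mapping.keys c"
  have "c = (\<Sum>t\<in>?K. free_scale (Poly_Mapping.lookup c t) (tup t))"
    using lin_ext_tup_self[of c] by (simp add: lin_ext_def)
  also have "chain_cong r \<dots> (\<Sum>t\<in>?K. free_scale (Poly_Mapping.lookup c t) (\<Sum>i\<in>cells r. Word (theta i t) i))"
    using c by (intro cong_sum cong_scale tup_normal_form) auto
  also have "\<dots> = (\<Sum>i\<in>cells r. \<Sum>t\<in>?K. free_scale (Poly_Mapping.lookup c t) (Word (theta i t) i))"
    by (simp add: free.scale_sum_right) (rule sum.swap)
  also have "chain_cong r \<dots> (\<Sum>i\<in>cells r. Word (Theta i c) i)"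
  proof (rule cong_sum)
    fix i assume "i \<in> cells r"
    then have l: "length (tl i) = r" by (simp add: cells_def words_def)
    have "chain_cong r (\<Sum>t\<in>?K. free_scale (Poly_Mapping.lookup c t) (Word (theta i t) i))
        (\<Sum>t\<in>?K. Word (scale (Poly_Mapping.lookup c t) (theta i t)) i)"
      unfolding Word_def by (intro cong_sum cong_sym[OF word_scale[of "tl i", unfolded l]])
    also have "chain_cong r \<dots> (Word (\<Sum>t\<in>?K. scale (Poly_Mapping.lookup c t) (theta i t)) i)"
      unfolding Word_def by (intro cong_sym[OF word_sum[of _ "tl i", unfolded l]]) simp
    finally show "chain_cong r (\<Sum>t\<in>?K. free_scale (Poly_Mapping.lookup c t) (Word (theta i t) i)) (Word (Theta i c) i)"
      by (simp add: Theta_def lin_ext_def)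
  qed
  finally show ?thesis .
qed

lemma theta_X_ones:
  assumes "length w = length v" "set v \<subseteq> {..<n}"
  shows "set w \<subseteq> {..<n} \<Longrightarrow> theta w (map (X 1) v) = (if w = v then 1 else 0)"
  using assms
  by (induction w v rule: list_induct2) (auto simp: cf_X)

lemma theta_word:
  assumes "length w = length v" "set v \<subseteq> {..<n}" "set w \<subseteq> {..<n}" "e < n"
  shows "theta (e # w) (X y e' # map (X 1) v)
    = (if w = v \<and> e' mod n = e then y * q ^ (e' div n) else 0)"
  using assms by (auto simp: theta_X_ones cf_X)

lemma Theta_word:
  assumes "length w = length v" "set v \<subseteq> {..<n}" "set w \<subseteq> {..<n}" "e < n"
  shows "Theta (e # w) (word y e' v) = (if w = v \<and> e' mod n = e then y * q ^ (e' div n) else 0)"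
  unfolding word_def using assms by (simp add: theta_word del: theta.simps)

text \<open>Append a scalar \<open>y\<close> to the last entry of the tensor with coefficient \<open>y'\<close>. The normal form moves
  it to the left through all entries, which twists it; the cyclic relation moves it
  to the front directly, without a twist.\<close>

lemma word_N_reduced:
  assumes e: "e < n" and w: "set w \<subseteq> {..<n}" and y: "y \<in> N (e + sum_list w)"
  shows "word y e w \<in> R (length w)"
  using y
proof (induction rule: N_induct)
  case zero
  show ?case by (rule word_zero)
next
  case (add c x y)
  have "chain_cong (length w) (word (scale c x + y) e w) (word (scale c x) e w + word y e w)"
    by (rule word_add)
  also have "chain_cong (length w) \<dots> (free_scale c (word x e w) + word y e w)"
    by (intro cong_add word_scale cong_refl)
  also have "chain_cong (length w) \<dots> (free_scale c 0 + 0)"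
    using add by (intro cong_add cong_scale) (simp_all add: cong_zero_iff)
  finally show ?case by (simp add: cong_zero_iff)
next
  case (generator y y')
  let ?r = "length w"
  let ?z = "y' * (\<alpha> ^^ (e + sum_list w)) y"
  define t where "t = X y' e # map (X 1) w"
  have t: "t \<in> tuples A ?r" by (simp add: t_def word_tuples)
  let ?t = "t[?r := t ! ?r \<cdot> \<iota> y]"
  have t': "?t \<in> tuples A ?r" using t by (intro tuples_update A_closed tuples_nth) auto
  show ?case
  proof (cases "0 \<in> set w")
    case True
    then show ?thesis by (rule word_degenerate) simp
  next
    case False
    then have cell: "e # w \<in> cells ?r" using e w by (simp add: cells_def words_def)
    have th: "theta i ?t = (if i = e # w then ?z else 0)" if i: "i \<in> cells ?r" for i
    proof -
      obtain e' w' where i': "i = e' # w'" "length w' = ?r" "set w' \<subseteq> {..<n}" "e' < n"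
        using i by (cases i) (auto simp: cells_def words_def)
      have "theta i ?t = theta i t * (\<alpha> ^^ sum_list i) y"
        using t i' by (intro theta_last) (auto simp: tuples_def)
      also have "theta i t = (if i = e # w then y' else 0)"
        using i' w e theta_word[of w' w e' y' e] by (auto simp: t_def simp del: theta.simps)
      finally show ?thesis using i' by auto
    qed
    have "chain_cong ?r (tup ?t) (\<Sum>i\<in>cells ?r. Word (theta i ?t) i)"
      using t' by (rule tup_normal_form)
    also have "chain_cong ?r \<dots> (\<Sum>i\<in>cells ?r. if i = e # w then word ?z e w else 0)"
    proof (rule cong_sum)
      fix i assume i: "i \<in> cells ?r"
      then have "length (tl i) = ?r" by (simp add: cells_def words_def)
      then show "chain_cong ?r (Word (theta i ?t) i) (if i = e # w then word ?z e w else 0)"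
        using word_zero[of _ "tl i"] by (auto simp: th[OF i] Word_def cong_zero_iff)
    qed
    also have "\<dots> = word ?z e w" using cell by simp
    finally have 1: "chain_cong ?r (tup ?t) (word ?z e w)" .
    have "chain_cong ?r (tup ?t) (tup (t[0 := \<iota> y \<cdot> t ! 0]))"
      using t by (rule tup_cyclic)
    also have "\<dots> = word (y * y') e w"
      by (simp add: t_def word_def iota_X X_mult)
    finally have 2: "chain_cong ?r (word ?z e w) (word (y * y') e w)"
      using cong_trans[OF cong_sym[OF 1]] by blast
    have "chain_cong ?r (word ((?z - y * y') + y * y') e w) (word (?z - y * y') e w + word (y * y') e w)"
      by (rule word_add)
    then have "chain_cong ?r (word ?z e w - word (y * y') e w) (word (?z - y * y') e w)"
      by (simp add: chain_cong_def diff_diff_eq2 algebra_simps)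
    from cong_sym[OF this] have "chain_cong ?r (word (?z - y * y') e w) 0"
      using cong_trans cong_diff[OF 2 cong_refl[of ?r "word (y * y') e w"]] by fastforce
    then show ?thesis by (simp add: cong_zero_iff)
  qed
qed

lemma word_reduce: "word y (e + k * n) w = word (y * q ^ k) e w"
proof (induction k arbitrary: y)
  case (Suc k)
  have "word y (e + Suc k * n) w = word (y * q) (e + k * n) w"
    using X_reduce[of y "e + k * n"] by (simp add: word_def ac_simps)
  then show ?case using Suc by (simp add: mult.assoc)
qed simp

lemma word_N:
  assumes w: "set w \<subseteq> {..<n}" and y: "y \<in> N (e + sum_list w)"
  shows "word y e w \<in> R (length w)"
proof -
  have e: "e = e mod n + e div n * n" by simp
  have "y \<in> N (e mod n + sum_list w + e div n * n)" using y by (metis add.assoc add.commute e)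
  then have "y * q ^ (e div n) \<in> N (e mod n + sum_list w)" by (rule N_qpow)
  then have "word (y * q ^ (e div n)) (e mod n) w \<in> R (length w)"
    using w n_ge_2 by (intro word_N_reduced) auto
  then show ?thesis using word_reduce e by metis
qed

text \<open>
  The normal form of a chain is built from its coefficients, and words whose coefficients are
  twisted commutators are relations. So the converse of \<open>Theta_R\<close> holds.
\<close>

lemma R_if_Theta:
  assumes c: "c \<in> free_space r" and N: "\<And>i. i \<in> cells r \<Longrightarrow> Theta i c \<in> N (sum_list i)"
  shows "c \<in> R r"
proof -
  have "chain_cong r c (\<Sum>i\<in>cells r. Word (Theta i c) i)" using c by (rule chain_normal_form)
  also have "chain_cong r \<dots> 0"
    unfolding cong_zero_iff
  proof (rule R_sum)
    fix i assume i: "i \<in> cells r"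
    then obtain e w where ew: "i = e # w" "length w = r" "set w \<subseteq> {..<n}"
      by (cases i) (auto simp: cells_def words_def)
    then show "Word (Theta i c) i \<in> R r"
      using word_N[of w "Theta i c" e] N[OF i] by (simp add: Word_def)
  qed
  finally show ?thesis by (simp add: cong_zero_iff)
qed

end

section \<open>The Hochschild boundary in coordinates\<close>

context monogenic
begin

definition face :: "nat \<Rightarrow> nat \<Rightarrow> 'a poly set list \<Rightarrow> 'a poly set list" where
  "face r k t = (if k < r then take k t @ [t ! k \<cdot> t ! Suc k] @ drop (Suc (Suc k)) t
                 else (t ! r \<cdot> t ! 0) # butlast (tl t))"

abbreviation bd :: "nat \<Rightarrow> ('a poly set list \<Rightarrow>\<^sub>0 'k) \<Rightarrow> ('a poly set list \<Rightarrow>\<^sub>0 'k)" where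
  "bd \<equiv> free_boundary A"

lemma bd_linear: "Vector_Spaces.linear free_scale free_scale (bd r)"
proof -
  have "bd r = lin_ext free_scale (tuple_boundary A r)"
    by (simp add: fun_eq_iff free_boundary_def lin_ext_def)
  then show ?thesis by (simp add: free.lin_ext_linear)
qed

sublocale bd: Vector_Spaces.linear free_scale free_scale "bd r" for r
  by (rule bd_linear)

lemma bd_tup: "bd r (tup t) = (\<Sum>k\<le>r. free_scale ((- 1) ^ k) (tup (face r k t)))"
proof -
  have "bd r = lin_ext free_scale (tuple_boundary A r)"
    by (simp add: fun_eq_iff free_boundary_def lin_ext_def)
  then have "bd r (tup t) = tuple_boundary A r t" by simp
  also have "\<dots> = (\<Sum>k\<le>r. free_scale ((- 1) ^ k) (tup (face r k t)))"
    by (simp add: tuple_boundary_def face_def lessThan_Suc_atMost[symmetric])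
  finally show ?thesis .
qed

lemma length_face [simp]: "length t = Suc (Suc r) \<Longrightarrow> k \<le> Suc r \<Longrightarrow> length (face (Suc r) k t) = Suc r"
  by (auto simp: face_def)

lemma face_nth:
  assumes "length t = Suc (Suc r)" "k \<le> Suc r" "j \<le> r"
  shows "face (Suc r) k t ! j =
    (if k = Suc r then (if j = 0 then t ! Suc r \<cdot> t ! 0 else t ! j)
     else if j < k then t ! j else if j = k then t ! k \<cdot> t ! Suc k else t ! Suc j)"
  using assms by (auto simp: face_def nth_append nth_Cons' nth_butlast nth_tl)

lemma face_tuples: "t \<in> tuples A (Suc r) \<Longrightarrow> k \<le> Suc r \<Longrightarrow> face (Suc r) k t \<in> tuples A r"
proof -
  assume t: "t \<in> tuples A (Suc r)" and k: "k \<le> Suc r"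
  then have l: "length t = Suc (Suc r)" by (simp add: tuples_def)
  have "face (Suc r) k t ! j \<in> carrier A" if "j \<le> r" for j
    using that k t by (auto simp: face_nth[OF l k that] intro!: A_closed tuples_nth[OF t])
  then show ?thesis
    using l k by (auto simp: tuples_def in_set_conv_nth less_Suc_eq_le)
qed

lemma free_space_induct [consumes 1, case_names subspace tup]:
  assumes "c \<in> free_space r" "free.subspace S" "\<And>t. t \<in> tuples A r \<Longrightarrow> tup t \<in> S"
  shows "c \<in> S"
proof -
  have "c = (\<Sum>t\<in>Poly_Mapping.keys c. free_scale (Poly_Mapping.lookup c t) (tup t))"
    using lin_ext_tup_self[of c] by (simp add: lin_ext_def)
  also have "\<dots> \<in> S"
    using assms by (intro free.subspace_sum free.subspace_scale) auto
  finally show ?thesis .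
qed

lemma bd_free: "c \<in> free_space (Suc r) \<Longrightarrow> bd (Suc r) c \<in> free_space r"
proof -
  assume c: "c \<in> free_space (Suc r)"
  have "c \<in> {c. bd (Suc r) c \<in> free_space r}"
    using c
  proof (induction rule: free_space_induct)
    case subspace
    show ?case
      using free_space_subspace[of r]
      by (simp add: free.subspace_def bd.add bd.scale bd.zero del: mem_Collect_eq)
        (simp add: bd.add bd.scale)
  next
    case (tup t)
    then show ?case
      unfolding mem_Collect_eq[of _ "\<lambda>c. bd (Suc r) c \<in> free_space r"] bd_tup
      by (intro free.subspace_sum free.subspace_scale free_space_subspace tup_free face_tuples) auto
  qed
  then show ?thesis by simp
qed

text \<open>The simplicial identities. Associativity enters where two neighbouring faces merge the same
  three entries, cyclically understood.\<close>

lemma face_face: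
  assumes t: "t \<in> tuples A (Suc (Suc m))" and lk: "l < k" "k \<le> Suc (Suc m)"
  shows "face (Suc m) l (face (Suc (Suc m)) k t) = face (Suc m) (k - 1) (face (Suc (Suc m)) l t)"
proof (rule nth_equalityI)
  have len: "length t = Suc (Suc (Suc m))" using t by (simp add: tuples_def)
  have car: "t ! i \<in> carrier A" if "i \<le> Suc (Suc m)" for i using t that by (rule tuples_nth)
  let ?a = "face (Suc (Suc m)) k t" and ?b = "face (Suc (Suc m)) l t"
  have la: "length ?a = Suc (Suc m)" and lb: "length ?b = Suc (Suc m)"
    using len lk by auto
  show "length (face (Suc m) l ?a) = length (face (Suc m) (k - 1) ?b)"
    using la lb lk by simp
  fix i assume "i < length (face (Suc m) l ?a)"
  then have i: "i \<le> m" using la lk by simp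
  have na: "?a ! j = (if k = Suc (Suc m) then (if j = 0 then t ! Suc (Suc m) \<cdot> t ! 0 else t ! j)
     else if j < k then t ! j else if j = k then t ! k \<cdot> t ! Suc k else t ! Suc j)"
    if "j \<le> Suc m" for j using face_nth[OF len lk(2) that] .
  have nb: "?b ! j = (if j < l then t ! j else if j = l then t ! l \<cdot> t ! Suc l else t ! Suc j)"
    if "j \<le> Suc m" for j using face_nth[OF len _ that, of l] lk by simp
  have "face (Suc m) l ?a ! i = (if l = Suc m then (if i = 0 then ?a ! Suc m \<cdot> ?a ! 0 else ?a ! i)
     else if i < l then ?a ! i else if i = l then ?a ! l \<cdot> ?a ! Suc l else ?a ! Suc i)"
    using lk by (intro face_nth[OF la _ i]) auto
  moreover have "face (Suc m) (k - 1) ?b ! i =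
     (if k - 1 = Suc m then (if i = 0 then ?b ! Suc m \<cdot> ?b ! 0 else ?b ! i)
     else if i < k - 1 then ?b ! i else if i = k - 1 then ?b ! (k - 1) \<cdot> ?b ! Suc (k - 1) else ?b ! Suc i)"
    using lk by (intro face_nth[OF lb _ i]) auto
  ultimately show "face (Suc m) l ?a ! i = face (Suc m) (k - 1) ?b ! i"
    using i lk na nb car by (auto simp: A_assoc)
qed

text \<open>The usual cancellation: the pairs of faces with \<open>l < k\<close> correspond to those with \<open>k \<le> l\<close>, with
  opposite signs.\<close>

lemma bd_bd_tup:
  assumes t: "t \<in> tuples A (Suc (Suc m))"
  shows "bd (Suc m) (bd (Suc (Suc m)) (tup t)) = 0"
proof -
  define r where "r = Suc m"
  define f where "f k l = free_scale ((- 1) ^ (k + l)) (tup (face r l (face (Suc r) k t)) :: _ \<Rightarrow>\<^sub>0 'k)" for k l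
  have ff: "f k l = - f l (k - 1)" if "l < k" "k \<le> Suc r" for k l
  proof -
    have "(- 1 :: 'k) ^ (k + l) = - ((- 1) ^ (l + (k - 1)))"
      using that by (cases k) (auto simp: add.commute)
    then show ?thesis
      using face_face[OF t that[unfolded r_def]] by (simp add: f_def r_def)
  qed
  have "bd r (bd (Suc r) (tup t)) = (\<Sum>k\<le>Suc r. \<Sum>l\<le>r. f k l)"
    by (simp only: bd_tup bd.sum bd.scale free.scale_sum_right free.scale_scale f_def power_add)
  also have "\<dots> = (\<Sum>(k, l)\<in>{..Suc r} \<times> {..r}. f k l)"
    by (rule sum.cartesian_product)
  also have "{..Suc r} \<times> {..r} = {(k, l). l < k \<and> k \<le> Suc r} \<union> {(k, l). k \<le> l \<and> l \<le> r}"
    by auto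
  also have "(\<Sum>(k, l)\<in>\<dots>. f k l)
      = (\<Sum>(k, l)\<in>{(k, l). l < k \<and> k \<le> Suc r}. f k l) + (\<Sum>(k, l)\<in>{(k, l). k \<le> l \<and> l \<le> r}. f k l)"
  proof (rule sum.union_disjoint)
    show "finite {(k, l). l < k \<and> k \<le> Suc r}" "finite {(k, l). k \<le> l \<and> l \<le> r}"
      by (rule finite_subset[of _ "{..Suc r} \<times> {..Suc r}"]; auto)+
  qed auto
  also have "(\<Sum>(k, l)\<in>{(k, l). l < k \<and> k \<le> Suc r}. f k l)
      = (\<Sum>(k, l)\<in>{(k, l). k \<le> l \<and> l \<le> r}. - f k l)"
    by (rule sum.reindex_bij_witness[of _ "\<lambda>(k, l). (Suc l, k)" "\<lambda>(k, l). (l, k - 1)"])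
      (auto simp: ff)
  finally show ?thesis by (simp add: r_def case_prod_unfold sum_negf)
qed

lemma bd_bd: "c \<in> free_space (Suc (Suc m)) \<Longrightarrow> bd (Suc m) (bd (Suc (Suc m)) c) = 0"
proof -
  assume c: "c \<in> free_space (Suc (Suc m))"
  have "c \<in> {c. bd (Suc m) (bd (Suc (Suc m)) c) = 0}"
    using c
  proof (induction rule: free_space_induct)
    case subspace
    show ?case by (simp add: free.subspace_def bd.add bd.scale bd.zero)
  qed (simp add: bd_bd_tup)
  then show ?thesis by simp
qed

text \<open>Contributions to the coefficient at \<open>i\<close> come from the index words that arise from \<open>i\<close> by
  splitting an entry in two, modulo \<open>n\<close>; a split in which the exponents exceed the entry by \<open>n\<close>
  carries a factor \<open>q = x\<^sup>n\<close>.\<close>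

definition bsplit :: "nat \<Rightarrow> (nat list \<Rightarrow> 'a) \<Rightarrow> nat list \<Rightarrow> 'a" where
  "bsplit r y i =
     (\<Sum>k\<le>r. scale ((- 1) ^ k) (\<Sum>e<n.
        y (take k i @ e # ((i ! k + n - e) mod n) # drop (Suc k) i) * q ^ (if e \<le> i ! k then 0 else 1))) +
     scale ((- 1) ^ Suc r) (\<Sum>e<n.
        (\<alpha> ^^ e) (y (((i ! 0 + n - e) mod n) # tl i @ [e])) * q ^ (if e \<le> i ! 0 then 0 else 1))"

lemma bsplit_add: "bsplit r (\<lambda>j. f j + g j) i = bsplit r f i + bsplit r g i"
  by (simp add: bsplit_def distrib_right sum.distrib scale_right_distrib)

lemma bsplit_scale: "bsplit r (\<lambda>j. scale c (f j)) i = scale c (bsplit r f i)"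
  by (simp add: bsplit_def scale_mult_left scale_sum_right scale_right_distrib mult.commute[of _ c])

lemma split_carry:
  assumes "i < n" "e < n"
  shows "e + (i + n - e) mod n = i + (if e \<le> i then 0 else 1) * n"
proof (cases "e \<le> i")
  case True
  then have "(i + n - e) mod n = (i - e + n) mod n" by simp
  also have "\<dots> = i - e" using assms by simp
  finally show ?thesis using True by simp
qed (use assms in simp)

lemma theta_merge:
  assumes "length is = length us" "length js = length vs" "a \<in> carrier A" "b \<in> carrier A" "e0 < n"
  shows "theta (is @ e0 # js) (us @ (a \<cdot> b) # vs) =
    (\<Sum>e<n. theta (is @ e # ((e0 + n - e) mod n) # js) (us @ a # b # vs) * q ^ (if e \<le> e0 then 0 else 1))"
proof -
  let ?x = "\<lambda>e. if e \<le> e0 then 0 else 1::nat" and ?f = "\<lambda>e. (e0 + n - e) mod n"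
  have "cf (a \<cdot> b) e0 * (\<alpha> ^^ e0) (theta js vs)
     = (\<Sum>e<n. theta (e # ?f e # js) (a # b # vs) * q ^ ?x e)"
    unfolding cf_mult[OF assms(3-5)] sum_distrib_right
  proof (rule sum.cong[OF refl])
    fix e assume "e \<in> {..<n}"
    then have "e + ?f e = e0 + ?x e * n" using split_carry[OF assms(5)] by simp
    then have "q ^ ?x e * (\<alpha> ^^ e0) (theta js vs) = (\<alpha> ^^ (e + ?f e)) (theta js vs) * q ^ ?x e"
      by (simp only: qpow_comm pow_pow add.commute)
    then show "cf a e * (\<alpha> ^^ e) (cf b (?f e)) * q ^ ?x e * (\<alpha> ^^ e0) (theta js vs)
        = theta (e # ?f e # js) (a # b # vs) * q ^ ?x e"
      by (simp only: theta.simps pow_mult pow_pow mult.assoc)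
  qed
  then show ?thesis
    by (simp add: theta_append[OF assms(1)] pow_sum sum_distrib_left mult.assoc)
qed

text \<open>On the last face, the coefficient of the last entry stands in front and not at the end of
  the product. Applying \<open>\<alpha>\<^sup>e\<close> to the coefficient at the split word makes the two products differ by a
  twisted commutator.\<close>

lemma theta_merge_cyclic:
  assumes "length js = length vs" "a \<in> carrier A" "b \<in> carrier A" "e0 < n"
  shows "theta (e0 # js) ((b \<cdot> a) # vs) -
    (\<Sum>e<n. (\<alpha> ^^ e) (theta (((e0 + n - e) mod n) # js @ [e]) (a # vs @ [b]))
       * q ^ (if e \<le> e0 then 0 else 1)) \<in> N (e0 + sum_list js)"
proof -
  let ?x = "\<lambda>e. if e \<le> e0 then 0 else 1::nat" and ?f = "\<lambda>e. (e0 + n - e) mod n"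
  have "cf (b \<cdot> a) e0 * (\<alpha> ^^ e0) (theta js vs)
      = (\<Sum>e<n. cf b e * (\<alpha> ^^ e) (cf a (?f e) * (\<alpha> ^^ ?f e) (theta js vs)) * q ^ ?x e)"
    unfolding cf_mult[OF assms(3,2,4)] sum_distrib_right
  proof (rule sum.cong[OF refl])
    fix e assume "e \<in> {..<n}"
    then have "e + ?f e = e0 + ?x e * n" using split_carry[OF assms(4)] by simp
    then have "q ^ ?x e * (\<alpha> ^^ e0) (theta js vs) = (\<alpha> ^^ (e + ?f e)) (theta js vs) * q ^ ?x e"
      by (simp only: qpow_comm pow_pow add.commute)
    then show "cf b e * (\<alpha> ^^ e) (cf a (?f e)) * q ^ ?x e * (\<alpha> ^^ e0) (theta js vs)
        = cf b e * (\<alpha> ^^ e) (cf a (?f e) * (\<alpha> ^^ ?f e) (theta js vs)) * q ^ ?x e"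
      by (simp only: pow_mult pow_pow mult.assoc)
  qed
  moreover have "(cf b e * (\<alpha> ^^ e) (cf a (?f e) * (\<alpha> ^^ ?f e) (theta js vs)) * q ^ ?x e -
     (\<alpha> ^^ e) (theta (?f e # js @ [e]) (a # vs @ [b])) * q ^ ?x e) \<in> N (e0 + sum_list js)"
    if "e < n" for e
  proof -
    let ?Q = "cf a (?f e) * (\<alpha> ^^ ?f e) (theta js vs)"
    let ?W = "e0 + sum_list js + ?x e * n"
    have W: "e + ?f e + sum_list js = ?W" using split_carry[OF assms(4) that] by simp
    have "theta (?f e # js @ [e]) (a # vs @ [b]) = ?Q * (\<alpha> ^^ (?f e + sum_list js)) (cf b e)"
      by (simp add: theta_append[OF assms(1)] mult.assoc pow_pow)
    then have "(\<alpha> ^^ e) (theta (?f e # js @ [e]) (a # vs @ [b]))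
       = (\<alpha> ^^ e) ?Q * (\<alpha> ^^ ?W) (cf b e)"
      unfolding W[symmetric] by (simp only: pow_mult pow_pow add.assoc)
    moreover have "cf b e * (\<alpha> ^^ e) ?Q - (\<alpha> ^^ e) ?Q * (\<alpha> ^^ ?W) (cf b e) \<in> N ?W"
      using N_neg[OF N_generator[of "(\<alpha> ^^ e) ?Q" ?W "cf b e"]] by (simp only: minus_diff_eq)
    ultimately have "cf b e * (\<alpha> ^^ e) ?Q - (\<alpha> ^^ e) (theta (?f e # js @ [e]) (a # vs @ [b])) \<in> N ?W"
      by simp
    from N_qpow[OF this] show ?thesis by (simp only: left_diff_distrib)
  qed
  ultimately show ?thesis
    by (simp add: sum_subtractf[symmetric]) (intro N_sum, simp)
qed

lemma Theta_bd_tup: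
  assumes t: "t \<in> tuples A (Suc r)" and i: "i \<in> words n (Suc r)"
  shows "Theta i (bd (Suc r) (tup t)) - bsplit r (\<lambda>j. theta j t) i \<in> N (sum_list i)"
proof -
  have lt: "length t = Suc (Suc r)" and st: "set t \<subseteq> carrier A" using t by (auto simp: tuples_def)
  have li: "length i = Suc r" and si: "set i \<subseteq> {..<n}" using i by (auto simp: words_def)
  let ?x = "\<lambda>k e. if e \<le> i ! k then 0 else 1::nat"
  have car: "t ! k \<in> carrier A" if "k \<le> Suc r" for k using t that by (rule tuples_nth)
  have ik: "i ! k < n" if "k \<le> r" for k using subsetD[OF si nth_mem[of k i]] li that by simp
  have inner: "theta i (face (Suc r) k t) = (\<Sum>e<n.
      theta (take k i @ e # ((i ! k + n - e) mod n) # drop (Suc k) i) t * q ^ ?x k e)" if k: "k \<le> r" for k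
  proof -
    have ti: "take k i @ i ! k # drop (Suc k) i = i" using li k by (simp add: id_take_nth_drop[symmetric])
    have tt: "take k t @ t ! k # t ! Suc k # drop (Suc (Suc k)) t = t"
      using lt k by (simp add: Cons_nth_drop_Suc)
    have "theta i (face (Suc r) k t) = theta (take k i @ i ! k # drop (Suc k) i)
        (take k t @ (t ! k \<cdot> t ! Suc k) # drop (Suc (Suc k)) t)"
      using k by (simp only: ti) (simp add: face_def)
    also have "\<dots> = (\<Sum>e<n. theta (take k i @ e # ((i ! k + n - e) mod n) # drop (Suc k) i)
        (take k t @ t ! k # t ! Suc k # drop (Suc (Suc k)) t) * q ^ ?x k e)"
      using k lt li by (intro theta_merge car ik) auto
    finally show ?thesis by (simp only: tt)
  qed
  have cyc: "theta i (face (Suc r) (Suc r) t) - (\<Sum>e<n.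
      (\<alpha> ^^ e) (theta (((i ! 0 + n - e) mod n) # tl i @ [e]) t) * q ^ ?x 0 e) \<in> N (sum_list i)"
  proof -
    obtain e0 js where ij: "i = e0 # js" using li by (cases i) auto
    obtain a u where "t = a # u" using lt by (cases t) auto
    moreover obtain vs b where "u = vs @ [b]" using lt \<open>t = a # u\<close> by (cases u rule: rev_cases) auto
    ultimately have tv: "t = a # vs @ [b]" by simp
    have "face (Suc r) (Suc r) t = (b \<cdot> a) # vs"
      using lt by (simp add: face_def tv nth_append)
    then show ?thesis
      using theta_merge_cyclic[of js vs a b e0] lt li st si by (simp add: ij tv)
  qed
  have "Theta i (bd (Suc r) (tup t)) = (\<Sum>k\<le>Suc r. scale ((- 1) ^ k) (theta i (face (Suc r) k t)))"
    by (simp only: bd_tup Theta.sum Theta.scale Theta_tup)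
  also have "\<dots> = (\<Sum>k\<le>r. scale ((- 1) ^ k) (theta i (face (Suc r) k t)))
      + scale ((- 1) ^ Suc r) (theta i (face (Suc r) (Suc r) t))"
    by (simp only: sum.atMost_Suc)
  also have "(\<Sum>k\<le>r. scale ((- 1) ^ k) (theta i (face (Suc r) k t))) = (\<Sum>k\<le>r. scale ((- 1) ^ k) (\<Sum>e<n.
      theta (take k i @ e # ((i ! k + n - e) mod n) # drop (Suc k) i) t * q ^ ?x k e))"
    by (intro sum.cong refl) (simp add: inner)
  finally have "Theta i (bd (Suc r) (tup t)) - bsplit r (\<lambda>j. theta j t) i
    = scale ((- 1) ^ Suc r) (theta i (face (Suc r) (Suc r) t) - (\<Sum>e<n.
      (\<alpha> ^^ e) (theta (((i ! 0 + n - e) mod n) # tl i @ [e]) t) * q ^ ?x 0 e))"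
    unfolding bsplit_def scale_right_diff_distrib by (simp only: add_diff_add diff_self add_0_left)
  then show ?thesis by (simp only: N_scale[OF cyc])
qed

lemma Theta_bd:
  assumes c: "c \<in> free_space (Suc r)" and i: "i \<in> words n (Suc r)"
  shows "Theta i (bd (Suc r) c) - bsplit r (\<lambda>j. Theta j c) i \<in> N (sum_list i)"
proof -
  have "c \<in> {c. Theta i (bd (Suc r) c) - bsplit r (\<lambda>j. Theta j c) i \<in> N (sum_list i)}"
    using c
  proof (induction rule: free_space_induct)
    case subspace
    have "bsplit r (\<lambda>j. 0) i = 0" by (simp add: bsplit_def)
    moreover have "Theta i (bd (Suc r) (c + d)) - bsplit r (\<lambda>j. Theta j (c + d)) i
       = (Theta i (bd (Suc r) c) - bsplit r (\<lambda>j. Theta j c) i)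
       + (Theta i (bd (Suc r) d) - bsplit r (\<lambda>j. Theta j d) i)" for c d
      by (simp add: bd.add Theta.add bsplit_add)
    moreover have "Theta i (bd (Suc r) (free_scale k c)) - bsplit r (\<lambda>j. Theta j (free_scale k c)) i
       = scale k (Theta i (bd (Suc r) c) - bsplit r (\<lambda>j. Theta j c) i)" for k c
      by (simp add: bd.scale Theta.scale bsplit_scale scale_right_diff_distrib)
    ultimately show ?case
      by (simp add: free.subspace_def bd.zero Theta.zero N_zero N_add N_scale)
  next
    case (tup t)
    then show ?case using Theta_bd_tup[OF _ i] by simp
  qed
  then show ?thesis by simp
qed

definition splits :: "nat \<Rightarrow> nat list \<Rightarrow> nat list set" where
  "splits r i =
     {take k i @ e # ((i ! k + n - e) mod n) # drop (Suc k) i |k e. k \<le> r \<and> e < n} \<union>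
     {((i ! 0 + n - e) mod n) # tl i @ [e] |e. e < n}"

lemma bsplit_N:
  assumes i: "i \<in> words n (Suc r)"
    and y: "\<And>j. j \<in> words n (Suc (Suc r)) \<Longrightarrow> j \<in> splits r i \<Longrightarrow> y j \<in> N (sum_list j)"
  shows "bsplit r y i \<in> N (sum_list i)"
proof -
  have li: "length i = Suc r" and si: "set i \<subseteq> {..<n}" using i by (auto simp: words_def)
  have ik: "i ! k < n" if "k \<le> r" for k using subsetD[OF si nth_mem[of k i]] li that by simp
  have n: "n > 0" using n_ge_2 by simp
  have 1: "y (take k i @ e # ((i ! k + n - e) mod n) # drop (Suc k) i) * q ^ (if e \<le> i ! k then 0 else 1)
      \<in> N (sum_list i)" (is "y ?j * q ^ ?x \<in> _") if k: "k \<le> r" and e: "e < n" for k e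
  proof -
    have ti: "take k i @ i ! k # drop (Suc k) i = i" using li k by (simp add: id_take_nth_drop[symmetric])
    have "sum_list ?j = sum_list (take k i) + (e + (i ! k + n - e) mod n) + sum_list (drop (Suc k) i)"
      by simp
    also have "\<dots> = sum_list (take k i @ i ! k # drop (Suc k) i) + ?x * n"
      using split_carry[OF ik[OF k] e] by simp
    finally have s: "sum_list ?j = sum_list i + ?x * n" by (simp only: ti)
    have "set (take k i) \<subseteq> {..<n}" "set (drop (Suc k) i) \<subseteq> {..<n}"
      using si set_take_subset[of k i] set_drop_subset[of "Suc k" i] by auto
    then have "?j \<in> words n (Suc (Suc r))" using li k e n by (simp add: words_def)
    moreover have "?j \<in> splits r i" unfolding splits_def using k e by blast
    ultimately have "y ?j \<in> N (sum_list ?j)" by (rule y)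
    then show ?thesis unfolding s by (rule N_qpow)
  qed
  have 2: "(\<alpha> ^^ e) (y (((i ! 0 + n - e) mod n) # tl i @ [e])) * q ^ (if e \<le> i ! 0 then 0 else 1)
      \<in> N (sum_list i)" (is "_ (y ?j) * q ^ ?x \<in> _") if e: "e < n" for e
  proof -
    obtain e0 js where ij: "i = e0 # js" using li by (cases i) auto
    have s: "sum_list ?j = sum_list i + ?x * n"
      using split_carry[OF ik[of 0] e] by (simp add: ij)
    have "?j \<in> words n (Suc (Suc r))" using li si e n by (auto simp: words_def ij)
    moreover have "?j \<in> splits r i" unfolding splits_def using e by blast
    ultimately have "y ?j \<in> N (sum_list ?j)" by (rule y)
    from N_pow[OF this] show ?thesis unfolding s by (rule N_qpow)
  qed
  show ?thesis
    unfolding bsplit_def by (intro N_add N_scale N_sum) (use 1 2 in auto)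
qed

lemma Theta_bd_N:
  assumes c: "c \<in> free_space (Suc r)"
    and "\<And>j. j \<in> words n (Suc (Suc r)) \<Longrightarrow> Theta j c \<in> N (sum_list j)"
  shows "bd (Suc r) c \<in> R r"
proof (rule R_if_Theta)
  fix i assume "i \<in> cells r"
  then have i: "i \<in> words n (Suc r)" by (simp add: cells_def)
  show "Theta i (bd (Suc r) c) \<in> N (sum_list i)"
    using N_add[OF Theta_bd[OF c i] bsplit_N[OF i assms(2)]] by simp
qed (use c bd_free in blast)

text \<open>If an entry comes from \<open>K\<close>, the two faces that merge it with its neighbours agree by the balancing
  or the cyclic relation and have opposite signs. On all other faces the entry survives.\<close>

lemma bd_degenerate:
  assumes t: "t \<in> tuples A (Suc r)" and j: "1 \<le> j" "j \<le> Suc r" and tj: "t ! j \<in> range \<iota>"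
  shows "bd (Suc r) (tup t) \<in> R r"
proof -
  have lt: "length t = Suc (Suc r)" using t by (simp add: tuples_def)
  obtain y where y: "t ! j = \<iota> y" using tj by blast
  obtain j' where j': "j = Suc j'" using j by (cases j) auto
  have car: "t ! k \<in> carrier A" if "k \<le> Suc r" for k using t that by (rule tuples_nth)
  have other: "tup (face (Suc r) k t) \<in> R r" if k: "k \<le> Suc r" "k \<noteq> j" "k \<noteq> j'" for k
  proof (cases "k = Suc r \<or> j < k")
    case True
    then show ?thesis
      using k j y j' face_nth[OF lt k(1), of j] t
      by (intro tup_degenerate[of _ r j] face_tuples) auto
  next
    case False
    then show ?thesis
      using k j y j' face_nth[OF lt k(1), of j'] t
      by (intro tup_degenerate[of _ r j'] face_tuples) auto
  qed
  have pair: "chain_cong r (tup (face (Suc r) j' t)) (tup (face (Suc r) j t))"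
  proof (cases "j = Suc r")
    case True
    define s where "s = butlast t"
    have s: "s \<in> tuples A r"
      using t by (auto simp: tuples_def s_def dest: in_set_butlastD)
    have ts: "t = s @ [\<iota> y]"
      using lt y True by (simp add: s_def) (metis append_butlast_last_id diff_Suc_1 last_conv_nth length_0_conv nat.distinct(1))
    have ls: "length s = Suc r" using s by (simp add: tuples_def)
    have "face (Suc r) j' t = s[r := s ! r \<cdot> \<iota> y]"
      using ls True j' lt by (intro nth_equalityI) (auto simp: face_nth ts nth_append nth_list_update)
    moreover have "face (Suc r) j t = s[0 := \<iota> y \<cdot> s ! 0]"
      using ls True j' lt by (intro nth_equalityI) (auto simp: face_nth ts nth_append nth_list_update)
    ultimately show ?thesis using tup_cyclic[OF s] by simp
  next
    case False
    let ?us = "take j' t" and ?vs = "drop (Suc (Suc j)) t"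
    have car': "set ?us \<subseteq> carrier A" "set ?vs \<subseteq> carrier A"
      using t set_take_subset[of j' t] set_drop_subset[of "Suc (Suc j)" t] by (auto simp: tuples_def)
    have "face (Suc r) j' t = ?us @ (t ! j' \<cdot> \<iota> y) # t ! Suc j # ?vs"
      using False j j' lt y by (simp add: face_def Cons_nth_drop_Suc)
    moreover have "face (Suc r) j t = ?us @ t ! j' # (\<iota> y \<cdot> t ! Suc j) # ?vs"
      using False j j' lt y by (simp add: face_def take_Suc_conv_app_nth)
    moreover have "chain_cong r (tup (?us @ (t ! j' \<cdot> \<iota> y) # t ! Suc j # ?vs))
        (tup (?us @ t ! j' # (\<iota> y \<cdot> t ! Suc j) # ?vs))"
      using False j j' lt by (intro tup_balance car' car) auto
    ultimately show ?thesis by simp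
  qed
  let ?f = "\<lambda>k. free_scale ((- 1) ^ k) (tup (face (Suc r) k t) :: _ \<Rightarrow>\<^sub>0 'k)"
  have "bd (Suc r) (tup t) = (\<Sum>k\<in>{..Suc r} - {j, j'}. ?f k) + (\<Sum>k\<in>{j, j'}. ?f k)"
    unfolding bd_tup using j j' by (intro sum.subset_diff) auto
  also have "(\<Sum>k\<in>{j, j'}. ?f k)
      = free_scale ((- 1) ^ j') (tup (face (Suc r) j' t) - tup (face (Suc r) j t))"
    by (simp add: j' free.scale_right_diff_distrib)
  finally show ?thesis
    using pair other unfolding chain_cong_def by (auto intro!: R_add R_sum R_scale)
qed

lemma bd_R: "c \<in> R (Suc r) \<Longrightarrow> bd (Suc r) c \<in> R r"
proof -
  assume c: "c \<in> R (Suc r)"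
  have "c \<in> {c. bd (Suc r) c \<in> R r}"
    using c
  proof (induction rule: R_induct)
    case subspace
    show ?case by (simp add: free.subspace_def bd.add bd.scale bd.zero R_zero R_add R_scale)
  next
    case (balanced c)
    then show ?case using Theta_bd_N by simp
  next
    case (degenerate t j)
    then show ?case using bd_degenerate by simp
  qed
  then show ?thesis by simp
qed

end

section \<open>A matching on index words\<close>

text \<open>Words that start with pairs \<open>1, n - 1\<close> followed by an exponent \<open>c \<ge> 2\<close> are called redundant, those
  in which the pairs are followed by \<open>1, j\<close> with \<open>j < n - 1\<close> collapsible. Replacing \<open>c\<close> by
  \<open>1, c - 1\<close> is a bijection from redundant to collapsible words that are longer by one; the
  terminology is that of Brown's collapsing schemes. Words of neither kind are critical.\<close>

fun redundant :: "nat \<Rightarrow> nat list \<Rightarrow> bool" where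
  "redundant n [] = False"
| "redundant n [i] = (i \<ge> 2)"
| "redundant n (i # j # u) = (i \<ge> 2 \<or> i = 1 \<and> j = n - 1 \<and> redundant n u)"

fun collapsible :: "nat \<Rightarrow> nat list \<Rightarrow> bool" where
  "collapsible n (i # j # u) = (i = 1 \<and> (j < n - 1 \<or> j = n - 1 \<and> collapsible n u))"
| "collapsible n _ = False"

fun expand :: "nat list \<Rightarrow> nat list" where
  "expand [] = []"
| "expand [i] = [1, i - 1]"
| "expand (i # j # u) = (if i \<ge> 2 then 1 # (i - 1) # j # u else i # j # expand u)"

fun collapse :: "nat \<Rightarrow> nat list \<Rightarrow> nat list" where
  "collapse n (i # j # u) = (if j < n - 1 then Suc j # u else i # j # collapse n u)"
| "collapse n u = u"

fun critical :: "nat \<Rightarrow> nat \<Rightarrow> nat list" where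
  "critical n 0 = []"
| "critical n (Suc 0) = [1]"
| "critical n (Suc (Suc r)) = 1 # (n - 1) # critical n r"

fun expand_pos :: "nat list \<Rightarrow> nat" where
  "expand_pos (i # j # u) = (if i \<ge> 2 then 0 else Suc (Suc (expand_pos u)))"
| "expand_pos u = 0"

lemma expand_props:
  assumes "redundant n u" "set u \<subseteq> {1..<n}"
  shows "collapsible n (expand u)" "collapse n (expand u) = u" "length (expand u) = Suc (length u)"
    "sum_list (expand u) = sum_list u" "set (expand u) \<subseteq> {1..<n}" "even (expand_pos u)"
    "expand_pos u < length u" "u ! expand_pos u \<ge> 2"
    "expand u = take (expand_pos u) u @ 1 # (u ! expand_pos u - 1) # drop (Suc (expand_pos u)) u"
proof -
  have "collapsible n (expand u) \<and> collapse n (expand u) = u \<and> length (expand u) = Suc (length u) \<and>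
    sum_list (expand u) = sum_list u \<and> set (expand u) \<subseteq> {1..<n} \<and> even (expand_pos u) \<and>
    expand_pos u < length u \<and> u ! expand_pos u \<ge> 2 \<and>
    expand u = take (expand_pos u) u @ 1 # (u ! expand_pos u - 1) # drop (Suc (expand_pos u)) u"
    using assms by (induction u rule: expand.induct) auto
  then show "collapsible n (expand u)" "collapse n (expand u) = u" "length (expand u) = Suc (length u)"
    "sum_list (expand u) = sum_list u" "set (expand u) \<subseteq> {1..<n}" "even (expand_pos u)"
    "expand_pos u < length u" "u ! expand_pos u \<ge> 2"
    "expand u = take (expand_pos u) u @ 1 # (u ! expand_pos u - 1) # drop (Suc (expand_pos u)) u"
    by blast+
qed

lemma collapse_props:
  assumes "collapsible n w" "set w \<subseteq> {1..<n}"
  shows "redundant n (collapse n w)" "expand (collapse n w) = w" "Suc (length (collapse n w)) = length w"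
    "sum_list (collapse n w) = sum_list w" "set (collapse n w) \<subseteq> {1..<n}"
proof -
  have "redundant n (collapse n w) \<and> expand (collapse n w) = w \<and> Suc (length (collapse n w)) = length w \<and>
    sum_list (collapse n w) = sum_list w \<and> set (collapse n w) \<subseteq> {1..<n}"
    using assms
  proof (induction w rule: collapse.induct)
    case (1 n i j u)
    then show ?case
      by (cases "j < n - 1"; cases u) auto
  qed auto
  then show "redundant n (collapse n w)" "expand (collapse n w) = w" "Suc (length (collapse n w)) = length w"
    "sum_list (collapse n w) = sum_list w" "set (collapse n w) \<subseteq> {1..<n}"
    by blast+
qed

lemma critical_cases:
  "set u \<subseteq> {1..<n} \<Longrightarrow> \<not> redundant n u \<Longrightarrow> \<not> collapsible n u \<Longrightarrow> u = critical n (length u)"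
proof (induction n u rule: redundant.induct)
  case (3 n i j u)
  then have "i = 1" "j = n - 1" by auto
  then show ?case using 3 by simp
qed auto

lemma length_critical [simp]: "length (critical n r) = r"
  by (induction n r rule: critical.induct) auto

lemma set_critical: "n \<ge> 2 \<Longrightarrow> set (critical n r) \<subseteq> {1..<n}"
  by (induction n r rule: critical.induct) auto

abbreviation horner :: "nat \<Rightarrow> nat \<Rightarrow> nat list \<Rightarrow> nat" where
  "horner n \<equiv> foldl (\<lambda>a i. a * n + i)"

text \<open>Comparing ranks of words of equal length with exponents below \<open>n\<close> amounts to comparing the sums
  first and the words lexicographically second: the sum and the word are read as the
  digits of a number in base \<open>n\<close>, with a leading digit that may exceed \<open>n\<close>.\<close>

definition rank :: "nat \<Rightarrow> nat list \<Rightarrow> nat" where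
  "rank n u = horner n (sum_list u) u"

lemma horner_less:
  assumes "length u = length v" "set u \<subseteq> {..<n}" "a < b"
  shows "horner n a u < horner n b v"
  using assms
proof (induction u v arbitrary: a b rule: list_induct2)
  case (Cons x xs y ys)
  have "a * n + x < Suc a * n" using Cons.prems by simp
  also have "\<dots> \<le> b * n" using Cons.prems by (intro mult_le_mono1) simp
  finally have "a * n + x < b * n + y" by simp
  then show ?case using Cons by simp
qed simp

lemma rank_less:
  "length u = length v \<Longrightarrow> set u \<subseteq> {1..<n} \<Longrightarrow> sum_list u < sum_list v \<Longrightarrow> rank n u < rank n v"
  unfolding rank_def by (rule horner_less) auto

text \<open>A split to the right of the distinguished exponent, or one of that exponent with \<open>e \<ge> 2\<close>, leaves a
  redundant word. A split inside the initial pairs must break an exponent \<open>n - 1\<close>; collapsing the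
  result puts an exponent above \<open>1\<close> where \<open>u\<close> has \<open>1\<close>.\<close>

lemma split_horner:
  assumes "redundant n u" "set u \<subseteq> {1..<n}" "u = us @ c # vs" "e + e' = c" "1 \<le> e" "1 \<le> e'"
    and "collapsible n (us @ e # e' # vs)"
  shows "length us = expand_pos u \<and> e = 1 \<or> horner n a u < horner n a (collapse n (us @ e # e' # vs))"
  using assms
proof (induction n u arbitrary: us a rule: redundant.induct)
  case (1 n)
  then show ?case by simp
next
  case (2 n i)
  then have "us = []" "vs = []" by (auto simp: Cons_eq_append_conv)
  with 2 show ?case by simp
next
  case (3 n i j u)
  show ?case
  proof (cases "i \<ge> 2")
    case True
    show ?thesis
    proof (cases us)
      case Nil
      then show ?thesis using "3.prems" True by auto
    next
      case (Cons i' us')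
      then have "i' = i" using "3.prems" by simp
      then show ?thesis using "3.prems" True Cons by (cases us') auto
    qed
  next
    case False
    then have ij: "i = 1" "j = n - 1" "redundant n u" using "3.prems"(1) by auto
    show ?thesis
    proof (cases us)
      case Nil
      then show ?thesis using "3.prems" ij by auto
    next
      case (Cons i' us')
      note us = this
      show ?thesis
      proof (cases us')
        case Nil
        then have v: "vs = u" "c = n - 1" "us = [1]" using "3.prems" ij us by auto
        have "horner n (a * n + 1) ((n - 1) # u) < horner n (a * n + Suc e) (e' # u)"
          using "3.prems" v by (intro horner_less) auto
        moreover have "collapse n (us @ e # e' # vs) = Suc e # e' # u"
          using "3.prems" v by simp
        ultimately show ?thesis using ij by simp
      next
        case (Cons j' us'')
        have "u = us'' @ c # vs" "i' = i" "j' = j" using "3.prems" us Cons by auto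
        then show ?thesis
          using "3.IH"[of us'' "(a * n + 1) * n + (n - 1)"] "3.prems" ij us Cons False by simp
      qed
    qed
  qed
qed

section \<open>Triangularity of the boundary with respect to the matching\<close>

context monogenic
begin

lemma cells_Cons_iff: "e # w \<in> cells r \<longleftrightarrow> e < n \<and> length w = r \<and> set w \<subseteq> {1..<n}"
proof -
  have "set w \<subseteq> {1..<n} \<longleftrightarrow> set w \<subseteq> {..<n} \<and> 0 \<notin> set w"
    by (auto simp: subset_iff Suc_le_eq intro: gr0I)
  then show ?thesis by (auto simp: cells_def words_def)
qed

lemma cells_cases:
  assumes "i \<in> cells r"
  obtains e w where "i = e # w" "e < n" "length w = r" "set w \<subseteq> {1..<n}"
  using assms cells_Cons_iff by (cases i) (auto simp: cells_def words_def)

lemma cells_words: "i \<in> cells r \<Longrightarrow> i \<in> words n (Suc r)"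
  by (simp add: cells_def)

text \<open>A split of the first exponent lengthens the word \<open>u\<close> itself by a positive entry, and a
  split that exceeds the exponent by \<open>n\<close> raises the sum by \<open>n\<close>. Both increase the sum and hence the
  rank, which leaves the case of \<open>split_horner\<close>.\<close>

lemma inner_split_rank:
  assumes u: "redundant n u" "set u \<subseteq> {1..<n}" "length u = r" and e0: "e0 < n"
    and k: "k \<le> r" and e: "e < n"
    and j: "j = take k (e0 # u) @ e # (((e0 # u) ! k + n - e) mod n) # drop (Suc k) (e0 # u)"
    and cell: "j \<in> cells (Suc r)" and col: "collapsible n (tl j)"
  shows "k = Suc (expand_pos u) \<and> e = 1 \<or> rank n u < rank n (collapse n (tl j))"
proof -
  obtain e1 w where ew: "j = e1 # w" "length w = Suc r" "set w \<subseteq> {1..<n}"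
    using cell by (rule cells_cases)
  have c: "length (collapse n w) = r" "sum_list (collapse n w) = sum_list w"
    using collapse_props[of n w] col ew by auto
  have bigger: ?thesis if "sum_list u < sum_list w"
    using rank_less[of u "collapse n w" n] c u that ew by simp
  show ?thesis
  proof (cases k)
    case 0
    then have w: "w = ((e0 + n - e) mod n) # u" using j ew by simp
    then have "1 \<le> (e0 + n - e) mod n" using ew by simp
    then show ?thesis using bigger w by simp
  next
    case (Suc k')
    define e' where "e' = (u ! k' + n - e) mod n"
    have k': "k' < r" using k Suc by simp
    have w: "w = take k' u @ e # e' # drop (Suc k') u" using j ew Suc by (simp add: e'_def)
    have ukk: "take k' u @ u ! k' # drop (Suc k') u = u" using k' u by (simp add: id_take_nth_drop[symmetric])
    have un: "u ! k' < n" using subsetD[OF u(2) nth_mem[of k' u]] u k' by simp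
    have ee: "e + e' = u ! k' + (if e \<le> u ! k' then 0 else 1) * n"
      unfolding e'_def by (rule split_carry[OF un e])
    have pos: "1 \<le> e" "1 \<le> e'" using w ew by auto
    show ?thesis
    proof (cases "e \<le> u ! k'")
      case True
      then have "e + e' = u ! k'" using ee by simp
      then have "length (take k' u) = expand_pos u \<and> e = 1 \<or>
          horner n (sum_list u) u < horner n (sum_list u) (collapse n (take k' u @ e # e' # drop (Suc k') u))"
        using col ew(1) w pos ukk by (intro split_horner[OF u(1,2)]) auto
      moreover have "sum_list w = sum_list u"
      proof -
        have "sum_list w = sum_list (take k' u @ u ! k' # drop (Suc k') u)"
          using \<open>e + e' = u ! k'\<close> by (simp add: w)
        then show ?thesis by (simp only: ukk)
      qed
      ultimately show ?thesis
        using k' u Suc c ew(1) by (auto simp: rank_def w[symmetric])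
    next
      case False
      have "sum_list w = sum_list (take k' u @ u ! k' # drop (Suc k') u) + n"
        using ee False by (simp add: w)
      then have "sum_list w = sum_list u + n" by (simp only: ukk)
      then show ?thesis using bigger n_ge_2 by simp
    qed
  qed
qed

lemma cyclic_split_rank:
  assumes u: "redundant n u" "set u \<subseteq> {1..<n}" "length u = r"
    and j: "j = e1 # u @ [e]" and cell: "j \<in> cells (Suc r)" and col: "collapsible n (tl j)"
  shows "rank n u < rank n (collapse n (tl j))"
proof -
  have w: "set (u @ [e]) \<subseteq> {1..<n}" using cell j by (simp add: cells_Cons_iff)
  have "length (collapse n (u @ [e])) = r" "sum_list (collapse n (u @ [e])) = sum_list (u @ [e])"
    using collapse_props[of n "u @ [e]"] col j w u by auto
  then show ?thesis
    using rank_less[of u "collapse n (u @ [e])" n] u w j by simp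
qed

text \<open>The matched word arises from \<open>u\<close> by exactly one split. Its position is odd, because the
  pairs before it have even length and the word is preceded by the exponent \<open>e0\<close>.\<close>

lemma bsplit_single:
  assumes u: "redundant n u" "set u \<subseteq> {1..<n}" "length u = r" and e0: "e0 < n"
  shows "bsplit r (\<lambda>j. if j = e0 # expand u then v else 0) (e0 # u) = - v"
proof -
  let ?J = "e0 # expand u"
  note ex = expand_props[OF u(1,2)]
  have cell: "?J \<in> cells (Suc r)" using ex u e0 by (simp add: cells_Cons_iff)
  have p: "expand_pos u < r" and up: "u ! expand_pos u < n"
    using ex(7) u(3) subsetD[OF u(2) nth_mem[of "expand_pos u" u]] by simp_all
  let ?j = "\<lambda>k e. take k (e0 # u) @ e # (((e0 # u) ! k + n - e) mod n) # drop (Suc k) (e0 # u)"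
  have inner: "?j k e = ?J \<longleftrightarrow> k = Suc (expand_pos u) \<and> e = 1" if k: "k \<le> r" and e: "e < n" for k e
  proof
    assume j: "?j k e = ?J"
    then show "k = Suc (expand_pos u) \<and> e = 1"
      using inner_split_rank[OF u e0 k e j[symmetric] cell] ex by simp
  next
    assume ke: "k = Suc (expand_pos u) \<and> e = 1"
    have "(u ! expand_pos u + n - 1) mod n = (u ! expand_pos u - 1 + n) mod n"
      using ex(8) by simp
    also have "\<dots> = u ! expand_pos u - 1" using up by simp
    finally show "?j k e = ?J" using ke ex(9) by simp
  qed
  have cyc: "((e0 # u) ! 0 + n - e) mod n # tl (e0 # u) @ [e] \<noteq> ?J" for e
  proof
    assume j: "((e0 # u) ! 0 + n - e) mod n # tl (e0 # u) @ [e] = ?J"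
    then show False
      using cyclic_split_rank[OF u, of ?J "(e0 + n - e) mod n" e] cell ex by simp
  qed
  have "bsplit r (\<lambda>j. if j = ?J then v else 0) (e0 # u)
     = (\<Sum>k\<le>r. scale ((- 1) ^ k) (\<Sum>e<n. (if k = Suc (expand_pos u) \<and> e = 1 then v else 0)
          * q ^ (if e \<le> (e0 # u) ! k then 0 else 1)))"
  proof -
    have cyc0: "(\<Sum>e<n. (\<alpha> ^^ e) (if ((e0 # u) ! 0 + n - e) mod n # tl (e0 # u) @ [e] = ?J then v else 0)
        * q ^ (if e \<le> (e0 # u) ! 0 then 0 else 1)) = 0"
      by (intro sum.neutral ballI) (simp only: cyc if_False pow_zero mult_zero_left)
    have inner': "(\<Sum>e<n. (if ?j k e = ?J then v else 0) * q ^ (if e \<le> (e0 # u) ! k then 0 else 1))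
        = (\<Sum>e<n. (if k = Suc (expand_pos u) \<and> e = 1 then v else 0)
          * q ^ (if e \<le> (e0 # u) ! k then 0 else 1))" if "k \<le> r" for k
      by (intro sum.cong refl) (simp only: inner[OF that] lessThan_iff)
    show ?thesis
      unfolding bsplit_def cyc0 scale_zero_right add_0_right
      by (intro sum.cong refl) (simp only: inner' atMost_iff)
  qed
  also have "\<dots> = (\<Sum>k\<le>r. if k = Suc (expand_pos u) then - v else 0)"
  proof (intro sum.cong refl)
    fix k
    show "scale ((- 1) ^ k) (\<Sum>e<n. (if k = Suc (expand_pos u) \<and> e = 1 then v else 0)
          * q ^ (if e \<le> (e0 # u) ! k then 0 else 1)) = (if k = Suc (expand_pos u) then - v else 0)"
    proof (cases "k = Suc (expand_pos u)")
      case True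
      have "(\<Sum>e<n. (if k = Suc (expand_pos u) \<and> e = 1 then v else 0)
          * q ^ (if e \<le> (e0 # u) ! k then 0 else 1)) = (\<Sum>e<n. if e = 1 then v else 0)"
        using True ex(8) by (intro sum.cong) auto
      also have "\<dots> = v" using n_ge_2 by simp
      finally show ?thesis using True ex(6) by simp
    qed simp
  qed
  also have "\<dots> = - v" using p by simp
  finally show ?thesis .
qed

text \<open>Every split of a redundant word \<open>u\<close> other than the matched word is not collapsible or collapses to
  a word of higher rank. So the boundary from collapsible to redundant words is triangular.\<close>

lemma bsplit_triangular:
  assumes u: "redundant n u" "set u \<subseteq> {1..<n}" "length u = r" and e0: "e0 < n"
    and y0: "\<And>j. j \<in> words n (Suc (Suc r)) \<Longrightarrow> j \<notin> cells (Suc r) \<or> \<not> collapsible n (tl j) \<Longrightarrow>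
      y j \<in> N (sum_list j)"
    and y1: "\<And>j. j \<in> cells (Suc r) \<Longrightarrow> collapsible n (tl j) \<Longrightarrow>
      rank n u < rank n (collapse n (tl j)) \<Longrightarrow> y j \<in> N (sum_list j)"
  shows "bsplit r y (e0 # u) + y (e0 # expand u) \<in> N (e0 + sum_list u)"
proof -
  let ?J = "e0 # expand u"
  note ex = expand_props[OF u(1,2)]
  \<comment> \<open>Separate the coefficient at the matched word; all other splits have twisted commutators as coefficients.\<close>
  let ?d = "\<lambda>j. if j = ?J then y ?J else 0" and ?y = "\<lambda>j. if j = ?J then 0 else y j"
  have "y = (\<lambda>j. ?d j + ?y j)" by auto
  then have "bsplit r y (e0 # u) = bsplit r (\<lambda>j. ?d j + ?y j) (e0 # u)" by simp
  also have "\<dots> = - y ?J + bsplit r ?y (e0 # u)"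
    unfolding bsplit_add bsplit_single[OF u e0] ..
  finally have "bsplit r y (e0 # u) + y ?J = bsplit r ?y (e0 # u)" by simp
  moreover have "bsplit r ?y (e0 # u) \<in> N (sum_list (e0 # u))"
  proof (rule bsplit_N)
    have "set u \<subseteq> {..<n}" using u by auto
    then show "e0 # u \<in> words n (Suc r)" using u e0 by (simp add: words_def)
    fix j assume j: "j \<in> words n (Suc (Suc r))" "j \<in> splits r (e0 # u)"
    show "?y j \<in> N (sum_list j)"
    proof (cases "j = ?J \<or> j \<notin> cells (Suc r) \<or> \<not> collapsible n (tl j)")
      case True
      then show ?thesis using y0 j N_zero by auto
    next
      case False
      then have jc: "j \<in> cells (Suc r)" "collapsible n (tl j)" "j \<noteq> ?J" by auto
      have "rank n u < rank n (collapse n (tl j))"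
        using j(2) unfolding splits_def
      proof (elim UnE CollectE exE conjE)
        fix k e assume ke: "k \<le> r" "e < n"
          "j = take k (e0 # u) @ e # (((e0 # u) ! k + n - e) mod n) # drop (Suc k) (e0 # u)"
        have "j = ?J" if "k = Suc (expand_pos u)" "e = 1"
        proof -
          have up: "u ! expand_pos u < n" using ex(7) u(3) subsetD[OF u(2) nth_mem[of "expand_pos u" u]] by simp_all
          have "(u ! expand_pos u + n - 1) mod n = (u ! expand_pos u - 1 + n) mod n"
            using ex(8) by simp
          also have "\<dots> = u ! expand_pos u - 1" using up by simp
          finally show ?thesis using ke that ex(9) by simp
        qed
        then show ?thesis using inner_split_rank[OF u e0 ke jc(1,2)] jc(3) by blast
      next
        fix e assume "e < n" "j = ((e0 # u) ! 0 + n - e) mod n # tl (e0 # u) @ [e]"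
        then show ?thesis using cyclic_split_rank[OF u _ jc(1,2)] by simp
      qed
      then show ?thesis using y1 jc by simp
    qed
  qed
  ultimately show ?thesis by simp
qed

lemma Theta_sum_Word:
  assumes "j \<in> words n (Suc r)"
  shows "Theta j (\<Sum>i\<in>cells r. Word (f i) i) = (if j \<in> cells r then f j else 0)"
proof -
  obtain e w where j: "j = e # w" "e < n" "length w = r" "set w \<subseteq> {..<n}"
    using assms by (cases j) (auto simp: words_def)
  have "Theta j (\<Sum>i\<in>cells r. Word (f i) i) = (\<Sum>i\<in>cells r. if i = j then f i else 0)"
    unfolding Theta.sum
  proof (rule sum.cong[OF refl])
    fix i assume "i \<in> cells r"
    then obtain e' w' where i: "i = e' # w'" "e' < n" "length w' = r" "set w' \<subseteq> {1..<n}"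
      by (rule cells_cases)
    then have "set w' \<subseteq> {..<n}" by auto
    then show "Theta j (Word (f i) i) = (if i = j then f i else 0)"
      using Theta_word[of w w' e "f i" e'] i j by (auto simp: Word_def)
  qed
  then show ?thesis by simp
qed

lemma sum_Word_free: "(\<Sum>i\<in>cells r. Word (f i) i) \<in> free_space r"
  by (intro free.subspace_sum[OF free_space_subspace])
    (auto simp: Word_def cells_def words_def simp del: mem_Collect_eq intro!: word_free)

lemma rank_bounded: "\<exists>B. \<forall>i\<in>cells r. rank n (tl i) \<le> B"
  using finite_nat_set_iff_bounded_le[of "(\<lambda>i. rank n (tl i)) ` cells r"] by auto

text \<open>The triangular system for the coefficients at collapsible words is solved from the highest
  rank downwards: correcting the coefficients that belong to one rank does not disturb higher ranks.\<close>

lemma eliminate_redundant: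
  assumes c: "c \<in> free_space r"
  shows "\<exists>c'\<in>free_space (Suc r). \<forall>i\<in>cells r. redundant n (tl i) \<longrightarrow>
    Theta i (bd (Suc r) c' - c) \<in> N (sum_list i)"
proof -
  obtain B where B: "\<And>i. i \<in> cells r \<Longrightarrow> rank n (tl i) \<le> B" using rank_bounded by blast
  have "\<exists>c'\<in>free_space (Suc r). \<forall>i\<in>cells r. redundant n (tl i) \<longrightarrow> B < rank n (tl i) + m \<longrightarrow>
    Theta i (bd (Suc r) c' - c) \<in> N (sum_list i)" for m
  proof (induction m)
    case 0
    show ?case
    proof (intro bexI[of _ 0] ballI impI)
      fix i assume "i \<in> cells r" "B < rank n (tl i) + 0"
      then show "Theta i (bd (Suc r) 0 - c) \<in> N (sum_list i)" using B[of i] by simp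
    qed simp
  next
    case (Suc m)
    then obtain c' where c': "c' \<in> free_space (Suc r)"
      "\<And>i. i \<in> cells r \<Longrightarrow> redundant n (tl i) \<Longrightarrow> B < rank n (tl i) + m \<Longrightarrow>
        Theta i (bd (Suc r) c' - c) \<in> N (sum_list i)" by blast
    \<comment> \<open>The diagonal entries are \<open>- 1\<close>, so the error at a redundant word is itself the correction.\<close>
    define g where "g j = (if collapsible n (tl j) \<and> rank n (collapse n (tl j)) + m = B
      then Theta (hd j # collapse n (tl j)) (bd (Suc r) c' - c) else 0)" for j
    define d where "d = (\<Sum>j\<in>cells (Suc r). Word (g j) j)"
    have d: "d \<in> free_space (Suc r)" unfolding d_def by (rule sum_Word_free)
    have Thd: "Theta j d = (if j \<in> cells (Suc r) then g j else 0)" if "j \<in> words n (Suc (Suc r))" for j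
      unfolding d_def by (rule Theta_sum_Word[OF that])
    show ?case
    proof (intro bexI[of _ "c' + d"] ballI impI)
      show "c' + d \<in> free_space (Suc r)" by (rule free.subspace_add[OF free_space_subspace c'(1) d])
      fix i assume i: "i \<in> cells r" and red: "redundant n (tl i)" and rk: "B < rank n (tl i) + Suc m"
      obtain e u where eu: "i = e # u" "e < n" "length u = r" "set u \<subseteq> {1..<n}"
        using i by (rule cells_cases)
      have ru: "redundant n u" using red eu by simp
      note ex = expand_props[OF ru eu(4)]
      have J: "e # expand u \<in> cells (Suc r)" using ex eu by (simp add: cells_Cons_iff)
      have "bsplit r (\<lambda>j. Theta j d) (e # u) + Theta (e # expand u) d \<in> N (e + sum_list u)"
      proof (rule bsplit_triangular[OF ru eu(4,3,2)])
        fix j assume "j \<in> words n (Suc (Suc r))" "j \<notin> cells (Suc r) \<or> \<not> collapsible n (tl j)"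
        then show "Theta j d \<in> N (sum_list j)" by (auto simp: Thd g_def N_zero)
      next
        fix j assume "j \<in> cells (Suc r)" "collapsible n (tl j)" "rank n u < rank n (collapse n (tl j))"
        then show "Theta j d \<in> N (sum_list j)"
          using rk eu by (auto simp: Thd[OF cells_words] g_def N_zero)
      qed
      moreover have "Theta i (bd (Suc r) d) - bsplit r (\<lambda>j. Theta j d) i \<in> N (sum_list i)"
        by (rule Theta_bd[OF d cells_words[OF i]])
      ultimately have 1: "Theta i (bd (Suc r) d) + Theta (e # expand u) d \<in> N (sum_list i)"
        using N_add[of "Theta i (bd (Suc r) d) - bsplit r (\<lambda>j. Theta j d) i" "sum_list i"
            "bsplit r (\<lambda>j. Theta j d) i + Theta (e # expand u) d"] eu by simp
      have 2: "Theta (e # expand u) d = (if rank n u + m = B then Theta i (bd (Suc r) c' - c) else 0)"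
        using ex(1,2) eu J by (simp add: Thd[OF cells_words[OF J]] g_def)
      have "Theta i (bd (Suc r) (c' + d) - c)
          = (Theta i (bd (Suc r) d) + Theta (e # expand u) d)
          + (Theta i (bd (Suc r) c' - c) - Theta (e # expand u) d)"
        by (simp add: bd.add Theta.add Theta.diff)
      moreover have "Theta i (bd (Suc r) c' - c) - Theta (e # expand u) d \<in> N (sum_list i)"
        using c'(2)[OF i red] rk eu by (auto simp: 2 N_zero)
      ultimately show "Theta i (bd (Suc r) (c' + d) - c) \<in> N (sum_list i)"
        using N_add[OF 1] by (simp only:)
    qed
  qed
  from this[of "Suc B"] show ?thesis by auto
qed

text \<open>The same triangular system has only the trivial solution: if all other coefficients vanish,
  the boundary forces the coefficients at collapsible words to vanish, again from the highest
  rank downwards.\<close>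

lemma noncollapsible_determine:
  assumes c: "c \<in> free_space (Suc r)"
    and nc: "\<And>j. j \<in> cells (Suc r) \<Longrightarrow> \<not> collapsible n (tl j) \<Longrightarrow> Theta j c \<in> N (sum_list j)"
    and bdc: "\<And>i. i \<in> cells r \<Longrightarrow> redundant n (tl i) \<Longrightarrow> Theta i (bd (Suc r) c) \<in> N (sum_list i)"
  shows "c \<in> R (Suc r)"
proof -
  \<comment> \<open>The normal form \<open>c0\<close> of \<open>c\<close> has no coefficients at words outside the cells, which \<open>c\<close> may have.\<close>
  define c0 where "c0 = (\<Sum>j\<in>cells (Suc r). Word (Theta j c) j)"
  have c0: "c0 \<in> free_space (Suc r)" unfolding c0_def by (rule sum_Word_free)
  have Th0: "Theta j c0 = (if j \<in> cells (Suc r) then Theta j c else 0)" if "j \<in> words n (Suc (Suc r))" for j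
    unfolding c0_def by (rule Theta_sum_Word[OF that])
  have "c - c0 \<in> R (Suc r)"
    using chain_normal_form[OF c] by (simp add: chain_cong_def c0_def)
  from bd_R[OF this] have diff: "bd (Suc r) c - bd (Suc r) c0 \<in> R r" by (simp add: bd.diff)
  have bd0: "Theta i (bd (Suc r) c0) \<in> N (sum_list i)" if "i \<in> cells r" "redundant n (tl i)" for i
    using N_diff[OF bdc[OF that] Theta_R[OF diff that(1)]] by (simp add: Theta.diff)
  obtain B where B: "\<And>i. i \<in> cells r \<Longrightarrow> rank n (tl i) \<le> B" using rank_bounded by blast
  have all: "Theta j c \<in> N (sum_list j)" if "j \<in> cells (Suc r)" for j
    using that
  proof (induction "B - rank n (collapse n (tl j))" arbitrary: j rule: less_induct)
    case less
    show ?case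
    proof (cases "collapsible n (tl j)")
      case False
      then show ?thesis using nc less by blast
    next
      case True
      obtain e w where ew: "j = e # w" "e < n" "length w = Suc r" "set w \<subseteq> {1..<n}"
        using less.prems by (rule cells_cases)
      define u where "u = collapse n w"
      have u: "redundant n u" "set u \<subseteq> {1..<n}" "length u = r" "expand u = w" "sum_list u = sum_list w"
        using collapse_props[of n w] True ew by (auto simp: u_def)
      have i: "e # u \<in> cells r" using u ew by (simp add: cells_Cons_iff)
      have "bsplit r (\<lambda>j. Theta j c0) (e # u) + Theta (e # expand u) c0 \<in> N (e + sum_list u)"
      proof (rule bsplit_triangular[OF u(1-3) ew(2)])
        fix j' assume "j' \<in> words n (Suc (Suc r))" "j' \<notin> cells (Suc r) \<or> \<not> collapsible n (tl j')"
        then show "Theta j' c0 \<in> N (sum_list j')" using nc by (auto simp: Th0 N_zero)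
      next
        fix j' assume j': "j' \<in> cells (Suc r)" "collapsible n (tl j')"
          "rank n u < rank n (collapse n (tl j'))"
        obtain e' w' where ew': "j' = e' # w'" "e' < n" "length w' = Suc r" "set w' \<subseteq> {1..<n}"
          using j'(1) by (rule cells_cases)
        have "e' # collapse n w' \<in> cells r"
          using collapse_props[of n w'] j' ew' by (auto simp: cells_Cons_iff)
        from B[OF this] have "rank n (collapse n (tl j')) \<le> B" using ew' by simp
        then have "Theta j' c \<in> N (sum_list j')"
          using j' ew by (intro less.hyps) (auto simp: u_def)
        then show "Theta j' c0 \<in> N (sum_list j')" using j' by (simp add: Th0[OF cells_words])
      qed
      moreover have "bsplit r (\<lambda>j. Theta j c0) (e # u) \<in> N (sum_list (e # u))"
      proof -
        have "Theta (e # u) (bd (Suc r) c0) - bsplit r (\<lambda>j. Theta j c0) (e # u) \<in> N (sum_list (e # u))"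
          by (rule Theta_bd[OF c0 cells_words[OF i]])
        from N_diff[OF bd0[OF i] this] u show ?thesis by simp
      qed
      ultimately have "Theta (e # expand u) c0 \<in> N (e + sum_list u)"
        using N_diff[of "bsplit r (\<lambda>j. Theta j c0) (e # u) + Theta (e # expand u) c0" "e + sum_list u"
            "bsplit r (\<lambda>j. Theta j c0) (e # u)"] by simp
      then show ?thesis using u ew less.prems by (simp add: Th0[OF cells_words])
    qed
  qed
  show ?thesis by (rule R_if_Theta[OF c all])
qed

end

section \<open>The small complex inside the Hochschild complex\<close>

text \<open>Along an antidiagonal the terms \<open>c i (Suc j)\<close> and \<open>c (Suc i) j\<close> cancel up to the border of the square.\<close>

lemma double_telescope:
  fixes c :: "nat \<Rightarrow> nat \<Rightarrow> 'b::ab_group_add"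
  shows "(\<Sum>j<M. c M (Suc j)) + (\<Sum>i<M. \<Sum>j<M. c i (Suc j) - c (Suc i) j)
    = (\<Sum>i<M. c (Suc i) M) + (\<Sum>j<M. c 0 (Suc j)) - (\<Sum>i<M. c (Suc i) 0)"
proof -
  have 1: "(\<Sum>i<M. \<Sum>j<M. c i (Suc j)) + (\<Sum>j<M. c M (Suc j))
      = (\<Sum>j<M. c 0 (Suc j)) + (\<Sum>i<M. \<Sum>j<M. c (Suc i) (Suc j))"
  proof -
    have "(\<Sum>i<M. \<Sum>j<M. c i (Suc j)) + (\<Sum>j<M. c M (Suc j)) = (\<Sum>i<Suc M. \<Sum>j<M. c i (Suc j))"
      by simp
    also have "\<dots> = (\<Sum>j<M. c 0 (Suc j)) + (\<Sum>i<M. \<Sum>j<M. c (Suc i) (Suc j))"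
      by (rule sum.lessThan_Suc_shift)
    finally show ?thesis .
  qed
  have 2: "(\<Sum>i<M. \<Sum>j<M. c (Suc i) j) + (\<Sum>i<M. c (Suc i) M)
      = (\<Sum>i<M. c (Suc i) 0) + (\<Sum>i<M. \<Sum>j<M. c (Suc i) (Suc j))"
  proof -
    have "(\<Sum>i<M. \<Sum>j<M. c (Suc i) j) + (\<Sum>i<M. c (Suc i) M) = (\<Sum>i<M. \<Sum>j<Suc M. c (Suc i) j)"
      by (simp add: sum.distrib)
    also have "\<dots> = (\<Sum>i<M. c (Suc i) 0 + (\<Sum>j<M. c (Suc i) (Suc j)))"
      by (simp only: sum.lessThan_Suc_shift)
    finally show ?thesis by (simp add: sum.distrib)
  qed
  from 1 2 show ?thesis by (simp add: sum_subtractf algebra_simps)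
qed

context monogenic
begin

definition pairs :: "nat list \<Rightarrow> nat list" where
  "pairs js = concat (map (\<lambda>j. [1, n - 1 - j]) js)"

lemma pairs_simps [simp]:
  "pairs [] = []" "pairs (j # js) = 1 # (n - 1 - j) # pairs js"
  "pairs (js @ js') = pairs js @ pairs js'" "length (pairs js) = 2 * length js"
  by (induction js) (simp_all add: pairs_def)

lemma pairs_entries:
  assumes "set js \<subseteq> {..<n - 1}"
  shows "set (pairs js) \<subseteq> {1..<n}" "sum_list (pairs js) + sum_list js = length js * n"
proof -
  have "set (pairs js) \<subseteq> {1..<n} \<and> sum_list (pairs js) + sum_list js = length js * n"
    using assms by (induction js) auto
  then show "set (pairs js) \<subseteq> {1..<n}" "sum_list (pairs js) + sum_list js = length js * n" by auto
qed

text \<open>In degree \<open>2 m\<close> the generator of the small complex corresponds to the element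
  \<open>\<Sum> x\<^sup>j\<^sup>1\<^sup>+\<^sup>\<dots>\<^sup>+\<^sup>j\<^sup>m \<otimes> x \<otimes> x\<^sup>n\<^sup>-\<^sup>1\<^sup>-\<^sup>j\<^sup>1 \<otimes> \<dots> \<otimes> x \<otimes> x\<^sup>n\<^sup>-\<^sup>1\<^sup>-\<^sup>j\<^sup>m\<close>, a sum over all \<open>j\<close> below \<open>n - 1\<close>. It is what the
  contracting homotopy of the bar resolution produces from the two-periodic resolution of \<open>A\<close>.
  In odd degrees there is a further factor \<open>x\<close> at the end and \<open>x\<^sup>n\<^sup>-\<^sup>1\<close> at the beginning.\<close>

definition small_word :: "nat \<Rightarrow> nat list \<Rightarrow> nat list" where
  "small_word r js = pairs js @ (if even r then [] else [1])"

definition small_exponent :: "nat \<Rightarrow> nat list \<Rightarrow> nat" where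
  "small_exponent r js = (if even r then 0 else n - 1) + sum_list js"

definition small_to_bar :: "nat \<Rightarrow> 'a \<Rightarrow> ('a poly set list \<Rightarrow>\<^sub>0 'k)" where
  "small_to_bar r y = (\<Sum>js\<in>words (n - 1) (r div 2). word y (small_exponent r js) (small_word r js))"

definition word_face :: "nat \<Rightarrow> 'a \<Rightarrow> nat \<Rightarrow> nat list \<Rightarrow> ('a poly set list \<Rightarrow>\<^sub>0 'k)" where
  "word_face k y e w = (if k = 0 then word y (e + hd w) (tl w)
     else word y e (take (k - 1) w @ (w ! (k - 1) + w ! k) # drop (Suc k) w))"

lemma word_face_simps:
  "word_face 0 y e (a # w) = word y (e + a) w"
  "k = Suc (length us) \<Longrightarrow> word_face k y e (us @ a # b # vs) = word y e (us @ (a + b) # vs)"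
  by (simp_all add: word_face_def nth_append)

lemma bd_word:
  assumes w: "length w = Suc r"
  shows "bd (Suc r) (word y e w) = (\<Sum>k\<le>r. free_scale ((- 1) ^ k) (word_face k y e w))
    + free_scale ((- 1) ^ Suc r) (word ((\<alpha> ^^ last w) y) (last w + e) (butlast w))"
proof -
  have l: "length (X y e # map (X 1) w) = Suc (Suc r)" using w by simp
  have 1: "tup (face (Suc r) k (X y e # map (X 1) w)) = word_face k y e w" if k: "k \<le> r" for k
  proof (cases k)
    case 0
    obtain a v where "w = a # v" using w by (cases w) auto
    then show ?thesis using 0 by (simp add: face_def word_face_def word_def X_mult)
  next
    case (Suc k')
    then have "take (k - 1) w @ w ! (k - 1) # w ! k # drop (Suc k) w = w"
      using w k by (simp add: Cons_nth_drop_Suc)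
    show ?thesis using Suc w k
      by (simp add: face_def word_face_def word_def X_mult take_map drop_map)
  qed
  have 2: "tup (face (Suc r) (Suc r) (X y e # map (X 1) w))
      = word ((\<alpha> ^^ last w) y) (last w + e) (butlast w)"
  proof -
    have "w \<noteq> []" using w by auto
    then have "last w = w ! r" using w by (simp add: last_conv_nth)
    then show ?thesis using w by (simp add: face_def word_def X_mult map_butlast)
  qed
  show ?thesis
    unfolding word_def[of y e] bd_tup sum.atMost_Suc 2 by (simp add: 1)
qed

text \<open>Here \<open>x\<^sup>n\<close> is the scalar \<open>q\<close>, so the tensor is degenerate.\<close>

lemma word_n: "length us + length vs + 1 = r \<Longrightarrow> word y e (us @ n # vs) \<in> R r"
  unfolding word_def
proof (rule tup_degenerate[where i = "Suc (length us)"])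
  have "X 1 n = \<iota> q" using X_reduce[of 1 0] by (simp add: iota_X)
  then show "(X y e # map (X 1) (us @ n # vs)) ! Suc (length us) \<in> range \<iota>" by (simp add: nth_append)
qed (use word_tuples[of "us @ n # vs" r y e 1] in auto)

lemma cong_diff_zero: "x \<in> R r \<Longrightarrow> y \<in> R r \<Longrightarrow> chain_cong r (c + x - y) c"
  by (simp add: chain_cong_def R_diff)

text \<open>
  The face between two pairs produces \<open>n - i, n - 1 - j\<close> and the face inside the second pair produces
  \<open>n - 1 - i, n - j\<close>, with opposite signs and the same power of \<open>x\<close> in front. So the sum over \<open>i\<close> and \<open>j\<close>
  telescopes; the terms that remain have an entry \<open>n\<close> and vanish, or move an isolated \<open>1\<close>
  past one pair to the right.
\<close>

lemma inner_faces_pairs: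
  assumes "2 * m + 1 + length tail = r"
  shows "chain_cong r
    (\<Sum>js\<in>words (n - 1) (Suc m). \<Sum>k<2 * Suc m.
       free_scale ((- 1) ^ k) (word_face k y (E + sum_list js) (pairs js @ tail)))
    (\<Sum>js\<in>words (n - 1) m. word y (E + (n - 1) + sum_list js) (pairs js @ 1 # tail))"
  using assms
proof (induction m arbitrary: E tail)
  case 0
  let ?a = "\<lambda>p. word y (E + p) ((n - p) # tail)"
  have "(\<Sum>js\<in>words (n - 1) (Suc 0). \<Sum>k<2 * Suc 0.
       free_scale ((- 1) ^ k) (word_face k y (E + sum_list js) (pairs js @ tail)))
     = (\<Sum>j<n - 1. ?a (Suc j) - ?a j)"
    unfolding sum_words_Cons
  proof (rule sum.cong[OF refl])
    fix j assume "j \<in> {..<n - 1}"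
    then have j: "j < n - 1" by simp
    have "Suc (n - Suc j) = n - j" using j by simp
    moreover have "{..<2 * Suc 0} = {0, Suc 0}" by auto
    ultimately show "(\<Sum>w\<in>words (n - 1) 0. \<Sum>k<2 * Suc 0.
       free_scale ((- 1) ^ k) (word_face k y (E + sum_list (j # w)) (pairs (j # w) @ tail)))
       = ?a (Suc j) - ?a j"
      using j word_face_simps(2)[of "Suc 0" "[]" y "E + j" 1 "n - Suc j" tail]
      by (simp add: word_face_simps(1))
  qed
  also have "\<dots> = ?a (n - 1) - ?a 0" by (rule sum_lessThan_telescope)
  also have "chain_cong r \<dots> (?a (n - 1) - 0)"
    using word_n[of "[]" tail r y E] 0 by (intro cong_diff cong_refl) (simp add: cong_zero_iff)
  finally show ?case using n_ge_2 by simp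
next
  case (Suc m)
  have split: "(\<Sum>k<2 * Suc (Suc m). f k) = (\<Sum>k<2 * Suc m. f k) + (f (2 * m + 2) + f (2 * m + 3))"
    for f :: "nat \<Rightarrow> 'a poly set list \<Rightarrow>\<^sub>0 'k"
    by (simp add: numeral_3_eq_3 add.assoc)
  let ?F = "\<lambda>k js. free_scale ((- 1) ^ k) (word_face k y (E + sum_list js) (pairs js @ tail))"
  \<comment> \<open>Only \<open>p + t > 0\<close> matters: both \<open>c js i (Suc j)\<close> and \<open>c js (Suc i) j\<close> have \<open>i + j\<close> in the exponent.\<close>
  define c where "c js p t = word y (E + sum_list js + (p + t - 1)) (pairs js @ 1 # (n - p) # (n - t) # tail)"
    for js p t
  have "(\<Sum>js\<in>words (n - 1) (Suc (Suc m)). \<Sum>k<2 * Suc (Suc m). ?F k js)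
     = (\<Sum>js\<in>words (n - 1) (Suc (Suc m)). \<Sum>k<2 * Suc m. ?F k js)
     + (\<Sum>js\<in>words (n - 1) (Suc (Suc m)). ?F (2 * m + 2) js + ?F (2 * m + 3) js)"
    unfolding split sum.distrib ..
  also have "(\<Sum>js\<in>words (n - 1) (Suc (Suc m)). \<Sum>k<2 * Suc m. ?F k js)
     = (\<Sum>j<n - 1. \<Sum>js\<in>words (n - 1) (Suc m). \<Sum>k<2 * Suc m. free_scale ((- 1) ^ k)
         (word_face k y (E + j + sum_list js) (pairs js @ 1 # (n - 1 - j) # tail)))"
    unfolding sum_words_snoc[of _ _ "Suc m"] by (subst sum.swap) (simp add: ac_simps)
  also have "(\<Sum>js\<in>words (n - 1) (Suc (Suc m)). ?F (2 * m + 2) js + ?F (2 * m + 3) js)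
     = (\<Sum>js\<in>words (n - 1) m. \<Sum>i<n - 1. \<Sum>j<n - 1. c js i (Suc j) - c js (Suc i) j)"
    unfolding sum_words_snoc
  proof (intro sum.cong refl)
    fix js i j assume js: "js \<in> words (n - 1) m" and ij: "i \<in> {..<n - 1}" "j \<in> {..<n - 1}"
    have lj: "length js = m" using js by (simp add: words_def)
    let ?w = "pairs ((js @ [i]) @ [j]) @ tail" and ?E = "E + sum_list ((js @ [i]) @ [j])"
    have "word_face (2 * m + 2) y ?E ?w = c js i (Suc j)"
    proof -
      have "word_face (2 * m + 2) y ?E ((pairs js @ [1]) @ (n - 1 - i) # 1 # (n - 1 - j) # tail)
          = word y ?E ((pairs js @ [1]) @ (n - 1 - i + 1) # (n - 1 - j) # tail)"
        by (rule word_face_simps(2)) (simp add: lj)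
      moreover have "n - 1 - i + 1 = n - i" using ij by auto
      ultimately show ?thesis by (simp add: c_def add.assoc)
    qed
    moreover have "word_face (2 * m + 3) y ?E ?w = c js (Suc i) j"
    proof -
      have "word_face (2 * m + 3) y ?E ((pairs js @ [1, n - 1 - i]) @ 1 # (n - 1 - j) # tail)
          = word y ?E ((pairs js @ [1, n - 1 - i]) @ (1 + (n - 1 - j)) # tail)"
        by (rule word_face_simps(2)) (simp add: lj)
      moreover have "1 + (n - 1 - j) = n - j" using ij by auto
      ultimately show ?thesis by (simp add: c_def add.assoc)
    qed
    ultimately show "?F (2 * m + 2) ((js @ [i]) @ [j]) + ?F (2 * m + 3) ((js @ [i]) @ [j])
      = c js i (Suc j) - c js (Suc i) j" by (simp add: numeral_3_eq_3)
  qed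
  also have "chain_cong r ((\<Sum>j<n - 1. \<Sum>js\<in>words (n - 1) (Suc m). \<Sum>k<2 * Suc m. free_scale ((- 1) ^ k)
         (word_face k y (E + j + sum_list js) (pairs js @ 1 # (n - 1 - j) # tail)))
      + (\<Sum>js\<in>words (n - 1) m. \<Sum>i<n - 1. \<Sum>j<n - 1. c js i (Suc j) - c js (Suc i) j))
    ((\<Sum>j<n - 1. \<Sum>js\<in>words (n - 1) m. c js (n - 1) (Suc j))
      + (\<Sum>js\<in>words (n - 1) m. \<Sum>i<n - 1. \<Sum>j<n - 1. c js i (Suc j) - c js (Suc i) j))"
  proof (intro cong_add cong_refl cong_sum)
    fix j assume "j \<in> {..<n - 1}"
    have "chain_cong r (\<Sum>js\<in>words (n - 1) (Suc m). \<Sum>k<2 * Suc m. free_scale ((- 1) ^ k)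
         (word_face k y (E + j + sum_list js) (pairs js @ 1 # (n - 1 - j) # tail)))
       (\<Sum>js\<in>words (n - 1) m. word y (E + j + (n - 1) + sum_list js) (pairs js @ 1 # 1 # (n - 1 - j) # tail))"
      using Suc.prems by (intro Suc.IH) simp
    also have "\<dots> = (\<Sum>js\<in>words (n - 1) m. c js (n - 1) (Suc j))"
      using n_ge_2 by (intro sum.cong) (simp_all add: c_def ac_simps)
    finally show "chain_cong r (\<Sum>js\<in>words (n - 1) (Suc m). \<Sum>k<2 * Suc m. free_scale ((- 1) ^ k)
         (word_face k y (E + j + sum_list js) (pairs js @ 1 # (n - 1 - j) # tail)))
       (\<Sum>js\<in>words (n - 1) m. c js (n - 1) (Suc j))" .
  qed
  also have "(\<Sum>j<n - 1. \<Sum>js\<in>words (n - 1) m. c js (n - 1) (Suc j))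
      + (\<Sum>js\<in>words (n - 1) m. \<Sum>i<n - 1. \<Sum>j<n - 1. c js i (Suc j) - c js (Suc i) j)
    = (\<Sum>js\<in>words (n - 1) m. (\<Sum>j<n - 1. c js (n - 1) (Suc j))
      + (\<Sum>i<n - 1. \<Sum>j<n - 1. c js i (Suc j) - c js (Suc i) j))"
    by (subst sum.swap) (simp add: sum.distrib)
  also have "\<dots> = (\<Sum>js\<in>words (n - 1) m. (\<Sum>i<n - 1. c js (Suc i) (n - 1))
      + (\<Sum>j<n - 1. c js 0 (Suc j)) - (\<Sum>i<n - 1. c js (Suc i) 0))"
    by (simp only: double_telescope)
  also have "chain_cong r \<dots> (\<Sum>js\<in>words (n - 1) m. \<Sum>i<n - 1. c js (Suc i) (n - 1))"
  proof (intro cong_sum cong_diff_zero R_sum)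
    fix js j assume "js \<in> words (n - 1) m"
    then have "length js = m" by (simp add: words_def)
    then show "c js 0 (Suc j) \<in> R r" "c js (Suc j) 0 \<in> R r"
      using word_n[of "pairs js @ [1]" "(n - Suc j) # tail" r y "E + sum_list js + j"]
        word_n[of "pairs js @ [1, n - Suc j]" tail r y "E + sum_list js + j"] Suc.prems
      by (simp_all add: c_def)
  qed
  also have "\<dots> = (\<Sum>js\<in>words (n - 1) (Suc m). word y (E + (n - 1) + sum_list js) (pairs js @ 1 # tail))"
    unfolding sum_words_snoc using n_ge_2
    by (intro sum.cong refl) (simp add: c_def ac_simps)
  finally show ?case .
qed

lemma sum_Suc_split: "(\<Sum>k\<le>2 * m. f k) = (\<Sum>k<2 * m. f k) + f (2 * m)" for f :: "nat \<Rightarrow> 'b::comm_monoid_add"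
  by (simp add: lessThan_Suc_atMost[symmetric])

definition small_d :: "nat \<Rightarrow> 'a \<Rightarrow> 'a" where
  "small_d r y = (if even r then \<Sum>l<n. (\<alpha> ^^ l) y else (\<alpha> y - y) * lam n)"

lemma small_to_bar_even: "small_to_bar (2 * m) y = (\<Sum>js\<in>words (n - 1) m. word y (sum_list js) (pairs js))"
  and small_to_bar_odd: "small_to_bar (Suc (2 * m)) y
    = (\<Sum>js\<in>words (n - 1) m. word y (n - 1 + sum_list js) (pairs js @ [1]))"
  by (simp_all add: small_to_bar_def small_word_def small_exponent_def)

text \<open>The inner faces leave the term with \<open>l = 0\<close>. The last face moves \<open>x\<^sup>n\<^sup>-\<^sup>1\<^sup>-\<^sup>j\<close> to the front, past \<open>y\<close>, and
  gives the terms with \<open>l = n - 1 - j\<close>.\<close>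

lemma chain_map_even:
  "chain_cong (Suc (2 * m)) (bd (Suc (Suc (2 * m))) (small_to_bar (2 * Suc m) y))
     (small_to_bar (Suc (2 * m)) (\<Sum>l<n. (\<alpha> ^^ l) y))"
proof -
  let ?r = "Suc (2 * m)"
  let ?w = "\<lambda>l js. word ((\<alpha> ^^ l) y) (n - 1 + sum_list js) (pairs js @ [1])"
  have "bd (Suc ?r) (small_to_bar (2 * Suc m) y)
     = (\<Sum>js\<in>words (n - 1) (Suc m). \<Sum>k<2 * Suc m.
          free_scale ((- 1) ^ k) (word_face k y (0 + sum_list js) (pairs js @ [])))
     + (\<Sum>js\<in>words (n - 1) (Suc m). word ((\<alpha> ^^ last (pairs js)) y) (last (pairs js) + sum_list js) (butlast (pairs js)))"
    unfolding small_to_bar_even bd.sum sum.distrib[symmetric]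
  proof (intro sum.cong refl)
    fix js assume "js \<in> words (n - 1) (Suc m)"
    then have "length (pairs js) = Suc ?r" by (simp add: words_def)
    moreover have "{..?r} = {..<2 * Suc m}" by auto
    ultimately show "bd (Suc ?r) (word y (sum_list js) (pairs js))
      = (\<Sum>k<2 * Suc m. free_scale ((- 1) ^ k) (word_face k y (0 + sum_list js) (pairs js @ [])))
      + word ((\<alpha> ^^ last (pairs js)) y) (last (pairs js) + sum_list js) (butlast (pairs js))"
      by (simp add: bd_word del: pairs_simps(4))
  qed
  also have "(\<Sum>js\<in>words (n - 1) (Suc m). word ((\<alpha> ^^ last (pairs js)) y) (last (pairs js) + sum_list js) (butlast (pairs js)))
     = (\<Sum>js\<in>words (n - 1) m. \<Sum>j<n - 1. ?w (n - 1 - j) js)"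
    unfolding sum_words_snoc
  proof (intro sum.cong refl)
    fix js j assume "j \<in> {..<n - 1}"
    then have e: "n - 1 - j + (sum_list js + j) = n - 1 + sum_list js" by simp
    have p: "last (pairs (js @ [j])) = n - 1 - j" "butlast (pairs (js @ [j])) = pairs js @ [1]"
      "sum_list (js @ [j]) = sum_list js + j" by (simp_all add: butlast_append)
    show "word ((\<alpha> ^^ last (pairs (js @ [j]))) y) (last (pairs (js @ [j])) + sum_list (js @ [j]))
      (butlast (pairs (js @ [j]))) = ?w (n - 1 - j) js"
      by (simp only: p e)
  qed
  also have "\<dots> = (\<Sum>js\<in>words (n - 1) m. \<Sum>l<n - 1. ?w (Suc l) js)"
  proof (rule sum.cong[OF refl])
    fix js
    have "(\<Sum>j<n - 1. ?w (n - 1 - j) js) = (\<Sum>j<n - 1. ?w (Suc (n - 1 - Suc j)) js)"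
      by (intro sum.cong refl) (simp add: Suc_diff_Suc del: funpow.simps)
    also have "\<dots> = (\<Sum>l<n - 1. ?w (Suc l) js)"
      by (rule sum.nat_diff_reindex)
    finally show "(\<Sum>j<n - 1. ?w (n - 1 - j) js) = (\<Sum>l<n - 1. ?w (Suc l) js)" .
  qed
  also have "chain_cong ?r ((\<Sum>js\<in>words (n - 1) (Suc m). \<Sum>k<2 * Suc m.
          free_scale ((- 1) ^ k) (word_face k y (0 + sum_list js) (pairs js @ [])))
        + (\<Sum>js\<in>words (n - 1) m. \<Sum>l<n - 1. ?w (Suc l) js))
     ((\<Sum>js\<in>words (n - 1) m. word y (0 + (n - 1) + sum_list js) (pairs js @ [1]))
        + (\<Sum>js\<in>words (n - 1) m. \<Sum>l<n - 1. ?w (Suc l) js))"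
    by (intro cong_add cong_refl inner_faces_pairs) simp
  also have "\<dots> = (\<Sum>js\<in>words (n - 1) m. ?w 0 js + (\<Sum>l<n - 1. ?w (Suc l) js))"
    by (simp add: sum.distrib)
  also have "\<dots> = (\<Sum>js\<in>words (n - 1) m. \<Sum>l<Suc (n - 1). ?w l js)"
    by (simp only: sum.lessThan_Suc_shift)
  also have "chain_cong ?r \<dots> (small_to_bar ?r (\<Sum>l<n. (\<alpha> ^^ l) y))"
    unfolding small_to_bar_odd
  proof (rule cong_sum)
    fix js assume "js \<in> words (n - 1) m"
    then have "length (pairs js @ [1]) = ?r" by (simp add: words_def)
    then show "chain_cong ?r (\<Sum>l<Suc (n - 1). ?w l js)
        (word (\<Sum>l<n. (\<alpha> ^^ l) y) (n - 1 + sum_list js) (pairs js @ [1]))"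
      using cong_sym[OF word_sum[of "{..<n}" "pairs js @ [1]" "\<lambda>l. (\<alpha> ^^ l) y" "n - 1 + sum_list js"]] n_ge_2
      by (simp del: sum.lessThan_Suc)
  qed
  finally show ?thesis .
qed

text \<open>Beyond the inner faces of the pairs there is the face that merges the last pair with
  the final \<open>x\<close> (without pairs: the first entry with that \<open>x\<close>); together they restore the sum over all \<open>j\<close>, with \<open>x\<^sup>n\<close> in front.\<close>

lemma odd_inner_faces:
  "chain_cong (2 * m) (\<Sum>js\<in>words (n - 1) m. \<Sum>k\<le>2 * m.
      free_scale ((- 1) ^ k) (word_face k y (n - 1 + sum_list js) (pairs js @ [1])))
    (\<Sum>js\<in>words (n - 1) m. word y (sum_list js + n) (pairs js))"
proof (cases m)
  case 0
  then show ?thesis using n_ge_2 by (simp add: word_face_simps)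
next
  case (Suc m')
  let ?a = "\<lambda>js j. word y (n - 1 + sum_list js + j) (pairs js @ [1, n - j])"
  have "(\<Sum>js\<in>words (n - 1) m. \<Sum>k\<le>2 * m.
      free_scale ((- 1) ^ k) (word_face k y (n - 1 + sum_list js) (pairs js @ [1])))
    = (\<Sum>js\<in>words (n - 1) (Suc m'). \<Sum>k<2 * Suc m'.
      free_scale ((- 1) ^ k) (word_face k y (n - 1 + sum_list js) (pairs js @ [1])))
    + (\<Sum>js\<in>words (n - 1) (Suc m'). word_face (2 * Suc m') y (n - 1 + sum_list js) (pairs js @ [1]))"
    unfolding sum_Suc_split sum.distrib Suc by simp
  also have "(\<Sum>js\<in>words (n - 1) (Suc m'). word_face (2 * Suc m') y (n - 1 + sum_list js) (pairs js @ [1]))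
    = (\<Sum>js\<in>words (n - 1) m'. \<Sum>j<n - 1. ?a js j)"
    unfolding sum_words_snoc
  proof (intro sum.cong refl)
    fix js j assume "js \<in> words (n - 1) m'" and j: "j \<in> {..<n - 1}"
    then have l: "length js = m'" by (simp add: words_def)
    have "word_face (2 * Suc m') y (n - 1 + sum_list (js @ [j])) ((pairs js @ [1]) @ (n - 1 - j) # 1 # [])
      = word y (n - 1 + sum_list (js @ [j])) ((pairs js @ [1]) @ (n - 1 - j + 1) # [])"
      by (rule word_face_simps(2)) (simp add: l)
    moreover have "n - 1 - j + 1 = n - j" using j by auto
    ultimately show "word_face (2 * Suc m') y (n - 1 + sum_list (js @ [j])) (pairs (js @ [j]) @ [1]) = ?a js j"
      by (simp add: add.assoc)
  qed
  also have "chain_cong (2 * m) ((\<Sum>js\<in>words (n - 1) (Suc m'). \<Sum>k<2 * Suc m'.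
      free_scale ((- 1) ^ k) (word_face k y (n - 1 + sum_list js) (pairs js @ [1])))
      + (\<Sum>js\<in>words (n - 1) m'. \<Sum>j<n - 1. ?a js j))
    ((\<Sum>js\<in>words (n - 1) m'. word y (n - 1 + (n - 1) + sum_list js) (pairs js @ 1 # [1]))
      + (\<Sum>js\<in>words (n - 1) m'. \<Sum>j<n - 1. ?a js j))"
    by (intro cong_add cong_refl inner_faces_pairs) (simp add: Suc)
  also have "\<dots> = (\<Sum>js\<in>words (n - 1) m'. \<Sum>j<Suc (n - 1). ?a js j)"
  proof -
    have "n - (n - 1) = 1" using n_ge_2 by simp
    then have "word y (n - 1 + (n - 1) + sum_list js) (pairs js @ 1 # [1]) = ?a js (n - 1)" for js
      by (simp add: ac_simps)
    then show ?thesis by (simp only: sum.lessThan_Suc sum.distrib add.commute)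
  qed
  also have "\<dots> = (\<Sum>js\<in>words (n - 1) m'. ?a js 0 + (\<Sum>j<n - 1. ?a js (Suc j)))"
    by (simp only: sum.lessThan_Suc_shift)
  also have "chain_cong (2 * m) \<dots> (\<Sum>js\<in>words (n - 1) m'. 0 + (\<Sum>j<n - 1. ?a js (Suc j)))"
  proof (intro cong_sum cong_add cong_refl)
    fix js assume "js \<in> words (n - 1) m'"
    then have "length js = m'" by (simp add: words_def)
    then show "chain_cong (2 * m) (?a js 0) 0"
      using word_n[of "pairs js @ [1]" "[]" "2 * m" y "n - 1 + sum_list js"] Suc
      by (simp add: cong_zero_iff)
  qed
  also have "\<dots> = (\<Sum>js\<in>words (n - 1) m. word y (sum_list js + n) (pairs js))"
    unfolding Suc sum_words_snoc using n_ge_2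
    by (intro sum.cong refl) (simp add: ac_simps)
  finally show ?thesis .
qed

text \<open>The last face gives the same sum as the other faces, with \<open>\<alpha> y\<close> for \<open>y\<close> and the opposite sign.
  Replacing \<open>x\<^sup>n\<close> by \<open>q = - lam n\<close> yields the boundary of the small complex.\<close>

lemma chain_map_odd:
  "chain_cong (2 * m) (bd (Suc (2 * m)) (small_to_bar (Suc (2 * m)) y))
     (small_to_bar (2 * m) ((\<alpha> y - y) * lam n))"
proof -
  have "bd (Suc (2 * m)) (small_to_bar (Suc (2 * m)) y)
    = (\<Sum>js\<in>words (n - 1) m. \<Sum>k\<le>2 * m.
      free_scale ((- 1) ^ k) (word_face k y (n - 1 + sum_list js) (pairs js @ [1])))
    - (\<Sum>js\<in>words (n - 1) m. word (\<alpha> y) (sum_list js + n) (pairs js))"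
    unfolding small_to_bar_odd bd.sum sum_subtractf[symmetric]
  proof (intro sum.cong refl)
    fix js assume "js \<in> words (n - 1) m"
    then have "length (pairs js @ [1]) = Suc (2 * m)" by (simp add: words_def)
    from bd_word[OF this, of y "n - 1 + sum_list js"]
    show "bd (Suc (2 * m)) (word y (n - 1 + sum_list js) (pairs js @ [1]))
      = (\<Sum>k\<le>2 * m. free_scale ((- 1) ^ k) (word_face k y (n - 1 + sum_list js) (pairs js @ [1])))
        - word (\<alpha> y) (sum_list js + n) (pairs js)"
      using n_ge_2 by (simp add: add.commute)
  qed
  also have "chain_cong (2 * m) \<dots> ((\<Sum>js\<in>words (n - 1) m. word y (sum_list js + n) (pairs js))
    - (\<Sum>js\<in>words (n - 1) m. word (\<alpha> y) (sum_list js + n) (pairs js)))"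
    by (intro cong_diff cong_refl odd_inner_faces)
  also have "\<dots> = (\<Sum>js\<in>words (n - 1) m. word (y * q) (sum_list js) (pairs js) - word (\<alpha> y * q) (sum_list js) (pairs js))"
    using word_reduce[of _ _ 1] by (simp add: sum_subtractf)
  also have "chain_cong (2 * m) \<dots> (small_to_bar (2 * m) ((\<alpha> y - y) * lam n))"
    unfolding small_to_bar_even
  proof (rule cong_sum)
    fix js assume "js \<in> words (n - 1) m"
    then have l: "length (pairs js) = 2 * m" by (simp add: words_def)
    have "(\<alpha> y - y) * lam n + \<alpha> y * q = y * q" by (simp add: q_def left_diff_distrib)
    then have "chain_cong (2 * m) (word (y * q) (sum_list js) (pairs js))
      (word ((\<alpha> y - y) * lam n) (sum_list js) (pairs js) + word (\<alpha> y * q) (sum_list js) (pairs js))"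
      using word_add[of "pairs js" "(\<alpha> y - y) * lam n" "\<alpha> y * q" "sum_list js"] l by simp
    then show "chain_cong (2 * m)
      (word (y * q) (sum_list js) (pairs js) - word (\<alpha> y * q) (sum_list js) (pairs js))
      (word ((\<alpha> y - y) * lam n) (sum_list js) (pairs js))"
      by (simp add: chain_cong_def algebra_simps)
  qed
  finally show ?thesis .
qed

lemma chain_map:
  "chain_cong r (bd (Suc r) (small_to_bar (Suc r) y)) (small_to_bar r (small_d (Suc r) y))"
proof (cases "even r")
  case True
  then obtain m where "r = 2 * m" by (elim evenE)
  then show ?thesis using chain_map_odd[of m y] by (simp add: small_d_def)
next
  case False
  then obtain m where "r = Suc (2 * m)" by (elim oddE) simp
  then show ?thesis using chain_map_even[of m y] by (simp add: small_d_def)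
qed

abbreviation "tw \<equiv> eigen_twist n"

lemma small_word_props:
  assumes js: "js \<in> words (n - 1) (r div 2)"
  shows "length (small_word r js) = r" "set (small_word r js) \<subseteq> {1..<n}"
    "small_exponent r js + sum_list (small_word r js) = tw r" "\<not> redundant n (small_word r js)"
    "small_word r js = critical n r \<longleftrightarrow> js = replicate (r div 2) 0"
proof -
  have l: "length js = r div 2" and s: "set js \<subseteq> {..<n - 1}" using js by (auto simp: words_def)
  show len: "length (small_word r js) = r" using l by (auto simp: small_word_def elim!: evenE oddE)
  show "set (small_word r js) \<subseteq> {1..<n}"
    using pairs_entries(1)[OF s] n_ge_2 by (auto simp: small_word_def)
  show "small_exponent r js + sum_list (small_word r js) = tw r"
    using pairs_entries(2)[OF s] n_ge_2 l by (auto simp: small_exponent_def small_word_def eigen_twist_def)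
  have red: "\<not> redundant n (pairs js @ v)" if "v = [] \<or> v = [1]" for v
    using s that by (induction js) auto
  then show "\<not> redundant n (small_word r js)" by (simp add: small_word_def)
  have crit: "pairs js @ v = critical n (2 * length js + length v) \<longleftrightarrow> js = replicate (length js) 0"
    if "v = [] \<or> v = [1]" for v
    using s that n_ge_2 by (induction js) auto
  from crit[of "if even r then [] else [1]"]
  show "small_word r js = critical n r \<longleftrightarrow> js = replicate (r div 2) 0"
    using l len by (simp add: small_word_def split: if_splits)
qed

lemma small_to_bar_free: "small_to_bar r y \<in> free_space r"
  unfolding small_to_bar_def
  by (intro free.subspace_sum[OF free_space_subspace] word_free small_word_props)

lemma small_to_bar_add: "chain_cong r (small_to_bar r (y + z)) (small_to_bar r y + small_to_bar r z)"
  unfolding small_to_bar_def sum.distrib[symmetric]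
proof (rule cong_sum)
  fix js assume "js \<in> words (n - 1) (r div 2)"
  then show "chain_cong r (word (y + z) (small_exponent r js) (small_word r js))
    (word y (small_exponent r js) (small_word r js) + word z (small_exponent r js) (small_word r js))"
    using word_add[of "small_word r js" y z] by (simp add: small_word_props)
qed

lemma small_to_bar_scale: "chain_cong r (small_to_bar r (scale c y)) (free_scale c (small_to_bar r y))"
  unfolding small_to_bar_def free.scale_sum_right
proof (rule cong_sum)
  fix js assume "js \<in> words (n - 1) (r div 2)"
  then show "chain_cong r (word (scale c y) (small_exponent r js) (small_word r js))
    (free_scale c (word y (small_exponent r js) (small_word r js)))"
    using word_scale[of "small_word r js" c y] by (simp add: small_word_props)
qed

lemma small_to_bar_N:
  assumes "y \<in> N (tw r)"
  shows "small_to_bar r y \<in> R r"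
  unfolding small_to_bar_def
proof (rule R_sum)
  fix js assume "js \<in> words (n - 1) (r div 2)"
  note w = small_word_props[OF this]
  have "set (small_word r js) \<subseteq> {..<n}" using w(2) by auto
  then show "word y (small_exponent r js) (small_word r js) \<in> R r"
    using word_N[of "small_word r js" y "small_exponent r js"] w(1,3) assms by simp
qed

text \<open>The first exponent is the only one for which the sum of a critical word is divisible by \<open>n\<close>.\<close>

definition crit_index :: "nat \<Rightarrow> nat list" where
  "crit_index r = (if even r then 0 else n - 1) # critical n r"

lemma sum_critical: "sum_list (critical n r) = (r div 2) * n + r mod 2"
  using n_ge_2 by (induction n r rule: critical.induct) auto

lemma sum_crit_index: "sum_list (crit_index r) = tw r"
  using n_ge_2 by (auto simp: crit_index_def sum_critical eigen_twist_def odd_iff_mod_2_eq_one)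

lemma crit_index_cells: "crit_index r \<in> cells r"
  using n_ge_2 set_critical[of n r] by (simp add: crit_index_def cells_Cons_iff)

lemma Theta_small_to_bar_redundant:
  assumes i: "i \<in> cells r" and red: "redundant n (tl i)"
  shows "Theta i (small_to_bar r y) = 0"
proof -
  obtain e u where eu: "i = e # u" "e < n" "length u = r" "set u \<subseteq> {1..<n}"
    using i by (rule cells_cases)
  show ?thesis
    unfolding small_to_bar_def Theta.sum
  proof (intro sum.neutral ballI)
    fix js assume "js \<in> words (n - 1) (r div 2)"
    note w = small_word_props[OF this]
    have "set (small_word r js) \<subseteq> {..<n}" "set u \<subseteq> {..<n}" using w(2) eu by auto
    moreover have "u \<noteq> small_word r js" using w(4) eu red by auto
    ultimately show "Theta i (word y (small_exponent r js) (small_word r js)) = 0"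
      using Theta_word[of u "small_word r js" e y "small_exponent r js"] w(1) eu by simp
  qed
qed

lemma Theta_small_to_bar_critical: "Theta (crit_index r) (small_to_bar r y) = y"
proof -
  let ?z = "replicate (r div 2) (0::nat)"
  have z: "small_exponent r ?z = (if even r then 0 else n - 1)"
    by (simp add: small_exponent_def sum_list_replicate)
  have "Theta (crit_index r) (small_to_bar r y) = (\<Sum>js\<in>words (n - 1) (r div 2). if js = ?z then y else 0)"
    unfolding small_to_bar_def Theta.sum
  proof (rule sum.cong[OF refl])
    fix js assume "js \<in> words (n - 1) (r div 2)"
    note w = small_word_props[OF this]
    have s: "set (small_word r js) \<subseteq> {..<n}" "set (critical n r) \<subseteq> {..<n}"
      using w(2) set_critical[OF n_ge_2, of r] by auto
    have e: "(if even r then 0 else n - 1) < n" using n_ge_2 by simp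
    have "Theta (crit_index r) (word y (small_exponent r js) (small_word r js))
      = (if critical n r = small_word r js \<and> small_exponent r js mod n = (if even r then 0 else n - 1)
         then y * q ^ (small_exponent r js div n) else 0)"
      unfolding crit_index_def using w(1) s e by (intro Theta_word) auto
    also have "\<dots> = (if js = ?z then y else 0)"
    proof (cases "js = ?z")
      case True
      then have "critical n r = small_word r js" using w(5) by simp
      then show ?thesis using True z e by simp
    next
      case False
      then show ?thesis using w(5) by auto
    qed
    finally show "Theta (crit_index r) (word y (small_exponent r js) (small_word r js))
      = (if js = ?z then y else 0)" .
  qed
  moreover have "?z \<in> words (n - 1) (r div 2)" using n_ge_2 by (auto simp: words_def)
  ultimately show ?thesis by simp
qed

section \<open>The two complexes have the same homology\<close>

text \<open>First subtract a boundary so that no redundant coefficients are left, then the value of \<open>small_to_bar\<close>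
  that has the same critical coefficient. What remains has only collapsible coefficients and,
  as \<open>small_to_bar\<close> is a chain map without redundant coefficients, no redundant ones in its
  boundary. Hence it is zero.\<close>

lemma reduce_to_small:
  assumes c: "c \<in> free_space r"
    and bdc: "\<And>r' i. r = Suc r' \<Longrightarrow> i \<in> cells r' \<Longrightarrow> redundant n (tl i) \<Longrightarrow>
      Theta i (bd r c) \<in> N (sum_list i)"
  shows "\<exists>y. \<exists>c'\<in>free_space (Suc r). chain_cong r c (bd (Suc r) c' + small_to_bar r y)"
proof -
  obtain c' where c': "c' \<in> free_space (Suc r)"
    "\<And>i. i \<in> cells r \<Longrightarrow> redundant n (tl i) \<Longrightarrow> Theta i (bd (Suc r) c' - c) \<in> N (sum_list i)"
    using eliminate_redundant[OF c] by blast
  define y where "y = Theta (crit_index r) (c - bd (Suc r) c')"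
  define d where "d = c - bd (Suc r) c' - small_to_bar r y"
  have d: "d \<in> free_space r"
    unfolding d_def
    by (intro free.subspace_diff[OF free_space_subspace] c small_to_bar_free bd_free[OF c'(1)])
  have nc: "Theta i d \<in> N (sum_list i)" if i: "i \<in> cells r" "\<not> collapsible n (tl i)" for i
  proof (cases "redundant n (tl i)")
    case True
    have "Theta i d = - Theta i (bd (Suc r) c' - c)"
      using Theta_small_to_bar_redundant[OF i(1) True] by (simp add: d_def Theta.diff)
    then show ?thesis using c'(2)[OF i(1) True] N_neg by simp
  next
    case False
    obtain e u where eu: "i = e # u" "e < n" "length u = r" "set u \<subseteq> {1..<n}"
      using i(1) by (rule cells_cases)
    have u: "u = critical n r" using critical_cases[of u n] eu i False by simp
    show ?thesis
    proof (cases "i = crit_index r")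
      case True
      then show ?thesis by (simp add: d_def Theta.diff Theta_small_to_bar_critical y_def N_zero)
    next
      case False
\<comment> \<open>Any other first exponent makes the twist indivisible by \<open>n\<close>, and there is no coefficient.\<close>
      then have ne: "e \<noteq> (if even r then 0 else n - 1)" using u eu by (auto simp: crit_index_def)
      have "sum_list i = (r div 2) * n + (e + r mod 2)" using u eu by (simp add: sum_critical)
      moreover have "\<not> n dvd e + r mod 2"
      proof
        assume dv: "n dvd e + r mod 2"
        show False
        proof (cases "even r")
          case True
          then show ?thesis using dv ne eu nat_dvd_not_less[of e n] by (auto simp: even_iff_mod_2_eq_zero)
        next
          case False
          then have "n dvd Suc e" using dv by (simp add: odd_iff_mod_2_eq_one)
          then have "n \<le> Suc e" by (rule dvd_imp_le) simp
          then show ?thesis using False ne eu by simp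
        qed
      qed
      ultimately have "\<not> n dvd sum_list i" by (metis dvd_add_right_iff dvd_triv_right)
      then show ?thesis by (rule N_trivial)
    qed
  qed
  have "d \<in> R r"
  proof (cases r)
    case 0
    have "\<not> collapsible n (tl i)" if "i \<in> cells r" for i
      using that 0 by (auto elim!: cells_cases)
    then show ?thesis using R_if_Theta[OF d] nc by blast
  next
    case (Suc r')
    have "bd (Suc r') d = bd r c - bd r (small_to_bar r y)"
      using bd_bd[of c' r'] c'(1) by (simp add: d_def bd.diff Suc)
    moreover have "Theta i (bd r (small_to_bar r y)) \<in> N (sum_list i)"
      if i: "i \<in> cells r'" "redundant n (tl i)" for i
    proof -
      have "Theta i (bd r (small_to_bar r y) - small_to_bar r' (small_d r y)) \<in> N (sum_list i)"
        using chain_map[of r' y] Theta_R[OF _ i(1)] by (simp add: Suc chain_cong_def)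
      then show ?thesis using Theta_small_to_bar_redundant[OF i] by (simp add: Theta.diff)
    qed
    ultimately have "Theta i (bd (Suc r') d) \<in> N (sum_list i)"
      if "i \<in> cells r'" "redundant n (tl i)" for i
      using that bdc[OF Suc that] N_diff by (simp add: Theta.diff)
    then show ?thesis using noncollapsible_determine[of d r'] d nc by (simp add: Suc)
  qed
  then have "chain_cong r c (bd (Suc r) c' + small_to_bar r y)"
    by (simp add: d_def chain_cong_def diff_diff_eq)
  then show ?thesis using c'(1) by blast
qed

lemma small_to_bar_onto:
  assumes c: "c \<in> free_space r" and cyc: "r = 0 \<or> bd r c \<in> R (r - 1)"
  shows "\<exists>y. \<exists>c'\<in>free_space (Suc r). chain_cong r c (bd (Suc r) c' + small_to_bar r y) \<and>
    (r = 0 \<or> small_d r y \<in> N (tw (r - 1)))"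
proof -
  obtain y c' where yc: "c' \<in> free_space (Suc r)" "chain_cong r c (bd (Suc r) c' + small_to_bar r y)"
    using reduce_to_small[OF c] cyc Theta_R by fastforce
  have "small_d r y \<in> N (tw r')" if Suc: "r = Suc r'" for r'
  proof -
    have "c - (bd (Suc r) c' + small_to_bar r y) \<in> R (Suc r')"
      using yc(2) Suc by (simp add: chain_cong_def)
    from bd_R[OF this] have "bd r c - bd r (small_to_bar r y) \<in> R r'"
      using bd_bd[of c' r'] yc(1) by (simp add: bd.diff bd.add Suc)
    then have "bd r (small_to_bar r y) \<in> R r'"
      using cyc Suc R_diff[of "bd r c" r' "bd r c - bd r (small_to_bar r y)"] by simp
    then have "small_to_bar r' (small_d r y) \<in> R r'"
      using chain_map[of r' y] cong_trans[OF cong_sym] Suc by (metis cong_zero_iff)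
    from Theta_R[OF this crit_index_cells] show ?thesis
      by (simp add: Theta_small_to_bar_critical sum_crit_index)
  qed
  then show ?thesis using yc by (cases r) auto
qed

text \<open>Reducing \<open>w\<close> itself to a value of \<open>small_to_bar\<close> changes it by a boundary only, because its
  boundary has no redundant coefficients.\<close>

lemma small_to_bar_boundary:
  assumes w: "w \<in> free_space (Suc r)" and bw: "chain_cong r (small_to_bar r y) (bd (Suc r) w)"
  shows "\<exists>z. y - small_d (Suc r) z \<in> N (tw r)"
proof -
  have "Theta i (bd (Suc r) w) \<in> N (sum_list i)" if "i \<in> cells r" "redundant n (tl i)" for i
    using Theta_R[OF _ that(1)] cong_sym[OF bw] Theta_small_to_bar_redundant[OF that]
    unfolding chain_cong_def by (metis Theta.diff diff_zero)
  then obtain z c' where zc: "c' \<in> free_space (Suc (Suc r))"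
    "chain_cong (Suc r) w (bd (Suc (Suc r)) c' + small_to_bar (Suc r) z)"
    using reduce_to_small[OF w] by blast
  have "chain_cong r (bd (Suc r) w) (bd (Suc r) (bd (Suc (Suc r)) c' + small_to_bar (Suc r) z))"
    using bd_R zc(2) unfolding chain_cong_def bd.diff[symmetric] by blast
  also have "\<dots> = bd (Suc r) (small_to_bar (Suc r) z)"
    using bd_bd[OF zc(1)] by (simp add: bd.add)
  also have "chain_cong r \<dots> (small_to_bar r (small_d (Suc r) z))" by (rule chain_map)
  finally have "chain_cong r (small_to_bar r y) (small_to_bar r (small_d (Suc r) z))"
    by (rule cong_trans[OF bw])
  then have "Theta (crit_index r) (small_to_bar r y - small_to_bar r (small_d (Suc r) z)) \<in> N (tw r)"
    using Theta_R[OF _ crit_index_cells] by (simp add: chain_cong_def sum_crit_index)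
  then show ?thesis by (auto simp: Theta.diff Theta_small_to_bar_critical)
qed

lemma small_to_bar_of_boundary:
  assumes "y - small_d (Suc r) z \<in> N (tw r)"
  shows "chain_cong r (small_to_bar r y) (bd (Suc r) (small_to_bar (Suc r) z))"
proof -
  have "chain_cong r (small_to_bar r ((y - small_d (Suc r) z) + small_d (Suc r) z))
     (small_to_bar r (y - small_d (Suc r) z) + small_to_bar r (small_d (Suc r) z))"
    by (rule small_to_bar_add)
  also have "chain_cong r \<dots> (0 + bd (Suc r) (small_to_bar (Suc r) z))"
    using small_to_bar_N[OF assms] by (intro cong_add cong_sym[OF chain_map]) (simp add: cong_zero_iff)
  finally show ?thesis by simp
qed

end

section \<open>Eigenspace decomposition\<close>

context twisted_algebra
begin

abbreviation "Eig \<equiv> eigenspace scale \<alpha>"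

lemma Eig_subspace: "subspace (Eig c)"
  unfolding subspace_def eigenspace_def
  by (auto simp: al.add al.scale al.zero scale_right_distrib scale_left_commute)

lemma Eig_pow: "v \<in> Eig c \<Longrightarrow> (\<alpha> ^^ l) v = scale (c ^ l) v"
  by (induction l) (auto simp: eigenspace_def al.scale mult.commute)

text \<open>
  Subtracting \<open>\<omega> g\<close> times a sum of eigenvectors from its image under \<open>\<alpha>\<close> removes the summand for \<open>g\<close>
  and rescales the others by nonzero factors. Taking \<open>U = {0}\<close> shows that eigencomponents are unique.
\<close>

lemma stable_subspace_components:
  assumes "finite H" "inj_on \<omega> H" "subspace U" "\<And>v. v \<in> U \<Longrightarrow> \<alpha> v \<in> U"
    and "\<And>h. h \<in> H \<Longrightarrow> f h \<in> Eig (\<omega> h)" "(\<Sum>h\<in>H. f h) \<in> U"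
  shows "\<forall>h\<in>H. f h \<in> U"
  using assms(1,2,5,6)
proof (induction H arbitrary: f)
  case (insert g H)
  let ?S = "\<Sum>h\<in>insert g H. f h"
  have "(\<Sum>h\<in>H. scale (\<omega> h - \<omega> g) (f h)) = \<alpha> ?S - scale (\<omega> g) ?S"
  proof -
    have "\<alpha> ?S = (\<Sum>h\<in>insert g H. scale (\<omega> h) (f h))"
      unfolding al.sum using insert.prems(2) by (intro sum.cong) (auto simp: eigenspace_def)
    then have "\<alpha> ?S - scale (\<omega> g) ?S = (\<Sum>h\<in>insert g H. scale (\<omega> h - \<omega> g) (f h))"
      by (simp only: scale_sum_right sum_subtractf[symmetric] scale_left_diff_distrib)
    then show ?thesis using insert.hyps by simp
  qed
  also have "\<dots> \<in> U"
    using assms(3,4) insert.prems(3) by (intro subspace_diff subspace_scale) auto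
  finally have "\<forall>h\<in>H. scale (\<omega> h - \<omega> g) (f h) \<in> U"
    using insert.prems by (intro insert.IH) (auto intro: subspace_scale[OF Eig_subspace])
  moreover have "\<omega> h - \<omega> g \<noteq> 0" if "h \<in> H" for h
    using insert.prems(1) insert.hyps that by (auto simp: inj_on_def)
  ultimately have H: "f h \<in> U" if "h \<in> H" for h
    using subspace_scale[OF assms(3), of "scale (\<omega> h - \<omega> g) (f h)" "inverse (\<omega> h - \<omega> g)"] that by simp
  have "f g = ?S - (\<Sum>h\<in>H. f h)" using insert.hyps by simp
  also have "\<dots> \<in> U"
    by (rule subspace_diff[OF assms(3) insert.prems(3) subspace_sum[OF assms(3)]]) (rule H)
  finally show ?case using H by simp
qed simp

end

locale diagonal_algebra = twisted_algebra scale \<alpha>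
  for scale :: "'k::field \<Rightarrow> 'a::ring_1 \<Rightarrow> 'a" and \<alpha> +
  fixes s :: nat and \<omega> :: "nat \<Rightarrow> 'k"
  assumes diag: "diagonalizable scale \<alpha>"
    and eigenvals: "eigenvalues scale \<alpha> = \<omega> ` {1..s}"
    and distinct: "inj_on \<omega> {1..s}"
begin

lemma eigen_decomposition: "\<exists>f. (\<forall>h\<in>{1..s}. f h \<in> Eig (\<omega> h)) \<and> v = (\<Sum>h\<in>{1..s}. f h)"
proof -
  obtain E where E: "\<not> dependent E" "span E = UNIV" "\<forall>v\<in>E. \<exists>c. \<alpha> v = scale c v"
    using diag by (auto simp: diagonalizable_def)
  have "v \<in> span E" using E by simp
  then show ?thesis
  proof (induction rule: span_induct_alt)
    case base
    show ?case by (rule exI[of _ "\<lambda>_. 0"]) (auto intro: subspace_0[OF Eig_subspace])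
  next
    case (step c x y)
    obtain f where f: "\<forall>h\<in>{1..s}. f h \<in> Eig (\<omega> h)" "y = (\<Sum>h\<in>{1..s}. f h)" using step by blast
    have "x \<noteq> 0" using step(1) E(1) dependent_zero by blast
    moreover obtain k where k: "\<alpha> x = scale k x" using E(3) step(1) by blast
    ultimately have "k \<in> eigenvalues scale \<alpha>" by (auto simp: eigenvalues_def)
    then obtain g where g: "g \<in> {1..s}" "k = \<omega> g" using eigenvals by auto
    have "x \<in> Eig (\<omega> g)" using k g by (simp add: eigenspace_def)
    then have "\<forall>h\<in>{1..s}. (if h = g then scale c x else 0) + f h \<in> Eig (\<omega> h)"
      using f by (auto intro!: subspace_add[OF Eig_subspace] subspace_scale[OF Eig_subspace])
    moreover have "scale c x + y = (\<Sum>h\<in>{1..s}. (if h = g then scale c x else 0) + f h)"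
      using g f by (simp add: sum.distrib)
    ultimately show ?case
      by (intro exI[of _ "\<lambda>h. (if h = g then scale c x else 0) + f h"] conjI)
  qed
qed

definition component :: "nat \<Rightarrow> 'a \<Rightarrow> 'a" where
  "component h v = (SOME f. (\<forall>h\<in>{1..s}. f h \<in> Eig (\<omega> h)) \<and> v = (\<Sum>h\<in>{1..s}. f h)) h"

lemma component_eig: "h \<in> {1..s} \<Longrightarrow> component h v \<in> Eig (\<omega> h)"
  and component_sum: "(\<Sum>h\<in>{1..s}. component h v) = v"
  using someI_ex[OF eigen_decomposition[of v]] by (auto simp: component_def)

lemma component_unique:
  assumes "\<And>h. h \<in> {1..s} \<Longrightarrow> f h \<in> Eig (\<omega> h)" "v = (\<Sum>h\<in>{1..s}. f h)" "h \<in> {1..s}"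
  shows "component h v = f h"
proof -
  have "\<forall>h\<in>{1..s}. component h v - f h \<in> {0}"
  proof (rule stable_subspace_components[OF _ distinct])
    show "(\<Sum>h\<in>{1..s}. component h v - f h) \<in> {0}"
      using assms(2) component_sum[of v] by (simp add: sum_subtractf)
  qed (auto simp: al.zero intro!: subspace_diff[OF Eig_subspace] component_eig assms(1))
  then show ?thesis using assms(3) by simp
qed

lemma component_linear: "h \<in> {1..s} \<Longrightarrow> Vector_Spaces.linear scale scale (component h)"
proof (intro Vector_Spaces.linear.intro module_hom.intro module_hom_axioms.intro)
  assume h: "h \<in> {1..s}"
  fix v w c
  show "component h (v + w) = component h v + component h w"
    using h by (intro component_unique)
      (auto simp: sum.distrib component_sum simp del: One_nat_def intro!: subspace_add[OF Eig_subspace] component_eig)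
  show "component h (scale c v) = scale c (component h v)"
    using h by (intro component_unique)
      (auto simp: scale_sum_right[symmetric] component_sum simp del: One_nat_def intro!: subspace_scale[OF Eig_subspace] component_eig)
qed (simp_all add: vector_space_axioms module_axioms)

lemma component_stable:
  assumes "subspace U" "\<And>v. v \<in> U \<Longrightarrow> \<alpha> v \<in> U"
  shows "v \<in> U \<longleftrightarrow> (\<forall>h\<in>{1..s}. component h v \<in> U)"
proof
  assume "v \<in> U"
  then show "\<forall>h\<in>{1..s}. component h v \<in> U"
    by (intro stable_subspace_components[OF _ distinct assms])
      (simp_all only: finite_atLeastAtMost component_eig component_sum)
next
  assume "\<forall>h\<in>{1..s}. component h v \<in> U"
  then have "(\<Sum>h\<in>{1..s}. component h v) \<in> U" using assms(1) by (intro subspace_sum) auto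
  then show "v \<in> U" by (simp only: component_sum)
qed

end

text \<open>The Frobenius map of a field is injective.\<close>

lemma power_char_eq_1:
  fixes x :: "'k::field"
  assumes p: "prime CHAR('k)" and x: "x ^ CHAR('k) = 1"
  shows "x = 1"
proof -
  have "((x - 1) + 1) ^ CHAR('k) = (x - 1) ^ CHAR('k) + 1 ^ CHAR('k)"
    using p by (rule freshmans_dream) simp
  then have "(x - 1) ^ CHAR('k) = 0" using x by simp
  then show ?thesis by simp
qed

locale diagonal_monogenic = monogenic scale \<alpha> n lam + diagonal_algebra scale \<alpha> s \<omega>
  for scale :: "'k::field \<Rightarrow> 'a::ring_1 \<Rightarrow> 'a" and \<alpha> n lam s \<omega>
begin

text \<open>Otherwise \<open>n = p m\<close> for the characteristic \<open>p\<close>. The eigenvalues that occur in \<open>z\<close> satisfy \<open>\<omega>\<^sup>n = 1\<close>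
  and therefore already \<open>\<omega>\<^sup>m = 1\<close>, so that \<open>\<alpha>\<^sup>m\<close> fixes \<open>z\<close>, although \<open>z - \<alpha>\<^sup>m(z)\<close> is invertible.\<close>

lemma n_nonzero: "of_nat n \<noteq> (0 :: 'k)"
proof
  assume "of_nat n = (0 :: 'k)"
  then have dvd: "CHAR('k) dvd n" by (simp add: of_nat_eq_0_iff_char_dvd)
  then have "CHAR('k) > 0" using n_ge_2 by (intro gr0I) auto
  then have p: "prime CHAR('k)" by (rule prime_CHAR_semidom)
  obtain m where m: "n = CHAR('k) * m" using dvd by blast
  have "m > 0" using m n_ge_2 by (intro gr0I) auto
  then have "1 \<le> m" "m < n" using m prime_gt_1_nat[OF p] by auto
  moreover obtain z where z: "(\<alpha> ^^ n) z = z"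
    "\<And>i. 1 \<le> i \<Longrightarrow> i < n \<Longrightarrow> invertible_element (z - (\<alpha> ^^ i) z)"
    using breve by blast
  ultimately have inv: "invertible_element (z - (\<alpha> ^^ m) z)" by blast
  have "(\<alpha> ^^ m) (component h z) = component h z" if h: "h \<in> {1..s}" for h
  proof (cases "component h z = 0")
    case False
    have sum: "(\<Sum>h\<in>{1..s}. (\<alpha> ^^ n) (component h z)) = z"
      using z(1) component_sum[of z] by (simp add: pow_sum[symmetric])
    have "component h z = (\<alpha> ^^ n) (component h z)"
      using h sum by (intro component_unique)
        (auto simp: Eig_pow[OF component_eig] intro!: subspace_scale[OF Eig_subspace] component_eig)
    then have "scale (\<omega> h ^ n) (component h z) = scale 1 (component h z)"
      using Eig_pow[OF component_eig[OF h]] by simp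
    then have "\<omega> h ^ n = 1" using False by (simp only: scale_cancel_right simp_thms)
    then have "(\<omega> h ^ m) ^ CHAR('k) = 1"
      unfolding m by (simp add: power_mult[symmetric] mult.commute)
    then have "\<omega> h ^ m = 1" by (rule power_char_eq_1[OF p])
    then show ?thesis using Eig_pow[OF component_eig[OF h]] by simp
  qed simp
  then have "(\<Sum>h\<in>{1..s}. (\<alpha> ^^ m) (component h z)) = (\<Sum>h\<in>{1..s}. component h z)" by simp
  then have "(\<alpha> ^^ m) z = z" by (simp only: pow_sum[symmetric] component_sum)
  then show False using inv by (simp add: invertible_element_def)
qed

subsection \<open>The eigenspace complexes\<close>

abbreviation eig_map :: "'k \<Rightarrow> nat \<Rightarrow> 'a \<Rightarrow> 'a" where
  "eig_map c r \<equiv> (if even r then (\<lambda>y. scale (\<Sum>l<n. c ^ l) y) else (\<lambda>y. scale (c - 1) (y * lam n)))"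

lemma eig_map_linear: "Vector_Spaces.linear scale scale (eig_map c r)"
proof (intro Vector_Spaces.linear.intro module_hom.intro module_hom_axioms.intro)
  fix x y k
  show "eig_map c r (x + y) = eig_map c r x + eig_map c r y"
    by (simp add: scale_right_distrib distrib_right)
  show "eig_map c r (scale k x) = scale k (eig_map c r x)"
    by (simp add: scale_mult_left mult.commute)
qed (simp_all add: vector_space_axioms module_axioms)

lemma small_d_eig: "y \<in> Eig c \<Longrightarrow> small_d r y = eig_map c r y"
proof -
  assume y: "y \<in> Eig c"
  have "\<alpha> y = scale c y" using y by (simp add: eigenspace_def)
  then show ?thesis
    by (simp add: small_d_def Eig_pow[OF y] scale_sum_left scale_mult_left scale_left_diff_distrib
        left_diff_distrib)
qed

lemma lam_n_fixed: "\<alpha> (lam n) = lam n"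
  using lam_fixed n_ge_2 by simp

lemma eig_map_Eig: "y \<in> Eig c \<Longrightarrow> eig_map c r y \<in> Eig c"
  by (auto simp: eigenspace_def al.scale lam_n_fixed scale_mult_left mult.commute)

lemma tw_simps: "tw (2 * m) = m * n" "tw (Suc (2 * m)) = Suc m * n"
  by (simp_all add: eigen_twist_def)

lemma N_lam: "v \<in> N (j + n) \<Longrightarrow> v * lam n \<in> N j"
  using N_neg[OF N_q, of v j] by (simp add: q_def)

lemma eig_map_N: "v \<in> N (tw (Suc r)) \<Longrightarrow> eig_map c (Suc r) v \<in> N (tw r)"
proof (cases "even r")
  case True
  assume v: "v \<in> N (tw (Suc r))"
  obtain m where m: "r = 2 * m" using True by (elim evenE)
  have "v * lam n \<in> N (tw r)" using v N_lam[of v "m * n"] by (simp add: m tw_simps add.commute)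
  then show ?thesis using True N_scale by simp
next
  case False
  assume v: "v \<in> N (tw (Suc r))"
  obtain m where m: "r = Suc (2 * m)" using False by (elim oddE) simp
  then have "tw (Suc r) = tw r" using tw_simps(1)[of "Suc m"] tw_simps(2)[of m] by simp
  then show ?thesis using v False N_scale by simp
qed

abbreviation "Zc c r \<equiv> {y \<in> Eig c. r = 0 \<or> eig_map c r y \<in> N (tw (r - 1))}"
abbreviation "Bc c r \<equiv> {eig_map c (Suc r) y + v |y v. y \<in> Eig c \<and> v \<in> Eig c \<and> v \<in> N (tw r)}"

lemma eigen_HH_presents:
  "presents (eigen_HH scale \<alpha> n lam c r) scale (Zc c r) (Bc c r) (eigen_class scale \<alpha> n lam c r)"
proof -
  let ?M = "\<lambda>i. Eig c \<inter> N (tw i)"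
  have "presents (homology_module (eigen_chains scale \<alpha> n c) (eigen_boundary scale \<alpha> n lam c) r) scale
      {x \<in> Eig c. r = 0 \<or> eig_map c r x \<in> ?M (r - 1)}
      {b + v |b v. b \<in> eig_map c (Suc r) ` Eig c \<and> v \<in> ?M r}
      (\<lambda>x. boundaries (eigen_chains scale \<alpha> n c) (eigen_boundary scale \<alpha> n lam c) r
        +>\<^bsub>eigen_chains scale \<alpha> n c r\<^esub> (?M r +>\<^bsub>subspace_module scale (Eig c)\<^esub> x))"
  proof (rule presents_homology)
    show "subspace (Eig c)" by (rule Eig_subspace)
    show "subspace (?M i)" for i by (rule subspace_inter[OF Eig_subspace N_subspace])
    show "Vector_Spaces.linear scale scale (eig_map c i)" for i by (rule eig_map_linear)
    show "eig_map c (Suc i) ` Eig c \<subseteq> Eig c" for i using eig_map_Eig by blast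
    show "eig_map c (Suc i) ` ?M (Suc i) \<subseteq> ?M i" for i using eig_map_Eig eig_map_N by blast
    show "eigen_chains scale \<alpha> n c i = quotient_module (subspace_module scale (Eig c)) (?M i)" for i
      by (simp add: eigen_chains_def eigen_commutators_def)
    show "eigen_boundary scale \<alpha> n lam c i
        = induced_map (subspace_module scale (Eig c)) (?M (i - 1)) (eig_map c i)" for i
      by (simp add: eigen_boundary_def eigen_commutators_def fun_eq_iff)
  qed simp
  moreover have "{x \<in> Eig c. r = 0 \<or> eig_map c r x \<in> ?M (r - 1)} = Zc c r"
    using eig_map_Eig by blast
  moreover have "{b + v |b v. b \<in> eig_map c (Suc r) ` Eig c \<and> v \<in> ?M r} = Bc c r" by blast
  ultimately show ?thesis
    by (simp only: eigen_HH_def eigen_class_def[abs_def] eigen_commutators_def)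
qed

lemma eigen_HH_equalsI:
  assumes "Zc c r = Z" "Bc c r = B" "B \<subseteq> Z"
  shows "eigen_HH_equals scale \<alpha> n lam c r Z B"
proof -
  have P: "presents (eigen_HH scale \<alpha> n lam c r) scale Z B (eigen_class scale \<alpha> n lam c r)"
    using eigen_HH_presents[of c r] assms by simp
  then have sub: "subspace Z" "subspace B" by (auto simp: presents_def)
  have "\<exists>\<phi>. module_isomorphism (eigen_HH scale \<alpha> n lam c r) (quotient_module (subspace_module scale Z) B) \<phi> \<and>
    (\<forall>y\<in>Z. \<phi> (eigen_class scale \<alpha> n lam c r y) = B +>\<^bsub>subspace_module scale Z\<^esub> y)"
    using presents_isomorphic[OF P presents_quotient_subspace[OF sub assms(3)] vector_space_axioms
        vector_space_axioms, of "\<lambda>x. x"] subspace_0[OF sub(2)] by force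
  then show ?thesis using assms(3) by (simp add: eigen_HH_equals_def)
qed

lemma eigen_HH_zeroI:
  assumes "Zc c r \<subseteq> Bc c r"
  shows "module_is_zero (eigen_HH scale \<alpha> n lam c r)"
  using vector_space_axioms eigen_HH_presents assms by (rule presents_zero)

lemma geometric: "(\<Sum>l<n. c ^ l) * (c - 1) = c ^ n - (1 :: 'k)"
  using power_diff_1_eq[of c n] by (simp add: mult.commute)

text \<open>For \<open>c = 1\<close> the sum is \<open>n\<close>. When it is invertible, everything in odd degrees is a boundary and
  only zero is a cycle in positive even degrees, up to twisted commutators.\<close>

lemma geometric_nonzero: "\<not> (c \<noteq> 1 \<and> c ^ n = 1) \<Longrightarrow> (\<Sum>l<n. c ^ l) \<noteq> (0 :: 'k)"
  using geometric[of c] n_nonzero by (cases "c = 1") auto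

lemma Eig_lam: "y \<in> Eig c \<Longrightarrow> y * lam n \<in> Eig c"
  by (auto simp: eigenspace_def lam_n_fixed scale_mult_left)

text \<open>The factor \<open>c - 1\<close> of the boundary is invertible and can be absorbed.\<close>

lemma Bc_even:
  assumes "c \<noteq> 1" "even r"
  shows "Bc c r = {u + y * lam n |u y. u \<in> eigen_commutators scale \<alpha> c (tw r) \<and> y \<in> Eig c}"
proof (intro equalityI subsetI)
  fix x assume "x \<in> Bc c r"
  then obtain y v where yv: "x = scale (c - 1) (y * lam n) + v" "y \<in> Eig c" "v \<in> Eig c" "v \<in> N (tw r)"
    using assms by auto
  have "x = v + scale (c - 1) y * lam n" using yv by (simp add: scale_mult_left)
  then show "x \<in> {u + y * lam n |u y. u \<in> eigen_commutators scale \<alpha> c (tw r) \<and> y \<in> Eig c}"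
    using yv subspace_scale[OF Eig_subspace] unfolding eigen_commutators_def by blast
next
  fix x assume "x \<in> {u + y * lam n |u y. u \<in> eigen_commutators scale \<alpha> c (tw r) \<and> y \<in> Eig c}"
  then obtain u y where uy: "x = u + y * lam n" "u \<in> Eig c" "u \<in> N (tw r)" "y \<in> Eig c"
    by (auto simp: eigen_commutators_def)
  have "x = eig_map c (Suc r) (scale (inverse (c - 1)) y) + u"
    using uy assms by (simp add: scale_mult_left)
  then show "x \<in> Bc c r" using uy subspace_scale[OF Eig_subspace] by blast
qed

lemma HH_0: "if c = 1 then eigen_HH_equals scale \<alpha> n lam c 0 (Eig 1) (eigen_commutators scale \<alpha> 1 0)
   else eigen_HH_equals scale \<alpha> n lam c 0 (Eig c)
     {u + y * lam n |u y. u \<in> eigen_commutators scale \<alpha> c 0 \<and> y \<in> Eig c}"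
proof (cases "c = 1")
  case True
  have "Bc 1 0 = eigen_commutators scale \<alpha> 1 0"
    using subspace_0[OF Eig_subspace[of 1]] by (auto simp: eigen_commutators_def eigen_twist_def)
  then have "eigen_HH_equals scale \<alpha> n lam 1 0 (Eig 1) (eigen_commutators scale \<alpha> 1 0)"
    by (intro eigen_HH_equalsI) (auto simp: eigen_commutators_def)
  then show ?thesis using True by simp
next
  case False
  have "eigen_HH_equals scale \<alpha> n lam c 0 (Eig c)
     {u + y * lam n |u y. u \<in> eigen_commutators scale \<alpha> c 0 \<and> y \<in> Eig c}"
    using Bc_even[OF False, of 0]
    by (intro eigen_HH_equalsI)
      (auto simp: eigen_commutators_def eigen_twist_def intro!: subspace_add[OF Eig_subspace] Eig_lam)
  then show ?thesis using False by simp
qed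

lemma HH_odd: "if c \<noteq> 1 \<and> c ^ n = 1
   then eigen_HH_equals scale \<alpha> n lam c (2 * m + 1)
     {y \<in> Eig c. y * lam n \<in> eigen_commutators scale \<alpha> c (m * n)}
     (eigen_commutators scale \<alpha> c ((m + 1) * n))
   else module_is_zero (eigen_HH scale \<alpha> n lam c (2 * m + 1))"
proof -
  have tw: "tw (2 * m + 1) = (m + 1) * n" "tw (2 * m + 1 - 1) = m * n"
    using tw_simps by auto
  show ?thesis
  proof (cases "c \<noteq> 1 \<and> c ^ n = 1")
    case True
    then have sum0: "(\<Sum>l<n. c ^ l) = 0" using geometric[of c] by simp
    have Z: "Zc c (2 * m + 1) = {y \<in> Eig c. y * lam n \<in> eigen_commutators scale \<alpha> c (m * n)}"
    proof -
      have key: "scale (c - 1) (y * lam n) \<in> N (m * n) \<longleftrightarrow> y * lam n \<in> N (m * n)" for y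
        using N_scale[of "scale (c - 1) (y * lam n)" "m * n" "inverse (c - 1)"]
          N_scale[of "y * lam n" "m * n" "c - 1"] True by auto
      show ?thesis
        by (rule Collect_cong) (simp add: tw_simps key Eig_lam eigen_commutators_def cong: conj_cong)
    qed
    have B: "Bc c (2 * m + 1) = eigen_commutators scale \<alpha> c ((m + 1) * n)"
      using subspace_0[OF Eig_subspace[of c]] by (auto simp: tw_simps sum0 eigen_commutators_def)
    have "eigen_commutators scale \<alpha> c ((m + 1) * n) \<subseteq> {y \<in> Eig c. y * lam n \<in> eigen_commutators scale \<alpha> c (m * n)}"
      using N_lam[of _ "m * n"] by (auto simp: eigen_commutators_def Eig_lam add.commute)
    then show ?thesis using eigen_HH_equalsI[OF Z B] True by simp
  next
    case False
    note sum = geometric_nonzero[OF False]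
    have "Zc c (2 * m + 1) \<subseteq> Bc c (2 * m + 1)"
    proof
      fix x assume "x \<in> Zc c (2 * m + 1)"
      then have x: "x \<in> Eig c" by simp
      have "x = eig_map c (Suc (2 * m + 1)) (scale (inverse (\<Sum>l<n. c ^ l)) x) + 0"
        using sum by simp
      then show "x \<in> Bc c (2 * m + 1)"
        using subspace_scale[OF Eig_subspace x] subspace_0[OF Eig_subspace] N_zero by blast
    qed
    from eigen_HH_zeroI[OF this] show ?thesis by (simp only: False if_False)
  qed
qed

lemma HH_even: "if c \<noteq> 1 \<and> c ^ n = 1
   then eigen_HH_equals scale \<alpha> n lam c (2 * m + 2) (Eig c)
     {u + y * lam n |u y. u \<in> eigen_commutators scale \<alpha> c ((m + 1) * n) \<and> y \<in> Eig c}
   else module_is_zero (eigen_HH scale \<alpha> n lam c (2 * m + 2))"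
proof -
  have tw: "tw (2 * m + 2) = (m + 1) * n" "tw (2 * m + 2 - 1) = (m + 1) * n"
    using tw_simps[of "m + 1"] tw_simps[of m] by auto
  show ?thesis
  proof (cases "c \<noteq> 1 \<and> c ^ n = 1")
    case True
    then have sum0: "(\<Sum>l<n. c ^ l) = 0" using geometric[of c] by simp
    have Z: "Zc c (2 * m + 2) = Eig c" by (simp add: sum0 N_zero)
    have "{u + y * lam n |u y. u \<in> eigen_commutators scale \<alpha> c ((m + 1) * n) \<and> y \<in> Eig c} \<subseteq> Eig c"
      by (auto simp: eigen_commutators_def intro!: subspace_add[OF Eig_subspace] Eig_lam)
    then show ?thesis
      using eigen_HH_equalsI[OF Z Bc_even[of c "2 * m + 2"]] True tw by simp
  next
    case False
    note sum = geometric_nonzero[OF False]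
    have "Zc c (2 * m + 2) \<subseteq> Bc c (2 * m + 2)"
    proof
      fix x assume "x \<in> Zc c (2 * m + 2)"
      then have x: "x \<in> Eig c" "scale (\<Sum>l<n. c ^ l) x \<in> N (tw (2 * m + 2))" using tw by auto
      then have "x \<in> N (tw (2 * m + 2))"
        using N_scale[OF x(2), of "inverse (\<Sum>l<n. c ^ l)"] sum by simp
      moreover have "x = eig_map c (Suc (2 * m + 2)) 0 + x" by simp
      ultimately show "x \<in> Bc c (2 * m + 2)" using x(1) subspace_0[OF Eig_subspace] by blast
    qed
    from eigen_HH_zeroI[OF this] show ?thesis by (simp only: False if_False)
  qed
qed

subsection \<open>Assembling the eigenspaces\<close>

lemma small_d_linear: "Vector_Spaces.linear scale scale (small_d r)"
proof (intro Vector_Spaces.linear.intro module_hom.intro module_hom_axioms.intro)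
  fix x y k
  show "small_d r (x + y) = small_d r x + small_d r y"
    by (simp add: small_d_def sum.distrib al.add left_diff_distrib distrib_right)
  show "small_d r (scale k x) = scale k (small_d r x)"
    by (simp add: small_d_def scale_sum_right al.scale scale_right_diff_distrib[symmetric] scale_mult_left)
qed (simp_all add: vector_space_axioms module_axioms)

lemma small_d_component:
  assumes h: "h \<in> {1..s}"
  shows "component h (small_d r y) = eig_map (\<omega> h) r (component h y)"
proof -
  interpret d: Vector_Spaces.linear scale scale "small_d r" by (rule small_d_linear)
  show ?thesis
  proof (rule component_unique)
    show "small_d r y = (\<Sum>h\<in>{1..s}. eig_map (\<omega> h) r (component h y))"
    proof -
      have "small_d r (\<Sum>h\<in>{1..s}. component h y) = (\<Sum>h\<in>{1..s}. eig_map (\<omega> h) r (component h y))"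
        unfolding d.sum by (intro sum.cong refl small_d_eig component_eig)
      then show ?thesis by (simp only: component_sum)
    qed
  qed (use h component_eig eig_map_Eig in blast)+
qed

lemma N_component: "v \<in> N j \<longleftrightarrow> (\<forall>h\<in>{1..s}. component h v \<in> N j)"
  by (rule component_stable[OF N_subspace]) (drule N_pow[of _ _ 1], simp)

abbreviation "Zs r \<equiv> {y. r = 0 \<or> small_d r y \<in> N (tw (r - 1))}"
abbreviation "Bs r \<equiv> {y. \<exists>z. y - small_d (Suc r) z \<in> N (tw r)}"

text \<open>Twisted commutators are stable under \<open>\<alpha>\<close> and the boundaries commute with taking
  eigencomponents, so cycles and boundaries of the small complex can be tested in each
  eigenspace separately.\<close>

lemma direct_sum_presents:
  "presents (direct_sum_module {1..s} (\<lambda>h. eigen_HH scale \<alpha> n lam (\<omega> h) r)) scale (Zs r) (Bs r)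
     (\<lambda>y. \<lambda>h\<in>{1..s}. eigen_class scale \<alpha> n lam (\<omega> h) r (component h y))"
proof (rule presents_direct_sum[where Zh = "\<lambda>h. Zc (\<omega> h) r" and Bh = "\<lambda>h. Bc (\<omega> h) r"])
  interpret d: Vector_Spaces.linear scale scale "small_d i" for i by (rule small_d_linear)
  show "vector_space scale" by (rule vector_space_axioms)
  show "presents (eigen_HH scale \<alpha> n lam (\<omega> h) r) scale (Zc (\<omega> h) r) (Bc (\<omega> h) r)
    (eigen_class scale \<alpha> n lam (\<omega> h) r)" for h by (rule eigen_HH_presents)
  show "subspace (Zs r)"
    by (auto simp: subspace_def d.add d.scale d.zero N_zero N_add N_scale)
  show "subspace (Bs r)"
    unfolding subspace_def
  proof (intro conjI allI ballI)
    show "0 \<in> Bs r" by (auto intro!: exI[of _ 0] simp: d.zero N_zero)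
    fix x y k assume "x \<in> Bs r"
    then obtain z where z: "x - small_d (Suc r) z \<in> N (tw r)" by blast
    have "scale k x - small_d (Suc r) (scale k z) \<in> N (tw r)"
      using N_scale[OF z, of k] by (simp add: d.scale scale_right_diff_distrib)
    then show "scale k x \<in> Bs r" by blast
    assume "y \<in> Bs r"
    then obtain z' where z': "y - small_d (Suc r) z' \<in> N (tw r)" by blast
    have "x + y - small_d (Suc r) (z + z') \<in> N (tw r)"
      using N_add[OF z z'] by (simp add: d.add algebra_simps)
    then show "x + y \<in> Bs r" by blast
  qed
  show "Vector_Spaces.linear scale scale (component h)" if "h \<in> {1..s}" for h
    using that by (rule component_linear)
  show "component h x \<in> Zc (\<omega> h) r" if h: "h \<in> {1..s}" and x: "x \<in> Zs r" for h x
  proof -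
    have "component h (small_d r x) \<in> N (tw (r - 1))" if "r \<noteq> 0"
      using x h that N_component by blast
    then show ?thesis using component_eig[OF h] by (auto simp only: small_d_component[OF h] mem_Collect_eq)
  qed
  show "\<exists>x\<in>Zs r. \<forall>h\<in>{1..s}. component h x = f h" if f: "\<And>h. h \<in> {1..s} \<Longrightarrow> f h \<in> Zc (\<omega> h) r" for f
  proof -
    let ?x = "\<Sum>h\<in>{1..s}. f h"
    have comp: "component h ?x = f h" if "h \<in> {1..s}" for h
      using f that by (intro component_unique) auto
    have "component h (small_d r ?x) \<in> N (tw (r - 1))" if "r \<noteq> 0" "h \<in> {1..s}" for h
      unfolding small_d_component[OF that(2)] comp[OF that(2)] using f[OF that(2)] that(1) by blast
    then have "?x \<in> Zs r" using N_component by blast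
    then show ?thesis using comp by blast
  qed
  show "x \<in> Bs r \<longleftrightarrow> (\<forall>h\<in>{1..s}. component h x \<in> Bc (\<omega> h) r)" for x
  proof
    assume "x \<in> Bs r"
    then obtain z where z: "x - small_d (Suc r) z \<in> N (tw r)" by blast
    show "\<forall>h\<in>{1..s}. component h x \<in> Bc (\<omega> h) r"
    proof
      fix h assume h: "h \<in> {1..s}"
      interpret p: Vector_Spaces.linear scale scale "component h" using h by (rule component_linear)
      let ?v = "component h (x - small_d (Suc r) z)"
      have "?v \<in> N (tw r)" "?v \<in> Eig (\<omega> h)" using z h N_component component_eig by blast+
      moreover have "component h x = eig_map (\<omega> h) (Suc r) (component h z) + ?v"
        unfolding p.diff small_d_component[OF h] by simp
      ultimately show "component h x \<in> Bc (\<omega> h) r" using component_eig[OF h] by blast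
    qed
  next
    assume "\<forall>h\<in>{1..s}. component h x \<in> Bc (\<omega> h) r"
    then have "\<forall>h\<in>{1..s}. \<exists>y. y \<in> Eig (\<omega> h) \<and> component h x - eig_map (\<omega> h) (Suc r) y \<in> N (tw r)"
      by (auto simp only: mem_Collect_eq) (metis add_diff_cancel_left')
    then obtain y where y: "\<And>h. h \<in> {1..s} \<Longrightarrow> y h \<in> Eig (\<omega> h)"
      "\<And>h. h \<in> {1..s} \<Longrightarrow> component h x - eig_map (\<omega> h) (Suc r) (y h) \<in> N (tw r)" by metis
    have "small_d (Suc r) (\<Sum>h\<in>{1..s}. y h) = (\<Sum>h\<in>{1..s}. eig_map (\<omega> h) (Suc r) (y h))"
      unfolding d.sum by (intro sum.cong refl small_d_eig y)
    then have "x - small_d (Suc r) (\<Sum>h\<in>{1..s}. y h)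
      = (\<Sum>h\<in>{1..s}. component h x - eig_map (\<omega> h) (Suc r) (y h))"
      by (simp only: sum_subtractf component_sum)
    also have "\<dots> \<in> N (tw r)" by (intro N_sum y)
    finally show "x \<in> Bs r" by blast
  qed
qed simp

lemma relative_HH_presents:
  "\<exists>cl. presents (relative_HH A \<iota> r) free_scale {c \<in> free_space r. r = 0 \<or> bd r c \<in> R (r - 1)}
     {b + v |b v. b \<in> bd (Suc r) ` free_space (Suc r) \<and> v \<in> R r} cl"
  unfolding relative_HH_def
  by (rule exI, rule free.presents_homology)
    (use bd_free bd_R in \<open>auto simp: free_space_subspace R_subspace R_free bd_linear hochschild_chains_def
        hochschild_boundary_def free_chains_def fun_eq_iff simp del: mem_Collect_eq\<close>)

lemma relative_HH_direct_sum:
  "\<exists>\<phi>. module_isomorphism (relative_HH A \<iota> r)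
     (direct_sum_module {1..s} (\<lambda>h. eigen_HH scale \<alpha> n lam (\<omega> h) r)) \<phi>"
proof -
  let ?B = "{b + v |b v. b \<in> bd (Suc r) ` free_space (Suc r) \<and> v \<in> R r}"
  have B_iff: "c \<in> ?B \<longleftrightarrow> (\<exists>w\<in>free_space (Suc r). chain_cong r c (bd (Suc r) w))" for c
  proof
    assume "c \<in> ?B"
    then show "\<exists>w\<in>free_space (Suc r). chain_cong r c (bd (Suc r) w)" by (auto simp: chain_cong_def)
  next
    assume "\<exists>w\<in>free_space (Suc r). chain_cong r c (bd (Suc r) w)"
    then obtain w where w: "w \<in> free_space (Suc r)" "c - bd (Suc r) w \<in> R r" by (auto simp: chain_cong_def)
    then show "c \<in> ?B"
      by (intro CollectI exI[of _ "bd (Suc r) w"] exI[of _ "c - bd (Suc r) w"]) auto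
  qed
  have R_B: "v \<in> ?B" if "v \<in> R r" for v
    unfolding B_iff using that by (intro bexI[of _ 0]) (simp_all add: bd.zero cong_zero_iff)
  obtain cl where P: "presents (relative_HH A \<iota> r) free_scale {c \<in> free_space r. r = 0 \<or> bd r c \<in> R (r - 1)} ?B cl"
    using relative_HH_presents by blast
  have "\<exists>\<phi>. module_isomorphism (relative_HH A \<iota> r)
     (direct_sum_module {1..s} (\<lambda>h. eigen_HH scale \<alpha> n lam (\<omega> h) r)) \<phi> \<and>
     (\<forall>y\<in>Zs r. \<phi> (cl (small_to_bar r y))
       = (\<lambda>h\<in>{1..s}. eigen_class scale \<alpha> n lam (\<omega> h) r (component h y)))"
  proof (rule presents_isomorphic[OF P direct_sum_presents free.vector_space_axioms vector_space_axioms])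
    fix x assume x: "x \<in> Zs r"
    have "bd r (small_to_bar r x) \<in> R (r - 1)" if "r \<noteq> 0"
    proof -
      obtain r' where r': "r = Suc r'" using \<open>r \<noteq> 0\<close> by (cases r) auto
      then have "small_to_bar r' (small_d r x) \<in> R r'" using x small_to_bar_N by simp
      then have "chain_cong r' (small_to_bar r' (small_d (Suc r') x)) 0"
        by (simp add: r' cong_zero_iff)
      from cong_trans[OF chain_map this] show ?thesis by (simp add: r' cong_zero_iff)
    qed
    then show "small_to_bar r x \<in> {c \<in> free_space r. r = 0 \<or> bd r c \<in> R (r - 1)}"
      using small_to_bar_free by blast
    show "small_to_bar r x \<in> ?B \<longleftrightarrow> x \<in> Bs r"
    proof
      assume "small_to_bar r x \<in> ?B"
      then show "x \<in> Bs r" using small_to_bar_boundary unfolding B_iff by blast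
    next
      assume "x \<in> Bs r"
      then show "small_to_bar r x \<in> ?B"
        using small_to_bar_of_boundary small_to_bar_free unfolding B_iff by blast
    qed
    fix c
    show "small_to_bar r (scale c x) - free_scale c (small_to_bar r x) \<in> ?B"
      using small_to_bar_scale by (intro R_B) (simp add: chain_cong_def)
    fix y
    show "small_to_bar r (x + y) - (small_to_bar r x + small_to_bar r y) \<in> ?B"
      using small_to_bar_add by (intro R_B) (simp add: chain_cong_def)
  next
    fix z assume z: "z \<in> {c \<in> free_space r. r = 0 \<or> bd r c \<in> R (r - 1)}"
    then obtain y c' where yc: "c' \<in> free_space (Suc r)" "chain_cong r z (bd (Suc r) c' + small_to_bar r y)"
      "r = 0 \<or> small_d r y \<in> N (tw (r - 1))"
      using small_to_bar_onto[of z r] by blast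
    have "chain_cong r (z - small_to_bar r y) (bd (Suc r) c')"
      using yc(2) by (simp add: chain_cong_def algebra_simps)
    then show "\<exists>x\<in>Zs r. z - small_to_bar r x \<in> ?B"
      using yc unfolding B_iff by blast
  qed
  then show ?thesis by blast
qed

end

section \<open>The homology of a monogenic extension\<close>

theorem corollary2p7:
  fixes scale :: "'k::field \<Rightarrow> 'a::ring_1 \<Rightarrow> 'a"
    and \<alpha> :: "'a \<Rightarrow> 'a"
    and lam :: "nat \<Rightarrow> 'a"
    and n s :: nat
    and \<omega> :: "nat \<Rightarrow> 'k"
  assumes alg: "k_algebra scale"
    and endo: "algebra_endomorphism scale \<alpha>"
    and n_ge_2: "n \<ge> 2"
    and monic: "lam 0 = 1"
    and lam_fixed: "\<And>i. 1 \<le> i \<Longrightarrow> i \<le> n \<Longrightarrow> \<alpha> (lam i) = lam i"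
    and lam_comm: "\<And>i y. 1 \<le> i \<Longrightarrow> i \<le> n \<Longrightarrow> lam i * y = (\<alpha> ^^ i) y * lam i"
    and breve: "\<exists>z \<in> ring_center. (\<alpha> ^^ n) z = z \<and>
                  (\<forall>i. 1 \<le> i \<and> i < n \<longrightarrow> invertible_element (z - (\<alpha> ^^ i) z))"
    and diag: "diagonalizable scale \<alpha>"
    and eigenvals: "eigenvalues scale \<alpha> = \<omega> ` {1..s}"
    and distinct: "inj_on \<omega> {1..s}"
    and omega_1: "\<omega> 1 = 1"
  shows
    "(\<forall>r. \<exists>\<phi>. module_isomorphism
        (relative_HH (monogenic_extension scale \<alpha> n lam) (monogenic_incl scale \<alpha> n lam) r)
        (direct_sum_module {1..s} (\<lambda>h. eigen_HH scale \<alpha> n lam (\<omega> h) r)) \<phi>) \<and>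
     (\<forall>h\<in>{1..s}.
        (if h = 1
         then eigen_HH_equals scale \<alpha> n lam (\<omega> h) 0
                (eigenspace scale \<alpha> 1) (eigen_commutators scale \<alpha> 1 0)
         else eigen_HH_equals scale \<alpha> n lam (\<omega> h) 0
                (eigenspace scale \<alpha> (\<omega> h))
                {u + y * lam n |u y. u \<in> eigen_commutators scale \<alpha> (\<omega> h) 0 \<and>
                                     y \<in> eigenspace scale \<alpha> (\<omega> h)}) \<and>
        (\<forall>m.
          (if h \<noteq> 1 \<and> \<omega> h ^ n = 1
           then eigen_HH_equals scale \<alpha> n lam (\<omega> h) (2 * m + 1)
                  {y \<in> eigenspace scale \<alpha> (\<omega> h).
                     y * lam n \<in> eigen_commutators scale \<alpha> (\<omega> h) (m * n)}
                  (eigen_commutators scale \<alpha> (\<omega> h) ((m + 1) * n))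
           else module_is_zero (eigen_HH scale \<alpha> n lam (\<omega> h) (2 * m + 1))) \<and>
          (if h \<noteq> 1 \<and> \<omega> h ^ n = 1
           then eigen_HH_equals scale \<alpha> n lam (\<omega> h) (2 * m + 2)
                  (eigenspace scale \<alpha> (\<omega> h))
                  {u + y * lam n |u y. u \<in> eigen_commutators scale \<alpha> (\<omega> h) ((m + 1) * n) \<and>
                                       y \<in> eigenspace scale \<alpha> (\<omega> h)}
           else module_is_zero (eigen_HH scale \<alpha> n lam (\<omega> h) (2 * m + 2)))))"
proof -
  interpret k_algebra scale by (rule alg)
  interpret diagonal_monogenic scale \<alpha> n lam s \<omega>
    by unfold_locales (use assms in auto)
  have one: "h = 1 \<longleftrightarrow> \<omega> h = 1" if "h \<in> {1..s}" for h
    using inj_onD[OF distinct, of h 1] omega_1 that by auto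
  show ?thesis
  proof (intro conjI allI ballI)
    show "\<exists>\<phi>. module_isomorphism (relative_HH A \<iota> r)
        (direct_sum_module {1..s} (\<lambda>h. eigen_HH scale \<alpha> n lam (\<omega> h) r)) \<phi>" for r
      by (rule relative_HH_direct_sum)
  qed (use HH_0 HH_odd HH_even one omega_1 in \<open>simp_all only:\<close>)
qed

end
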